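(* Assume hypothesis $(\mathrm{H}_3)$: for every $n\ge3$, every $\rho\in[-1,0]$ and every measurable $f:\mathbb{R}^n\to B^3$, $\mathrm{Stab}_\rho[f]\ge\mathrm{Stab}_\rho[f^{(3)}_{\mathrm{opt}}]$ with $f^{(3)}_{\mathrm{opt}}(x)=(x_1,x_2,x_3)/\|(x_1,x_2,x_3)\|$. Then \[\inf_G\frac{\mathrm{QMaxCut}(G)}{\mathrm{SDP}_{\mathrm{QMC}}(G)}=\alpha_{\mathrm{GP}},\] the infimum being over all weighted graphs $G$ without self-loops.
   Context: $\mathrm{Stab}_\rho[f]=\mathbb{E}_{\mathbf{x}\sim_\rho\mathbf{y}}\langle f(\mathbf{x}),f(\mathbf{y})\rangle$ for $\rho$-correlated standard Gaussians. A weighted graph $G=(V,E,w)$ is a finite undirected graph with nonnegative edge weights summing to $1$. With Pauli matrices $X,Y,Z$, $h=\tfrac14(I\otimes I-X\otimes X-Y\otimes Y-Z\otimes Z)$, $H_G=\sum_{(u,v)\in E}w_{u,v}h_{u,v}$ on $(\mathbb{C}^2)^{\otimes V}$, and $\mathrm{QMaxCut}(G)=\lambda_{\max}(H_G)$. $\mathrm{SDP}_{\mathrm{QMC}}(G)=\max_{f:V\to S^{|V|-1}}\mathbb{E}_{(\mathbf{u},\mathbf{v})\sim E}[\tfrac14-\tfrac34\langle f(\mathbf{u}),f(\mathbf{v})\rangle]$. $F^*(3,\rho)=\mathbb{E}\langle\mathbf{Z}u/\|\mathbf{Z}u\|,\mathbf{Z}v/\|\mathbf{Z}v\|\rangle$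 for unit vectors $u,v$ with $\langle u,v\rangle=\rho$ and $\mathbf{Z}$ a $3\times m$ matrix of i.i.d. standard Gaussians, and $\alpha_{\mathrm{GP}}=\min_{-1\le\rho<1/3}\frac{\frac14-\frac14F^*(3,\rho)}{\frac14-\frac34\rho}$ ($\approx0.498$). *)

theory Defs
  imports "HOL-Probability.Probability" "Jordan_Normal_Form.Char_Poly"
begin

definition gauss :: "nat \<Rightarrow> (nat \<Rightarrow> real) measure" where
  "gauss n = PiM {..<n} (\<lambda>_. density lborel std_normal_density)"

text \<open>If x, z are independent standard Gaussians, then x and
  rho x + sqrt(1 - rho^2) z are rho-correlated standard Gaussians.\<close>

definition corr :: "nat \<Rightarrow> real \<Rightarrow> (nat \<Rightarrow> real) \<Rightarrow> (nat \<Rightarrow> real) \<Rightarrow> (nat \<Rightarrow> real)" where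
  "corr n \<rho> x z = (\<lambda>i\<in>{..<n}. \<rho> * x i + sqrt (1 - \<rho>\<^sup>2) * z i)"

definition Stab :: "nat \<Rightarrow> real \<Rightarrow> ((nat \<Rightarrow> real) \<Rightarrow> real^3) \<Rightarrow> real" where
  "Stab n \<rho> f =
     (\<integral>p. inner (f (fst p)) (f (corr n \<rho> (fst p) (snd p))) \<partial>(gauss n \<Otimes>\<^sub>M gauss n))"

definition f_opt3 :: "(nat \<Rightarrow> real) \<Rightarrow> real^3" where
  "f_opt3 x = (let v = (vector [x 0, x 1, x 2] :: real^3) in (1 / norm v) *\<^sub>R v)"

definition H3 :: bool where
  "H3 \<longleftrightarrow> (\<forall>n \<ge> 3. \<forall>\<rho> \<in> {-1..0}. \<forall>f.
      f \<in> borel_measurable (PiM {..<n} (\<lambda>_. borel)) \<and>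
      (\<forall>x \<in> space (PiM {..<n} (\<lambda>_. (borel :: real measure))). norm (f x) \<le> 1)
      \<longrightarrow> Stab n \<rho> f \<ge> Stab n \<rho> f_opt3)"

text \<open>Z is a 3 x m matrix of i.i.d. standard Gaussians; we take m = 2 and the unit
  vectors u = (1,0), v = (rho, sqrt(1-rho^2)), so that <u,v> = rho.\<close>

definition gauss_mat :: "(real^2^3) measure" where
  "gauss_mat = density lborel (\<lambda>Z. \<Prod>i\<in>UNIV. \<Prod>j\<in>UNIV. std_normal_density (Z $ i $ j))"

definition F_star3 :: "real \<Rightarrow> real" where
  "F_star3 \<rho> =
     (let u = (vector [1, 0] :: real^2); v = (vector [\<rho>, sqrt (1 - \<rho>\<^sup>2)] :: real^2) in
      \<integral>Z. inner ((1 / norm (Z *v u)) *\<^sub>R (Z *v u)) ((1 / norm (Z *v v)) *\<^sub>R (Z *v v)) \<partial>gauss_mat)"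

definition alpha_GP :: real where
  "alpha_GP = (INF \<rho> \<in> {-1..<1/3}. (1/4 - 1/4 * F_star3 \<rho>) / (1/4 - 3/4 * \<rho>))"

text \<open>A weighted graph on vertex set {..<n}: edges are unordered pairs {u,v},
  u \<noteq> v, encoded as (u,v) with u < v < n (so no self-loops); weights are
  nonnegative and sum to 1.\<close>

definition edges :: "nat \<Rightarrow> (nat \<times> nat) set" where
  "edges n = {(u, v). u < v \<and> v < n}"

definition weighted_graph :: "nat \<Rightarrow> (nat \<times> nat \<Rightarrow> real) \<Rightarrow> bool" where
  "weighted_graph n w \<longleftrightarrow> (\<forall>e \<in> edges n. w e \<ge> 0) \<and> (\<Sum>e\<in>edges n. w e) = 1"

definition pauliI :: "complex mat" where "pauliI = mat_of_rows_list 2 [[1, 0], [0, 1]]"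
definition pauliX :: "complex mat" where "pauliX = mat_of_rows_list 2 [[0, 1], [1, 0]]"
definition pauliY :: "complex mat" where "pauliY = mat_of_rows_list 2 [[0, -\<i>], [\<i>, 0]]"
definition pauliZ :: "complex mat" where "pauliZ = mat_of_rows_list 2 [[1, 0], [0, -1]]"

text \<open>Computational basis of (C^2)^{\<otimes> n}: index i < 2^n, qubit k holds bit (i div 2^k) mod 2.
  The tensor product of 2x2 operators A_0 \<otimes> ... \<otimes> A_{n-1} has entries
  \<Prod>k<n. A_k[i_k, j_k].\<close>

definition qbit :: "nat \<Rightarrow> nat \<Rightarrow> nat" where
  "qbit i k = (i div 2 ^ k) mod 2"

definition tensor_ops :: "nat \<Rightarrow> (nat \<Rightarrow> complex mat) \<Rightarrow> complex mat" where
  "tensor_ops n A = mat (2 ^ n) (2 ^ n) (\<lambda>(i, j). \<Prod>k<n. (A k) $$ (qbit i k, qbit j k))"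

definition two_site :: "nat \<Rightarrow> complex mat \<Rightarrow> nat \<Rightarrow> nat \<Rightarrow> complex mat" where
  "two_site n P u v = tensor_ops n (\<lambda>k. if k = u \<or> k = v then P else pauliI)"

definition h_edge :: "nat \<Rightarrow> nat \<Rightarrow> nat \<Rightarrow> complex mat" where
  "h_edge n u v = (1/4 :: complex) \<cdot>\<^sub>m
     (tensor_ops n (\<lambda>_. pauliI) - two_site n pauliX u v - two_site n pauliY u v - two_site n pauliZ u v)"

definition H_G :: "nat \<Rightarrow> (nat \<times> nat \<Rightarrow> real) \<Rightarrow> complex mat" where
  "H_G n w = mat (2 ^ n) (2 ^ n)
     (\<lambda>(i, j). \<Sum>e\<in>edges n. complex_of_real (w e) * h_edge n (fst e) (snd e) $$ (i, j))"

definition lambda_max :: "complex mat \<Rightarrow> real" where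
  "lambda_max M = Max {x :: real. eigenvalue M (complex_of_real x)}"

definition QMaxCut :: "nat \<Rightarrow> (nat \<times> nat \<Rightarrow> real) \<Rightarrow> real" where
  "QMaxCut n w = lambda_max (H_G n w)"

definition sphere_maps :: "nat \<Rightarrow> (nat \<Rightarrow> nat \<Rightarrow> real) set" where
  "sphere_maps n = {f. \<forall>u<n. (\<forall>i\<ge>n. f u i = 0) \<and> (\<Sum>i<n. (f u i)\<^sup>2) = 1}"

definition SDP_QMC :: "nat \<Rightarrow> (nat \<times> nat \<Rightarrow> real) \<Rightarrow> real" where
  "SDP_QMC n w = (SUP f \<in> sphere_maps n.
      \<Sum>e\<in>edges n. w e * (1/4 - 3/4 * (\<Sum>i<n. f (fst e) i * f (snd e) i)))"

end

theory Submission
  imports Defs "Jordan_Normal_Form.Spectral_Radius" "Jordan_Normal_Form.Jordan_Normal_Form_Existence"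
begin

text \<open>Lower bound: rounding SDP vectors \<open>f u\<close> with a Gaussian matrix \<open>Z\<close> to the product state with
  Bloch vectors \<open>Z (f u) / |Z (f u)|\<close> has expected energy \<open>1/4 - F(\<rho>)/4\<close> on an edge of inner product
  \<open>\<rho>\<close>, which is at least \<open>\<alpha> (1/4 - 3\<rho>/4)\<close>.

  Upper bound: for \<open>\<rho> \<le> 0\<close>, partition the directions of Gaussian space of large dimension into small
  cells, weight two cells by the probability that they are hit by a \<open>\<rho>\<close>-correlated pair, and replace each
  cell by a cloud of many copies. Cell directions are SDP vectors of value close to \<open>1/4 - 3\<rho>/4\<close>, while by
  the hypothesis no assignment of Bloch vectors to cells beats \<open>1/4 - F(\<rho>)/4\<close>. Entanglement does not help on
  the blown-up graph: measure every qubit along a random Pauli axis and record \<open>3\<close> times the signed axis.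
  Outcomes of distinct qubits have the right correlations, and conditioning on the outcomes of a few qubits
  chosen greedily makes the cloud averages almost deterministic. The conditional averages are then Bloch
  vectors of a product state of nearly the same energy. For \<open>0 < \<rho> < 1/3\<close> the ratio is at least \<open>1/2\<close>,
  which is its value at \<open>\<rho> = -1\<close>.\<close>

subsection \<open>Product operators and Pauli measurements\<close>

text \<open>The obstacle in the upper bound is that \<open>QMaxCut\<close> maximises over entangled
  states, whereas the hypothesis speaks only of functions into the ball, that is, of product states.
  Cloud averages bridge the gap: the conditioning set needed for accuracy \<eta> has size at most
  \<open>K * N\<close>, with K depending on \<eta> alone and N the number of cells, so among M
  copies per cloud it touches a vanishing fraction. The clouds also absorb the self-loops that arise
  when a correlated pair lands in a single cell. The factor 3 undoes the probability 1/3 with which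
  each axis is measured; its price is outcome vectors of squared length 9, the source of the
  constants 9 and 81. Large dimension is needed on the SDP side alone: there the norm of a Gaussian
  concentrates, so normalised correlated vectors have mean inner product close to \<rho>, while the
  optimal field of the hypothesis always lives in three coordinates. The limits are therefore taken
  in the order M, then \<eta>, then the dimension. The range of \<rho> splits at 0 because the
  hypothesis covers only [-1,0].\<close>

lemma qbit_less [simp]: "qbit i k < 2"
  by (simp add: qbit_def)

lemma sum_lessThan_2: "(\<Sum>i<2. f i) = f 0 + f (Suc 0)" for f :: "nat \<Rightarrow> 'a::comm_monoid_add"
  by (simp add: numeral_2_eq_2)

text \<open>Distributivity, since an index below \<open>2^n\<close> is the same as a choice of n
  bits. The induction peels off the top bit: j and \<open>j + 2^n\<close> agree in all lower bits
  and differ in bit n.\<close>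

lemma sum_qbit_prod:
  fixes f :: "nat \<Rightarrow> nat \<Rightarrow> 'a::comm_semiring_1"
  shows "(\<Sum>j<2^n. \<Prod>k<n. f k (qbit j k)) = (\<Prod>k<n. \<Sum>b<2. f k b)"
proof (induction n)
  case 0
  show ?case by simp
next
  case (Suc n)
  have low: "qbit (j + 2^n) k = qbit j k" if kn: "k < n" for j k
  proof -
    obtain d where d: "n = k + Suc d" using less_imp_Suc_add[OF kn] by auto
    have "(j + 2^n) div 2^k = j div 2^k + 2 * 2^d"
      unfolding d by (simp add: power_add mult.left_commute[of 2] div_mult_self2)
    then show ?thesis unfolding qbit_def by (simp add: mod_add_right_eq)
  qed
  have split: "(\<Sum>j<m + m. g j) = (\<Sum>j<m. g j) + (\<Sum>j<m. g (j + m))" for g :: "nat \<Rightarrow> 'a" and m :: nat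
    using sum.atLeastLessThan_concat[of 0 m "m + m" g] sum.shift_bounds_nat_ivl[of g 0 m m]
    by (simp add: atLeast0LessThan)
  have "(\<Sum>j<2^Suc n. \<Prod>k<Suc n. f k (qbit j k)) =
     (\<Sum>j<2^n. \<Prod>k<Suc n. f k (qbit j k)) + (\<Sum>j<2^n. \<Prod>k<Suc n. f k (qbit (j + 2^n) k))"
    using split[of "\<lambda>j. \<Prod>k<Suc n. f k (qbit j k)" "2^n"] by (simp only: power_Suc mult_2)
  also have "(\<Sum>j<2^n. \<Prod>k<Suc n. f k (qbit j k)) = (\<Sum>j<2^n. (\<Prod>k<n. f k (qbit j k)) * f n 0)"
    by (intro sum.cong) (auto simp: qbit_def)
  also have "(\<Sum>j<2^n. \<Prod>k<Suc n. f k (qbit (j + 2^n) k)) = (\<Sum>j<2^n. (\<Prod>k<n. f k (qbit j k)) * f n 1)"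
  proof (intro sum.cong refl)
    fix j :: nat assume "j \<in> {..<2^n}"
    then have "qbit (j + 2^n) n = 1" by (auto simp: qbit_def)
    moreover have "(\<Prod>k<n. f k (qbit (j + 2^n) k)) = (\<Prod>k<n. f k (qbit j k))"
      by (intro prod.cong) (auto simp: low)
    ultimately show "(\<Prod>k<Suc n. f k (qbit (j + 2^n) k)) = (\<Prod>k<n. f k (qbit j k)) * f n 1"
      by simp
  qed
  also have "(\<Sum>j<2^n. (\<Prod>k<n. f k (qbit j k)) * f n 0) + (\<Sum>j<2^n. (\<Prod>k<n. f k (qbit j k)) * f n 1) =
      (\<Prod>k<n. \<Sum>b<2. f k b) * (f n 0 + f n 1)"
    by (simp only: sum_distrib_right[symmetric] distrib_left Suc.IH)
  also have "\<dots> = (\<Prod>k<Suc n. \<Sum>b<2. f k b)" by (simp add: sum_lessThan_2)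
  finally show ?case .
qed

lemma sum_qbit_prod2:
  fixes f :: "nat \<Rightarrow> nat \<Rightarrow> nat \<Rightarrow> 'a::comm_semiring_1"
  shows "(\<Sum>i<2^n. \<Sum>j<2^n. \<Prod>k<n. f k (qbit i k) (qbit j k)) = (\<Prod>k<n. \<Sum>a<2. \<Sum>b<2. f k a b)"
proof -
  have "(\<Sum>i<2^n. \<Sum>j<2^n. \<Prod>k<n. f k (qbit i k) (qbit j k)) =
    (\<Sum>i<2^n. \<Prod>k<n. \<Sum>b<2. f k (qbit i k) b)"
    by (intro sum.cong refl sum_qbit_prod)
  also have "\<dots> = (\<Prod>k<n. \<Sum>a<2. \<Sum>b<2. f k a b)"
    by (rule sum_qbit_prod)
  finally show ?thesis .
qed

text \<open>Injectivity of the binary expansion, by peeling off the lowest bit. It makes a product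
  of local identity matrices the global identity.\<close>

lemma qbit_eq_iff: "i < 2^n \<Longrightarrow> j < 2^n \<Longrightarrow> (\<forall>k<n. qbit i k = qbit j k) \<longleftrightarrow> i = j"
proof (induction n arbitrary: i j)
  case (Suc n)
  have s: "qbit i (Suc k) = qbit (i div 2) k" for i k
    by (simp add: qbit_def div_mult2_eq)
  have "(\<forall>k<Suc n. qbit i k = qbit j k) \<longleftrightarrow> qbit i 0 = qbit j 0 \<and> (\<forall>k<n. qbit (i div 2) k = qbit (j div 2) k)"
    by (auto simp: less_Suc_eq_0_disj s)
  also have "\<dots> \<longleftrightarrow> i mod 2 = j mod 2 \<and> i div 2 = j div 2"
    using Suc by (subst Suc.IH) (auto simp: qbit_def)
  also have "\<dots> \<longleftrightarrow> i = j"
  proof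
    assume *: "i mod 2 = j mod 2 \<and> i div 2 = j div 2"
    have "i = 2 * (i div 2) + i mod 2" by simp
    also have "\<dots> = 2 * (j div 2) + j mod 2" by (simp only: *)
    finally show "i = j" by simp
  qed simp
  finally show ?case .
qed simp

section \<open>Quadratic forms of product operators\<close>

definition tensor_form :: "nat \<Rightarrow> (nat \<Rightarrow> complex) \<Rightarrow> (nat \<Rightarrow> nat \<Rightarrow> nat \<Rightarrow> complex) \<Rightarrow> complex" where
  "tensor_form n \<psi> A = (\<Sum>i<2^n. \<Sum>j<2^n. cnj (\<psi> i) * \<psi> j * (\<Prod>k<n. A k (qbit i k) (qbit j k)))"

text \<open>Positive semidefiniteness of a 2 by 2 matrix, phrased as a factorisation into a matrix
  and its conjugate transpose because such factors multiply across tensor products. Only indices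
  below 2 are constrained.\<close>

definition gram2 :: "(nat \<Rightarrow> nat \<Rightarrow> complex) \<Rightarrow> bool" where
  "gram2 A \<longleftrightarrow> (\<exists>B :: nat \<Rightarrow> nat \<Rightarrow> complex. \<forall>a<2. \<forall>b<2. A a b = (\<Sum>l<2. cnj (B l a) * B l b))"

lemma tensor_form_cong:
  assumes "\<And>k a b. k < n \<Longrightarrow> a < 2 \<Longrightarrow> b < 2 \<Longrightarrow> A k a b = A' k a b"
  shows "tensor_form n \<psi> A = tensor_form n \<psi> A'"
  unfolding tensor_form_def using assms by (intro sum.cong refl arg_cong2[where f="(*)"] prod.cong) auto

text \<open>The factors of the tensor product are products of the local factors; the summation index
  \<open>l\<close> is read through its bits as a string of local indices.\<close>

lemma gram2_tensor:
  assumes "\<And>k. k < n \<Longrightarrow> gram2 (A k)"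
  shows "\<exists>b :: nat \<Rightarrow> nat \<Rightarrow> complex.
    \<forall>i j. (\<Prod>k<n. A k (qbit i k) (qbit j k)) = (\<Sum>l<2^n. cnj (b l i) * b l j)"
proof -
  obtain B :: "nat \<Rightarrow> nat \<Rightarrow> nat \<Rightarrow> complex" where B: "\<And>k a b. k < n \<Longrightarrow> a < 2 \<Longrightarrow> b < 2 \<Longrightarrow> A k a b = (\<Sum>l<2. cnj (B k l a) * B k l b)"
    using assms unfolding gram2_def by metis
  have "(\<Prod>k<n. A k (qbit i k) (qbit j k)) =
     (\<Sum>l<2^n. cnj (\<Prod>k<n. B k (qbit l k) (qbit i k)) * (\<Prod>k<n. B k (qbit l k) (qbit j k)))" for i j
  proof -
    have "(\<Prod>k<n. A k (qbit i k) (qbit j k)) =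
        (\<Prod>k<n. \<Sum>l<2. cnj (B k l (qbit i k)) * B k l (qbit j k))"
      by (intro prod.cong refl) (auto simp: B)
    also have "\<dots> = (\<Sum>l<2^n. \<Prod>k<n. cnj (B k (qbit l k) (qbit i k)) * B k (qbit l k) (qbit j k))"
      by (rule sum_qbit_prod[symmetric])
    finally show ?thesis by (simp add: prod.distrib)
  qed
  then show ?thesis by (intro exI[of _ "\<lambda>l i. \<Prod>k<n. B k (qbit l k) (qbit i k)"] allI)
qed

text \<open>Inserting the factorisation turns the form into a sum over \<open>l\<close> of squared
  moduli of pairings of \<psi> with the l-th factor.\<close>

lemma tensor_form_nonneg:
  assumes "\<And>k. k < n \<Longrightarrow> gram2 (A k)"
  shows "tensor_form n \<psi> A \<in> \<real>" "0 \<le> Re (tensor_form n \<psi> A)"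
proof -
  obtain b :: "nat \<Rightarrow> nat \<Rightarrow> complex" where b: "\<And>i j. (\<Prod>k<n. A k (qbit i k) (qbit j k)) = (\<Sum>l<2^n. cnj (b l i) * b l j)"
    using gram2_tensor[of n A] assms by auto
  have "tensor_form n \<psi> A = (\<Sum>i<2^n. \<Sum>j<2^n. \<Sum>l<2^n. cnj (\<psi> i * b l i) * (\<psi> j * b l j))"
    unfolding tensor_form_def b sum_distrib_left by (intro sum.cong) (auto simp: algebra_simps)
  also have "\<dots> = (\<Sum>i<2^n. \<Sum>l<2^n. \<Sum>j<2^n. cnj (\<psi> i * b l i) * (\<psi> j * b l j))"
    by (intro sum.cong refl sum.swap)
  also have "\<dots> = (\<Sum>l<2^n. \<Sum>i<2^n. \<Sum>j<2^n. cnj (\<psi> i * b l i) * (\<psi> j * b l j))"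
    by (rule sum.swap)
  also have "\<dots> = (\<Sum>l<2^n. cnj (\<Sum>i<2^n. \<psi> i * b l i) * (\<Sum>j<2^n. \<psi> j * b l j))"
    by (simp only: sum_product cnj_sum)
  also have "\<dots> = (\<Sum>l<2^n. of_real ((cmod (\<Sum>i<2^n. \<psi> i * b l i))\<^sup>2))"
    by (simp only: complex_norm_square mult.commute)
  finally have eq: "tensor_form n \<psi> A = of_real (\<Sum>l<2^n. (cmod (\<Sum>i<2^n. \<psi> i * b l i))\<^sup>2)" by simp
  show "tensor_form n \<psi> A \<in> \<real>" unfolding eq by simp
  show "0 \<le> Re (tensor_form n \<psi> A)" unfolding eq by (simp add: sum_nonneg)
qed

section \<open>Bloch vectors and the random Pauli measurement\<close>

definition sigma :: "nat \<Rightarrow> nat \<Rightarrow> nat \<Rightarrow> complex" where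
  "sigma i a b = (if i = 0 then pauliX else if i = 1 then pauliY else pauliZ) $$ (a, b)"

text \<open>Twice the density matrix of the qubit state with Bloch vector r: with this normalisation
  the zero vector gives the identity.\<close>

definition bloch :: "(nat \<Rightarrow> real) \<Rightarrow> nat \<Rightarrow> nat \<Rightarrow> complex" where
  "bloch r a b = (if a = b then 1 else 0) + (\<Sum>i<3. of_real (r i) * sigma i a b)"

lemmas pauli_defs = pauliI_def pauliX_def pauliY_def pauliZ_def mat_of_rows_list_def

lemma sigma_simps [simp]:
  "sigma 0 0 0 = 0" "sigma 0 0 (Suc 0) = 1" "sigma 0 (Suc 0) 0 = 1" "sigma 0 (Suc 0) (Suc 0) = 0"
  "sigma (Suc 0) 0 0 = 0" "sigma (Suc 0) 0 (Suc 0) = -\<i>" "sigma (Suc 0) (Suc 0) 0 = \<i>" "sigma (Suc 0) (Suc 0) (Suc 0) = 0"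
  "sigma 2 0 0 = 1" "sigma 2 0 (Suc 0) = 0" "sigma 2 (Suc 0) 0 = 0" "sigma 2 (Suc 0) (Suc 0) = -1"
  by (simp_all add: sigma_def pauli_defs)

lemma less_2_iff: "(a::nat) < 2 \<longleftrightarrow> a = 0 \<or> a = Suc 0" by auto

lemma sum_lessThan_3: "(\<Sum>i<3. f i) = f 0 + f (Suc 0) + f 2" for f :: "nat \<Rightarrow> 'a::comm_monoid_add"
  by (simp add: numeral_3_eq_3 numeral_2_eq_2)

lemma pauliI_entry: "a < 2 \<Longrightarrow> b < 2 \<Longrightarrow> pauliI $$ (a, b) = (if a = b then 1 else 0)"
  by (auto simp: less_2_iff pauli_defs)

text \<open>Cholesky factorisation with pivot \<open>1 + r 2\<close>. The Schur complement
  \<open>d\<close> satisfies (1 + r_2) d = 1 - |r|^2, so the ball condition makes it nonnegative. A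
  zero pivot forces r to be the south pole, where the matrix is diagonal with entries 0 and
  2.\<close>

lemma gram2_bloch:
  assumes r: "(\<Sum>i<3. (r i)\<^sup>2) \<le> 1"
  shows "gram2 (bloch r)"
proof -
  have r': "(r 0)\<^sup>2 + (r (Suc 0))\<^sup>2 + (r 2)\<^sup>2 \<le> 1" using r by (simp add: sum_lessThan_3)
  have "(r 2)\<^sup>2 \<le> 1" using r' zero_le_power2[of "r 0"] zero_le_power2[of "r (Suc 0)"] by linarith
  then have r2: "\<bar>r 2\<bar> \<le> 1" using abs_le_square_iff[of "r 2" 1] by simp
  show ?thesis
  proof (cases "r 2 = -1")
    case True
    then have "(r 0)\<^sup>2 + (r 1)\<^sup>2 \<le> 0" using r' by simp
    then have "r 0 = 0" "r 1 = 0" by (auto simp: sum_power2_le_zero_iff)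
    with True show ?thesis unfolding gram2_def
      by (intro exI[of _ "\<lambda>l a. if l = 1 \<and> a = 1 then of_real (sqrt 2) else 0"])
        (auto simp: less_2_iff bloch_def sum_lessThan_3 sum_lessThan_2 of_real_mult[symmetric] simp del: of_real_mult)
  next
    case False
    define x where "x = sqrt (1 + r 2)"
    define d where "d = 1 - r 2 - ((r 0)\<^sup>2 + (r 1)\<^sup>2) / (1 + r 2)"
    have x: "x > 0" "x * x = 1 + r 2" using False r2 by (auto simp: x_def)
    have "(1 + r 2) * d = 1 - (r 2)\<^sup>2 - ((r 0)\<^sup>2 + (r 1)\<^sup>2)"
      using False by (simp add: d_def field_simps power2_eq_square)
    then have "0 \<le> (1 + r 2) * d" using r' by simp
    then have d: "d \<ge> 0" using False r2 by (auto simp: zero_le_mult_iff)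
    define z where "z = Complex (r 0) (- r 1)"
    define B where "B = (\<lambda>l a. if l = (0::nat) then (if a = (0::nat) then of_real x else z / of_real x)
       else (if a = 0 then 0 else of_real (sqrt d)))"
    have zz: "cnj z * z = of_real ((r 0)\<^sup>2 + (r 1)\<^sup>2)"
      by (simp add: z_def complex_eq_iff power2_eq_square)
    have xx: "complex_of_real x * of_real x = 1 + of_real (r 2)"
      using x(2) by (metis of_real_1 of_real_add of_real_mult)
    have b11: "cnj z * z / (of_real x * of_real x) + of_real (sqrt d) * of_real (sqrt d) = 1 - of_real (r 2)"
      using d unfolding zz of_real_mult[symmetric] x(2) of_real_divide[symmetric] of_real_add[symmetric]
      by (simp add: d_def)
    have "bloch r a b = (\<Sum>l<2. cnj (B l a) * B l b)" if "a < 2" "b < 2" for a b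
      using that x xx b11
      by (auto simp: less_2_iff bloch_def sum_lessThan_3 sum_lessThan_2 B_def z_def complex_eq_iff add_divide_distrib)
    then show ?thesis unfolding gram2_def by blast
  qed
qed

lemma gram2_scale: "gram2 A \<Longrightarrow> c \<ge> 0 \<Longrightarrow> gram2 (\<lambda>a b. of_real c * A a b)"
  unfolding gram2_def
proof (elim exE)
  fix B :: "nat \<Rightarrow> nat \<Rightarrow> complex" assume *: "\<forall>a<2. \<forall>b<2. A a b = (\<Sum>l<2. cnj (B l a) * B l b)" and c: "0 \<le> c"
  have "complex_of_real c = of_real (sqrt c) * of_real (sqrt c)"
    using c by (simp flip: of_real_mult)
  with * show "\<exists>B :: nat \<Rightarrow> nat \<Rightarrow> complex. \<forall>a<2. \<forall>b<2. of_real c * A a b = (\<Sum>l<2. cnj (B l a) * B l b)"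
    by (intro exI[of _ "\<lambda>l a. of_real (sqrt c) * B l a"])
      (auto simp: sum_distrib_left algebra_simps)
qed

definition outs :: "(nat \<times> bool) set" where "outs = {..<3} \<times> UNIV"

definition out_sgn :: "nat \<times> bool \<Rightarrow> real" where "out_sgn x = (if snd x then 1 else -1)"

text \<open>Each axis is measured with probability 1/3, so the factor 3 makes the mean of this
  vector equal to the Bloch vector of the measured qubit.\<close>

definition out_vec :: "nat \<times> bool \<Rightarrow> nat \<Rightarrow> real" where
  "out_vec x j = (if j = fst x then 3 * out_sgn x else 0)"

text \<open>One third, for the choice of the axis, times the spectral projection (I + sigma)/2 or (I
  - sigma)/2 of that Pauli matrix.\<close>

definition povm :: "nat \<times> bool \<Rightarrow> nat \<Rightarrow> nat \<Rightarrow> complex" where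
  "povm x a b = of_real (1/6) * bloch (\<lambda>j. if j = fst x then out_sgn x else 0) a b"

lemma finite_outs [simp]: "finite outs" by (simp add: outs_def)

lemma sum_outs: "(\<Sum>x\<in>outs. f x) = (\<Sum>i<3. f (i, True) + f (i, False))"
  for f :: "_ \<Rightarrow> 'a::comm_monoid_add"
  unfolding outs_def sum.cartesian_product' by (simp add: UNIV_bool add.commute)

lemma sum_single_3: "i < 3 \<Longrightarrow> (\<Sum>j<3. f j * (if j = i then c else 0)) = f i * c"
  for f :: "nat \<Rightarrow> 'a::semiring_0"
  by (subst sum.remove[of _ i]) auto

lemma gram2_povm:
  assumes "x \<in> outs"
  shows "gram2 (povm x)"
proof -
  have "(\<Sum>j<3. (if j = fst x then out_sgn x else 0)\<^sup>2) = (\<Sum>j<3. 1 * (if j = fst x then (1::real) else 0))"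
    by (intro sum.cong) (auto simp: out_sgn_def)
  also have "\<dots> = 1" using assms by (subst sum_single_3) (auto simp: outs_def)
  finally show ?thesis unfolding povm_def by (intro gram2_scale gram2_bloch) auto
qed

lemma povm_eq:
  assumes "i < 3"
  shows "povm (i, s) a b = ((if a = b then 1 else 0) + (if s then 1 else -1) * sigma i a b) / 6"
proof -
  have "(\<Sum>j<3. of_real (if j = i then out_sgn (i, s) else 0) * sigma j a b) =
     (\<Sum>j<3. sigma j a b * (if j = i then of_real (out_sgn (i, s)) else 0))"
    by (intro sum.cong) auto
  then show ?thesis using assms by (simp only: povm_def bloch_def fst_conv sum_single_3) (simp add: out_sgn_def)
qed

text \<open>The operator attached to an affine function of the outcome vector. Its instances give
  completeness (c = 1, v = 0), the Pauli matrix \<open>sigma j\<close> (c = 0, v the negative j-th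
  unit vector) and the positive operator I - r.sigma behind the Bloch ball bound (c = 1, v =
  r).\<close>

lemma sum_povm: "(\<Sum>x\<in>outs. of_real (c - (\<Sum>j<3. v j * out_vec x j)) * povm x a b) =
   of_real c * (if a = b then 1 else 0) - (\<Sum>j<3. of_real (v j) * sigma j a b)"
proof -
  have "(\<Sum>j<3. v j * out_vec (i, s) j) = v i * (3 * out_sgn (i, s))" if "i < 3" for i s
    using sum_single_3[OF that, of v] by (simp add: out_vec_def)
  then have "of_real (c - (\<Sum>j<3. v j * out_vec (i, True) j)) * povm (i, True) a b +
     of_real (c - (\<Sum>j<3. v j * out_vec (i, False) j)) * povm (i, False) a b =
     of_real c * (if a = b then 1 else 0) / 3 - of_real (v i) * sigma i a b" if "i < 3" for i
    using that by (simp add: povm_eq out_sgn_def field_simps)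
  then have "(\<Sum>x\<in>outs. of_real (c - (\<Sum>j<3. v j * out_vec x j)) * povm x a b) =
     (\<Sum>i<3. of_real c * (if a = b then 1 else 0) / 3 - of_real (v i) * sigma i a b)"
    unfolding sum_outs by (intro sum.cong) auto
  then show ?thesis by (simp add: sum_subtractf)
qed

text \<open>The joint law of the outcomes when every qubit is measured; for a unit vector \<psi> it
  is a classical probability on \<open>outcomes n\<close>.\<close>

definition born :: "nat \<Rightarrow> (nat \<Rightarrow> complex) \<Rightarrow> (nat \<Rightarrow> nat \<times> bool) \<Rightarrow> real" where
  "born n \<psi> \<omega> = Re (tensor_form n \<psi> (\<lambda>k. povm (\<omega> k)))"

abbreviation outcomes :: "nat \<Rightarrow> (nat \<Rightarrow> nat \<times> bool) set" where
  "outcomes n \<equiv> PiE {..<n} (\<lambda>_. outs)"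

text \<open>Expanding the product of the local sums enumerates the outcome strings, so the mean of a
  product of one-site functions is the form of a product of one-site operators.\<close>

lemma sum_born_prod:
  "(\<Sum>\<omega>\<in>outcomes n. (\<Prod>k<n. g k (\<omega> k)) * born n \<psi> \<omega>) =
   Re (tensor_form n \<psi> (\<lambda>k a b. \<Sum>x\<in>outs. of_real (g k x) * povm x a b))"
proof -
  have "tensor_form n \<psi> (\<lambda>k a b. \<Sum>x\<in>outs. of_real (g k x) * povm x a b) =
     (\<Sum>i<2^n. \<Sum>j<2^n. \<Sum>\<omega>\<in>outcomes n. of_real (\<Prod>k<n. g k (\<omega> k)) *
        (cnj (\<psi> i) * \<psi> j * (\<Prod>k<n. povm (\<omega> k) (qbit i k) (qbit j k))))"
    unfolding tensor_form_def
  proof (intro sum.cong refl)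
    fix i j :: nat
    have "(\<Prod>k<n. \<Sum>x\<in>outs. of_real (g k x) * povm x (qbit i k) (qbit j k)) =
       (\<Sum>\<omega>\<in>outcomes n. \<Prod>k<n. of_real (g k (\<omega> k)) * povm (\<omega> k) (qbit i k) (qbit j k))"
      by (rule prod_sum_PiE) auto
    also have "\<dots> = (\<Sum>\<omega>\<in>outcomes n. of_real (\<Prod>k<n. g k (\<omega> k)) * (\<Prod>k<n. povm (\<omega> k) (qbit i k) (qbit j k)))"
      by (simp only: prod.distrib of_real_prod)
    finally show "cnj (\<psi> i) * \<psi> j * (\<Prod>k<n. \<Sum>x\<in>outs. of_real (g k x) * povm x (qbit i k) (qbit j k)) =
      (\<Sum>\<omega>\<in>outcomes n. of_real (\<Prod>k<n. g k (\<omega> k)) *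
        (cnj (\<psi> i) * \<psi> j * (\<Prod>k<n. povm (\<omega> k) (qbit i k) (qbit j k))))"
      by (simp only: sum_distrib_left mult.left_commute)
  qed
  also have "\<dots> = (\<Sum>i<2^n. \<Sum>\<omega>\<in>outcomes n. \<Sum>j<2^n. of_real (\<Prod>k<n. g k (\<omega> k)) *
        (cnj (\<psi> i) * \<psi> j * (\<Prod>k<n. povm (\<omega> k) (qbit i k) (qbit j k))))"
    by (intro sum.cong refl sum.swap)
  also have "\<dots> = (\<Sum>\<omega>\<in>outcomes n. \<Sum>i<2^n. \<Sum>j<2^n. of_real (\<Prod>k<n. g k (\<omega> k)) *
        (cnj (\<psi> i) * \<psi> j * (\<Prod>k<n. povm (\<omega> k) (qbit i k) (qbit j k))))"
    by (rule sum.swap)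
  also have "\<dots> = (\<Sum>\<omega>\<in>outcomes n. of_real (\<Prod>k<n. g k (\<omega> k)) * tensor_form n \<psi> (\<lambda>k. povm (\<omega> k)))"
    by (simp add: tensor_form_def sum_distrib_left)
  finally show ?thesis by (simp add: born_def Re_sum del: of_real_prod)
qed

lemma born_nonneg: "\<omega> \<in> outcomes n \<Longrightarrow> 0 \<le> born n \<psi> \<omega>"
  unfolding born_def by (intro tensor_form_nonneg gram2_povm) auto

lemma tensor_form_id: "tensor_form n \<psi> (\<lambda>k a b. if a = b then 1 else 0) = of_real (\<Sum>i<2^n. (cmod (\<psi> i))\<^sup>2)"
proof -
  have d: "(\<Prod>k<n. if qbit i k = qbit j k then 1 else 0 :: complex) = (if i = j then 1 else 0)"
    if "i < 2^n" "j < 2^n" for i j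
    using qbit_eq_iff[OF that] by (auto simp: prod_zero_iff)
  have "tensor_form n \<psi> (\<lambda>k a b. if a = b then 1 else 0) = (\<Sum>i<2^n. \<Sum>j<2^n. if i = j then cnj (\<psi> i) * \<psi> j else 0)"
    unfolding tensor_form_def by (intro sum.cong refl) (auto simp: d)
  also have "\<dots> = (\<Sum>i<2^n. cnj (\<psi> i) * \<psi> i)" by (intro sum.cong) auto
  finally show ?thesis by (simp only: of_real_sum complex_norm_square mult.commute)
qed

lemma sum_born: "(\<Sum>\<omega>\<in>outcomes n. born n \<psi> \<omega>) = (\<Sum>i<2^n. (cmod (\<psi> i))\<^sup>2)"
proof -
  have "(\<Sum>\<omega>\<in>outcomes n. born n \<psi> \<omega>) = Re (tensor_form n \<psi> (\<lambda>k a b. \<Sum>x\<in>outs. of_real 1 * povm x a b))"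
    using sum_born_prod[where g="\<lambda>_ _. 1"] by simp
  also have "\<dots> = Re (tensor_form n \<psi> (\<lambda>k a b. if a = b then 1 else 0))"
    using sum_povm[of 1 "\<lambda>_. 0"] by (intro arg_cong[where f=Re] tensor_form_cong) simp
  finally show ?thesis by (simp add: tensor_form_id)
qed

text \<open>Averaging \<open>out_vec\<close> against the POVM at one site yields
  \<open>sigma j\<close>, and the other sites collapse to the identity. Distinctness matters: at a
  single site the outcome is perfectly correlated with itself, which later produces the diagonal
  term 9.\<close>

lemma born_correlation:
  assumes "u < n" "v < n" "u \<noteq> v" "j < 3"
  shows "(\<Sum>\<omega>\<in>outcomes n. born n \<psi> \<omega> * (out_vec (\<omega> u) j * out_vec (\<omega> v) j)) =
    Re (tensor_form n \<psi> (\<lambda>k. if k = u \<or> k = v then sigma j else (\<lambda>a b. if a = b then 1 else 0)))"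
proof -
  define g where "g = (\<lambda>k x. if k = u \<or> k = v then out_vec x j else 1)"
  have "(\<Prod>k<n. g k (\<omega> k)) = out_vec (\<omega> u) j * out_vec (\<omega> v) j" for \<omega>
    using assms by (simp add: g_def prod.remove[of _ u] prod.remove[of _ v])
  then have "(\<Sum>\<omega>\<in>outcomes n. born n \<psi> \<omega> * (out_vec (\<omega> u) j * out_vec (\<omega> v) j)) =
     (\<Sum>\<omega>\<in>outcomes n. (\<Prod>k<n. g k (\<omega> k)) * born n \<psi> \<omega>)" by (simp add: mult.commute)
  also have "\<dots> = Re (tensor_form n \<psi> (\<lambda>k a b. \<Sum>x\<in>outs. of_real (g k x) * povm x a b))"
    by (rule sum_born_prod)
  also have "\<dots> = Re (tensor_form n \<psi> (\<lambda>k. if k = u \<or> k = v then sigma j else (\<lambda>a b. if a = b then 1 else 0)))"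
  proof (intro arg_cong[where f=Re] tensor_form_cong)
    fix k a b :: nat
    have 1: "(\<Sum>x\<in>outs. of_real (out_vec x j) * povm x a b) = sigma j a b"
    proof -
      have [simp]: "(\<Sum>i<3. (if i = j then - 1 else 0) * f i) = - f j" for f :: "nat \<Rightarrow> real"
        using assms by (subst sum.remove[of _ j]) (auto intro!: sum.neutral)
      have [simp]: "(\<Sum>i<3. of_real (if i = j then - 1 else 0) * f i) = - f j" for f :: "nat \<Rightarrow> complex"
        using assms by (subst sum.remove[of _ j]) (auto intro!: sum.neutral)
      show ?thesis using sum_povm[of 0 "\<lambda>i. if i = j then -1 else 0" a b] by simp
    qed
    show "(\<Sum>x\<in>outs. of_real (g k x) * povm x a b) =
      (if k = u \<or> k = v then sigma j else (\<lambda>a b. if a = b then 1 else 0)) a b"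
      using 1 sum_povm[of 1 "\<lambda>_. 0" a b] by (auto simp: g_def)
  qed
  finally show ?thesis .
qed

text \<open>Conditioning on the outcomes of other qubits leaves a genuine qubit state,
  so the conditional mean of the outcome vector stays in the Bloch ball.\<close>

lemma born_conditional_ball:
  assumes a: "a < n" "a \<notin> T" and \<tau>: "\<tau> \<in> outcomes n" and r: "(\<Sum>j<3. (r j)\<^sup>2) \<le> 1"
  defines "C \<equiv> {\<omega>\<in>outcomes n. \<forall>k\<in>T \<inter> {..<n}. \<omega> k = \<tau> k}"
  shows "(\<Sum>j<3. r j * (\<Sum>\<omega>\<in>C. born n \<psi> \<omega> * out_vec (\<omega> a) j)) \<le> (\<Sum>\<omega>\<in>C. born n \<psi> \<omega>)"
proof -
  define P where "P = (\<Sum>\<omega>\<in>C. born n \<psi> \<omega>)"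
  define v where "v j = (\<Sum>\<omega>\<in>C. born n \<psi> \<omega> * out_vec (\<omega> a) j)" for j
  \<comment> \<open>The weight is 1 - r.out at site \<open>a\<close> on the conditioning event.
    Summed over outcomes it attaches a single POVM element to each site of \<open>T\<close>, the
    operator I - r.sigma to \<open>a\<close> and the identity elsewhere; all are positive, hence so
    is their product. Unnormalised sums also cover conditioning events of probability zero.\<close>
  define g where "g = (\<lambda>k x. if k \<in> T then (if x = \<tau> k then 1 else 0)
     else if k = a then 1 - (\<Sum>j<3. r j * out_vec x j) else 1)"
  have g: "(\<Prod>k<n. g k (\<omega> k)) = (if \<forall>k\<in>T \<inter> {..<n}. \<omega> k = \<tau> k then 1 - (\<Sum>j<3. r j * out_vec (\<omega> a) j) else 0)" for \<omega>
  proof (cases "\<forall>k\<in>T \<inter> {..<n}. \<omega> k = \<tau> k")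
    case True
    then have "(\<Prod>k\<in>{..<n} - {a}. g k (\<omega> k)) = 1" by (intro prod.neutral) (auto simp: g_def)
    with True a show ?thesis by (simp add: prod.remove[of _ a]) (simp add: g_def)
  next
    case False
    then show ?thesis by (auto simp: prod_zero_iff g_def)
  qed
  have "P - (\<Sum>j<3. r j * v j) = (\<Sum>\<omega>\<in>C. (1 - (\<Sum>j<3. r j * out_vec (\<omega> a) j)) * born n \<psi> \<omega>)"
  proof -
    have "(\<Sum>j<3. r j * v j) = (\<Sum>\<omega>\<in>C. \<Sum>j<3. r j * out_vec (\<omega> a) j * born n \<psi> \<omega>)"
      unfolding v_def sum_distrib_left by (subst sum.swap) (simp add: algebra_simps)
    then show ?thesis unfolding P_def
      by (simp add: sum_subtractf left_diff_distrib sum_distrib_right)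
  qed
  also have "\<dots> = (\<Sum>\<omega>\<in>outcomes n. (\<Prod>k<n. g k (\<omega> k)) * born n \<psi> \<omega>)"
    unfolding C_def by (rule sum.mono_neutral_cong_left) (auto simp: g finite_PiE)
  also have "\<dots> = Re (tensor_form n \<psi> (\<lambda>k a b. \<Sum>x\<in>outs. of_real (g k x) * povm x a b))"
    by (rule sum_born_prod)
  also have "\<dots> \<ge> 0"
  proof (rule tensor_form_nonneg)
    fix k assume k: "k < n"
    consider "k \<in> T" | "k \<notin> T" "k = a" | "k \<notin> T" "k \<noteq> a" by blast
    then show "gram2 (\<lambda>a b. \<Sum>x\<in>outs. of_real (g k x) * povm x a b)"
    proof cases
      case 1
      have t: "\<tau> k \<in> outs" using \<tau> k by auto
      have "(\<lambda>a b. \<Sum>x\<in>outs. of_real (g k x) * povm x a b) = povm (\<tau> k)"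
      proof (intro ext)
        fix a b
        have "(\<Sum>x\<in>outs. of_real (g k x) * povm x a b) = (\<Sum>x\<in>outs. if x = \<tau> k then povm x a b else 0)"
          using 1 by (intro sum.cong) (auto simp: g_def)
        then show "(\<Sum>x\<in>outs. of_real (g k x) * povm x a b) = povm (\<tau> k) a b"
          using t by simp
      qed
      then show ?thesis using gram2_povm[OF t] by simp
    next
      case 2
      have "(\<lambda>a b. \<Sum>x\<in>outs. of_real (g k x) * povm x a b) = bloch (\<lambda>j. - r j)"
        using 2 sum_povm[of 1 r] by (intro ext) (simp add: g_def bloch_def sum_negf)
      then show ?thesis using gram2_bloch[of "\<lambda>j. - r j"] r by simp
    next
      case 3
      have "(\<lambda>a b. \<Sum>x\<in>outs. of_real (g k x) * povm x a b) = bloch (\<lambda>j. 0)"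
        using 3 sum_povm[of 1 "\<lambda>_. 0"] by (intro ext) (simp add: g_def bloch_def)
      then show ?thesis using gram2_bloch[of "\<lambda>j. 0"] by simp
    qed
  qed
  finally show ?thesis unfolding P_def v_def by simp
qed

subsection \<open>Decoupling by conditioning\<close>

text \<open>Conditional expectation given the coordinates in \<open>T\<close>. On a fibre of mass
  zero the quotient defaults to 0, which is harmless for nonnegative \<open>p\<close>, as the
  weights vanish there.\<close>

definition cexp :: "('k \<Rightarrow> 'o) set \<Rightarrow> (('k \<Rightarrow> 'o) \<Rightarrow> real) \<Rightarrow> 'k set \<Rightarrow> (('k \<Rightarrow> 'o) \<Rightarrow> real) \<Rightarrow> ('k \<Rightarrow> 'o) \<Rightarrow> real" where
  "cexp \<Omega> p T X \<omega> = (\<Sum>\<omega>'\<in>{\<omega>'\<in>\<Omega>. \<forall>k\<in>T. \<omega>' k = \<omega> k}. p \<omega>' * X \<omega>') / (\<Sum>\<omega>'\<in>{\<omega>'\<in>\<Omega>. \<forall>k\<in>T. \<omega>' k = \<omega> k}. p \<omega>')"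

text \<open>Measurability with respect to the coordinates in \<open>T\<close>.\<close>

definition determined_by :: "'k set \<Rightarrow> (('k \<Rightarrow> 'o) \<Rightarrow> real) \<Rightarrow> bool" where
  "determined_by T Y \<longleftrightarrow> (\<forall>\<omega> \<omega>'. (\<forall>k\<in>T. \<omega> k = \<omega>' k) \<longrightarrow> Y \<omega> = Y \<omega>')"

lemma determined_by_cexp: "determined_by T (cexp \<Omega> p T X)"
  unfolding determined_by_def
proof (intro allI impI)
  fix \<omega> \<omega>' :: "'a \<Rightarrow> 'b" assume "\<forall>k\<in>T. \<omega> k = \<omega>' k"
  then have "{\<omega>''\<in>\<Omega>. \<forall>k\<in>T. \<omega>'' k = \<omega> k} = {\<omega>''\<in>\<Omega>. \<forall>k\<in>T. \<omega>'' k = \<omega>' k}" by auto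
  then show "cexp \<Omega> p T X \<omega> = cexp \<Omega> p T X \<omega>'" unfolding cexp_def by simp
qed

lemma determined_by_mono: "determined_by T Y \<Longrightarrow> T \<subseteq> T' \<Longrightarrow> determined_by T' Y"
  unfolding determined_by_def by (meson subsetD)

lemma cexp_sum: "cexp \<Omega> p T (\<lambda>\<omega>. c * (\<Sum>a\<in>A. X a \<omega>)) \<omega> = c * (\<Sum>a\<in>A. cexp \<Omega> p T (X a) \<omega>)"
proof -
  have "(\<Sum>\<omega>'\<in>B. p \<omega>' * (c * (\<Sum>a\<in>A. X a \<omega>'))) = c * (\<Sum>a\<in>A. \<Sum>\<omega>'\<in>B. p \<omega>' * X a \<omega>')" for B
    by (subst sum.swap) (simp add: sum_distrib_left mult.left_commute)
  then show ?thesis unfolding cexp_def by (simp add: sum_divide_distrib[symmetric])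
qed

context
  fixes \<Omega> :: "('k \<Rightarrow> 'o) set" and p :: "('k \<Rightarrow> 'o) \<Rightarrow> real"
  assumes fin: "finite \<Omega>" and pos: "\<And>\<omega>. \<omega> \<in> \<Omega> \<Longrightarrow> 0 \<le> p \<omega>"
begin

text \<open>Averaging over fibres is self-adjoint: the fibre relation \<open>R\<close> is symmetric
  and \<open>Y / q\<close> is constant on fibres, so the two summation variables may be
  exchanged.\<close>

lemma cexp_adjoint:
  assumes Y: "determined_by T Y"
  shows "(\<Sum>\<omega>\<in>\<Omega>. p \<omega> * (cexp \<Omega> p T X \<omega> * Y \<omega>)) = (\<Sum>\<omega>\<in>\<Omega>. p \<omega> * (X \<omega> * Y \<omega>))"
proof -
  define R where "R \<omega> \<omega>' = (if \<forall>k\<in>T. \<omega>' k = \<omega> k then 1 else 0 :: real)" for \<omega> \<omega>' :: "'k \<Rightarrow> 'o"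
  define q where "q \<omega> = (\<Sum>\<omega>'\<in>\<Omega>. R \<omega> \<omega>' * p \<omega>')" for \<omega>
  have filt: "(\<Sum>\<omega>'\<in>{\<omega>'\<in>\<Omega>. \<forall>k\<in>T. \<omega>' k = \<omega> k}. f \<omega>') = (\<Sum>\<omega>'\<in>\<Omega>. R \<omega> \<omega>' * f \<omega>')" for f \<omega>
    using fin by (simp add: R_def sum.inter_filter if_distrib if_distribR cong: if_cong)
  have c: "cexp \<Omega> p T X \<omega> = (\<Sum>\<omega>'\<in>\<Omega>. R \<omega> \<omega>' * (p \<omega>' * X \<omega>')) / q \<omega>" for \<omega>
    unfolding cexp_def filt q_def ..
  have R: "R \<omega> \<omega>' * (Y \<omega> / q \<omega>) = R \<omega>' \<omega> * (Y \<omega>' / q \<omega>')" for \<omega> \<omega>'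
  proof (cases "\<forall>k\<in>T. \<omega>' k = \<omega> k")
    case True
    then have "Y \<omega> = Y \<omega>'" using Y unfolding determined_by_def by metis
    moreover have "R \<omega> = R \<omega>'" using True by (auto simp: R_def fun_eq_iff)
    ultimately show ?thesis using True by (simp add: R_def q_def)
  next
    case False
    then have "\<not> (\<forall>k\<in>T. \<omega> k = \<omega>' k)" by metis
    then have "R \<omega>' \<omega> = 0" unfolding R_def by (rule if_not_P)
    moreover have "R \<omega> \<omega>' = 0" using False unfolding R_def by (rule if_not_P)
    ultimately show ?thesis by simp
  qed
  \<comment> \<open>Nonnegativity of \<open>p\<close> makes every point of a massless fibre
    massless, so the default value of the quotient never counts.\<close>
  have q0: "p \<omega> = 0" if "q \<omega> = 0" "\<omega> \<in> \<Omega>" for \<omega>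
  proof -
    have "R \<omega> \<omega> * p \<omega> = 0"
      using that fin pos sum_nonneg_eq_0_iff[of \<Omega> "\<lambda>\<omega>'. R \<omega> \<omega>' * p \<omega>'"] by (auto simp: q_def R_def)
    then show ?thesis by (simp add: R_def)
  qed
  have "(\<Sum>\<omega>\<in>\<Omega>. p \<omega> * (cexp \<Omega> p T X \<omega> * Y \<omega>)) =
    (\<Sum>\<omega>\<in>\<Omega>. \<Sum>\<omega>'\<in>\<Omega>. (p \<omega> * (p \<omega>' * X \<omega>')) * (R \<omega> \<omega>' * (Y \<omega> / q \<omega>)))"
    unfolding c by (intro sum.cong refl) (simp add: sum_distrib_left sum_divide_distrib sum_distrib_right algebra_simps)
  also have "\<dots> = (\<Sum>\<omega>'\<in>\<Omega>. \<Sum>\<omega>\<in>\<Omega>. (p \<omega> * (p \<omega>' * X \<omega>')) * (R \<omega> \<omega>' * (Y \<omega> / q \<omega>)))"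
    by (rule sum.swap)
  also have "\<dots> = (\<Sum>\<omega>'\<in>\<Omega>. \<Sum>\<omega>\<in>\<Omega>. (p \<omega> * (p \<omega>' * X \<omega>')) * (R \<omega>' \<omega> * (Y \<omega>' / q \<omega>')))"
    by (simp only: R)
  also have "\<dots> = (\<Sum>\<omega>'\<in>\<Omega>. (p \<omega>' * X \<omega>') * (Y \<omega>' / q \<omega>') * q \<omega>')"
  proof (intro sum.cong refl)
    fix \<omega>'
    have "(\<Sum>\<omega>\<in>\<Omega>. (p \<omega> * (p \<omega>' * X \<omega>')) * (R \<omega>' \<omega> * (Y \<omega>' / q \<omega>'))) =
      (\<Sum>\<omega>\<in>\<Omega>. (p \<omega>' * X \<omega>') * (Y \<omega>' / q \<omega>') * (R \<omega>' \<omega> * p \<omega>))"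
      by (intro sum.cong refl) (simp add: mult_ac)
    then show "(\<Sum>\<omega>\<in>\<Omega>. (p \<omega> * (p \<omega>' * X \<omega>')) * (R \<omega>' \<omega> * (Y \<omega>' / q \<omega>'))) =
      (p \<omega>' * X \<omega>') * (Y \<omega>' / q \<omega>') * q \<omega>'" by (simp only: q_def sum_distrib_left)
  qed
  also have "\<dots> = (\<Sum>\<omega>\<in>\<Omega>. p \<omega> * (X \<omega> * Y \<omega>))"
    using q0 by (intro sum.cong refl) (auto simp: mult.assoc)
  finally show ?thesis .
qed

lemma cexp_residual_orthogonal:
  assumes Y: "determined_by T Y"
  shows "(\<Sum>\<omega>\<in>\<Omega>. p \<omega> * ((X \<omega> - cexp \<Omega> p T X \<omega>) * Y \<omega>)) = 0"
  using cexp_adjoint[OF Y, of X] by (simp add: left_diff_distrib right_diff_distrib sum_subtractf)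

text \<open>Pythagoras: the residual is orthogonal to every function of the coordinates in
  \<open>T\<close>, in particular to the difference between the conditional expectation and
  \<open>Y\<close>. Any candidate \<open>Y\<close> thus bounds a conditional variance from
  above.\<close>

lemma cexp_best_approx:
  assumes Y: "determined_by T Y"
  shows "(\<Sum>\<omega>\<in>\<Omega>. p \<omega> * (X \<omega> - cexp \<Omega> p T X \<omega>)\<^sup>2) \<le> (\<Sum>\<omega>\<in>\<Omega>. p \<omega> * (X \<omega> - Y \<omega>)\<^sup>2)"
proof -
  define C where "C = cexp \<Omega> p T X"
  have d: "determined_by T (\<lambda>\<omega>. C \<omega> - Y \<omega>)"
    using Y determined_by_cexp[of T \<Omega> p X] unfolding determined_by_def C_def by metis
  have "(\<Sum>\<omega>\<in>\<Omega>. p \<omega> * (X \<omega> - Y \<omega>)\<^sup>2) = (\<Sum>\<omega>\<in>\<Omega>. p \<omega> * (X \<omega> - C \<omega>)\<^sup>2) +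
     2 * (\<Sum>\<omega>\<in>\<Omega>. p \<omega> * ((X \<omega> - C \<omega>) * (C \<omega> - Y \<omega>))) + (\<Sum>\<omega>\<in>\<Omega>. p \<omega> * (C \<omega> - Y \<omega>)\<^sup>2)"
    unfolding sum_distrib_left sum.distrib[symmetric]
    by (intro sum.cong refl) (simp add: power2_eq_square algebra_simps)
  also have "(\<Sum>\<omega>\<in>\<Omega>. p \<omega> * ((X \<omega> - C \<omega>) * (C \<omega> - Y \<omega>))) = 0"
    unfolding C_def by (rule cexp_residual_orthogonal) (use d in \<open>simp add: C_def\<close>)
  finally have "(\<Sum>\<omega>\<in>\<Omega>. p \<omega> * (X \<omega> - Y \<omega>)\<^sup>2) =
     (\<Sum>\<omega>\<in>\<Omega>. p \<omega> * (X \<omega> - C \<omega>)\<^sup>2) + (\<Sum>\<omega>\<in>\<Omega>. p \<omega> * (C \<omega> - Y \<omega>)\<^sup>2)" by simp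
  moreover have "(\<Sum>\<omega>\<in>\<Omega>. p \<omega> * (C \<omega> - Y \<omega>)\<^sup>2) \<ge> 0" by (intro sum_nonneg mult_nonneg_nonneg pos) auto
  ultimately show ?thesis by (simp add: C_def)
qed

text \<open>Law of total covariance; the two cross terms vanish by orthogonality.\<close>

lemma cexp_covariance:
  "(\<Sum>\<omega>\<in>\<Omega>. p \<omega> * (X \<omega> * Y \<omega>)) = (\<Sum>\<omega>\<in>\<Omega>. p \<omega> * (cexp \<Omega> p T X \<omega> * cexp \<Omega> p T Y \<omega>)) +
    (\<Sum>\<omega>\<in>\<Omega>. p \<omega> * ((X \<omega> - cexp \<Omega> p T X \<omega>) * (Y \<omega> - cexp \<Omega> p T Y \<omega>)))"
proof -
  have "(\<Sum>\<omega>\<in>\<Omega>. p \<omega> * (X \<omega> * Y \<omega>)) = (\<Sum>\<omega>\<in>\<Omega>. p \<omega> * (cexp \<Omega> p T X \<omega> * cexp \<Omega> p T Y \<omega>)) +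
    (\<Sum>\<omega>\<in>\<Omega>. p \<omega> * ((X \<omega> - cexp \<Omega> p T X \<omega>) * (Y \<omega> - cexp \<Omega> p T Y \<omega>))) +
    (\<Sum>\<omega>\<in>\<Omega>. p \<omega> * ((X \<omega> - cexp \<Omega> p T X \<omega>) * cexp \<Omega> p T Y \<omega>)) +
    (\<Sum>\<omega>\<in>\<Omega>. p \<omega> * ((Y \<omega> - cexp \<Omega> p T Y \<omega>) * cexp \<Omega> p T X \<omega>))"
    unfolding sum.distrib[symmetric] by (intro sum.cong refl) (simp add: algebra_simps)
  then show ?thesis by (simp add: cexp_residual_orthogonal determined_by_cexp)
qed

end

section \<open>Cloud averages and their conditional variance\<close>

definition cloud_mean :: "nat \<Rightarrow> nat \<Rightarrow> nat \<Rightarrow> (nat \<Rightarrow> nat \<times> bool) \<Rightarrow> real" where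
  "cloud_mean M u j \<omega> = (1 / real M) * (\<Sum>a<M. out_vec (\<omega> (u * M + a)) j)"

definition residual :: "nat \<Rightarrow> ((nat \<Rightarrow> nat \<times> bool) \<Rightarrow> real) \<Rightarrow> nat set \<Rightarrow> ((nat \<Rightarrow> nat \<times> bool) \<Rightarrow> real) \<Rightarrow> (nat \<Rightarrow> nat \<times> bool) \<Rightarrow> real" where
  "residual n p T X \<omega> = X \<omega> - cexp (outcomes n) p T X \<omega>"

text \<open>The expected conditional variance of the vector-valued cloud average given the outcomes
  in \<open>T\<close>. It serves as a potential that further conditioning can only lower.\<close>

definition cloud_var :: "nat \<Rightarrow> nat \<Rightarrow> ((nat \<Rightarrow> nat \<times> bool) \<Rightarrow> real) \<Rightarrow> nat set \<Rightarrow> nat \<Rightarrow> real" where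
  "cloud_var n M p T u = (\<Sum>j<3. \<Sum>\<omega>\<in>outcomes n. p \<omega> * (residual n p T (cloud_mean M u j) \<omega>)\<^sup>2)"

lemma finite_outcomes: "finite (outcomes n)"
  by (intro finite_PiE) auto

lemma out_vec_norm: "x \<in> outs \<Longrightarrow> (\<Sum>j<3. (out_vec x j)\<^sup>2) = 9"
proof -
  assume x: "x \<in> outs"
  have "(\<Sum>j<3. (out_vec x j)\<^sup>2) = (\<Sum>j<3. 1 * (if j = fst x then 9 else 0))"
    by (intro sum.cong) (auto simp: out_vec_def out_sgn_def)
  then show ?thesis using x by (subst (asm) sum_single_3) (auto simp: outs_def)
qed

context
  fixes n M :: nat and p :: "(nat \<Rightarrow> nat \<times> bool) \<Rightarrow> real"
  assumes pos: "\<And>\<omega>. \<omega> \<in> outcomes n \<Longrightarrow> 0 \<le> p \<omega>" and total: "(\<Sum>\<omega>\<in>outcomes n. p \<omega>) = 1"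
    and M: "M > 0"
begin

lemma cloud_var_nonneg: "0 \<le> cloud_var n M p T u"
  unfolding cloud_var_def by (intro sum_nonneg mult_nonneg_nonneg pos) auto

lemma residual_best:
  "determined_by T Y \<Longrightarrow> (\<Sum>\<omega>\<in>outcomes n. p \<omega> * (residual n p T X \<omega>)\<^sup>2) \<le> (\<Sum>\<omega>\<in>outcomes n. p \<omega> * (X \<omega> - Y \<omega>)\<^sup>2)"
  unfolding residual_def by (rule cexp_best_approx) (auto simp: finite_outcomes pos)

text \<open>The coarser conditional expectation remains an admissible candidate when more
  coordinates are known.\<close>

lemma cloud_var_mono: "T \<subseteq> T' \<Longrightarrow> cloud_var n M p T' u \<le> cloud_var n M p T u"
  unfolding cloud_var_def
  by (intro sum_mono order_trans[OF residual_best[OF determined_by_mono[OF determined_by_cexp]]])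
    (auto simp: residual_def)

text \<open>The constant 0 is an admissible candidate, and every outcome vector has squared length
  9.\<close>

lemma out_vec_var:
  assumes "b < n"
  shows "(\<Sum>j<3. \<Sum>\<omega>\<in>outcomes n. p \<omega> * (residual n p T (\<lambda>\<omega>. out_vec (\<omega> b) j) \<omega>)\<^sup>2) \<le> 9"
proof -
  have d: "determined_by T (\<lambda>\<omega>. 0)" by (simp add: determined_by_def)
  have "(\<Sum>j<3. \<Sum>\<omega>\<in>outcomes n. p \<omega> * (residual n p T (\<lambda>\<omega>. out_vec (\<omega> b) j) \<omega>)\<^sup>2) \<le>
     (\<Sum>j<3. \<Sum>\<omega>\<in>outcomes n. p \<omega> * (out_vec (\<omega> b) j - 0)\<^sup>2)"
    by (intro sum_mono residual_best[OF d])
  also have "\<dots> = (\<Sum>\<omega>\<in>outcomes n. p \<omega> * (\<Sum>j<3. (out_vec (\<omega> b) j)\<^sup>2))"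
    unfolding sum_distrib_left by (subst sum.swap) simp
  also have "\<dots> = (\<Sum>\<omega>\<in>outcomes n. p \<omega> * 9)"
  proof (intro sum.cong refl)
    fix \<omega> assume "\<omega> \<in> outcomes n"
    then have "\<omega> b \<in> outs" by (rule PiE_mem) (simp add: assms)
    then show "p \<omega> * (\<Sum>j<3. (out_vec (\<omega> b) j)\<^sup>2) = p \<omega> * 9" by (simp only: out_vec_norm)
  qed
  also have "\<dots> = 9" by (simp add: sum_distrib_right[symmetric] total)
  finally show ?thesis .
qed

text \<open>Averaged over the members \<open>b\<close> of a cloud, the covariance of \<open>b\<close> with the cloud mean is the variance
  of the cloud mean, so some \<open>b\<close> is correlated enough for its outcome to reduce that variance.\<close>

lemma cloud_var_step:
  assumes u: "u * M + M \<le> n"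
  shows "\<exists>b. cloud_var n M p (insert b T) u \<le> cloud_var n M p T u - (cloud_var n M p T u)\<^sup>2 / 9"
proof -
  define D where "D j = residual n p T (cloud_mean M u j)" for j
  define d where "d a j = residual n p T (\<lambda>\<omega>. out_vec (\<omega> (u * M + a)) j)" for a j
  define V where "V = cloud_var n M p T u"
  define I where "I a = (\<Sum>j<3. \<Sum>\<omega>\<in>outcomes n. p \<omega> * (D j \<omega> * d a j \<omega>))" for a
  have D: "D j \<omega> = (1 / real M) * (\<Sum>a<M. d a j \<omega>)" for j \<omega>
    unfolding D_def d_def residual_def
    unfolding cloud_mean_def[abs_def] cexp_sum sum_subtractf right_diff_distrib ..
  have "(\<Sum>a<M. I a) = real M * V"
  proof -
    have "(\<Sum>a<M. I a) = (\<Sum>j<3. \<Sum>a<M. \<Sum>\<omega>\<in>outcomes n. p \<omega> * (D j \<omega> * d a j \<omega>))"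
      unfolding I_def by (rule sum.swap)
    also have "\<dots> = (\<Sum>j<3. \<Sum>\<omega>\<in>outcomes n. \<Sum>a<M. p \<omega> * (D j \<omega> * d a j \<omega>))"
      by (intro sum.cong refl sum.swap)
    also have "\<dots> = (\<Sum>j<3. \<Sum>\<omega>\<in>outcomes n. real M * (p \<omega> * (D j \<omega>)\<^sup>2))"
    proof (intro sum.cong refl)
      fix j \<omega>
      have "(\<Sum>a<M. p \<omega> * (D j \<omega> * d a j \<omega>)) = p \<omega> * (D j \<omega> * (\<Sum>a<M. d a j \<omega>))"
        by (simp add: sum_distrib_left)
      also have "(\<Sum>a<M. d a j \<omega>) = real M * D j \<omega>" using D M by simp
      finally show "(\<Sum>a<M. p \<omega> * (D j \<omega> * d a j \<omega>)) = real M * (p \<omega> * (D j \<omega>)\<^sup>2)"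
        by (simp add: power2_eq_square)
    qed
    finally show ?thesis by (simp add: V_def cloud_var_def D_def sum_distrib_left)
  qed
  moreover have "\<exists>a<M. V \<le> I a"
  proof (rule ccontr)
    assume "\<not> ?thesis"
    then have "(\<Sum>a<M. I a) < (\<Sum>a<M. V)" using M by (intro sum_strict_mono) auto
    with calculation show False by simp
  qed
  ultimately obtain a where a: "a < M" "V \<le> I a" by blast
  define b where "b = u * M + a"
  have b: "b < n" using u a by (simp add: b_def)
  \<comment> \<open>The minimiser of \<open>V - 2 * c * V + c\<^sup>2 * 9\<close>, with minimum
    \<open>V - V\<^sup>2 / 9\<close>.\<close>
  define c where "c = V / 9"
  have c0: "c \<ge> 0" using cloud_var_nonneg by (simp add: c_def V_def)
  \<comment> \<open>The competitor corrects the old conditional expectation by a multiple of the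
    residual of copy \<open>b\<close>, a quantity known once \<open>b\<close> joins the conditioning
    set.\<close>
  have det: "determined_by (insert b T)
      (\<lambda>\<omega>. cexp (outcomes n) p T (cloud_mean M u j) \<omega> + c * d a j \<omega>)" for j
  proof -
    have "determined_by T (cexp (outcomes n) p T X)" for X by (rule determined_by_cexp)
    then show ?thesis unfolding determined_by_def d_def residual_def b_def
      by (auto intro!: arg_cong2[where f="(+)"] arg_cong2[where f="(-)"])
  qed
  have "cloud_var n M p (insert b T) u \<le> (\<Sum>j<3. \<Sum>\<omega>\<in>outcomes n. p \<omega> *
      (cloud_mean M u j \<omega> - (cexp (outcomes n) p T (cloud_mean M u j) \<omega> + c * d a j \<omega>))\<^sup>2)"
    unfolding cloud_var_def by (intro sum_mono residual_best det)
  also have "\<dots> = (\<Sum>j<3. \<Sum>\<omega>\<in>outcomes n. p \<omega> * (D j \<omega> - c * d a j \<omega>)\<^sup>2)"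
    by (simp add: D_def residual_def algebra_simps)
  also have "\<dots> = V - 2 * c * I a + c\<^sup>2 * (\<Sum>j<3. \<Sum>\<omega>\<in>outcomes n. p \<omega> * (d a j \<omega>)\<^sup>2)"
    unfolding V_def cloud_var_def I_def D_def[symmetric] sum_distrib_left sum_subtractf[symmetric] sum.distrib[symmetric]
    by (intro sum.cong refl) (simp add: power2_eq_square algebra_simps)
  also have "\<dots> \<le> V - 2 * c * V + c\<^sup>2 * 9"
    using a c0 out_vec_var[OF b, of T] unfolding d_def b_def
    by (intro add_mono diff_mono mult_left_mono) auto
  also have "\<dots> = V - V\<^sup>2 / 9" by (simp add: c_def power2_eq_square)
  finally show ?thesis unfolding V_def by blast
qed

text \<open>Read off from the decrease: the next value is nonnegative, so V^2/9 \<le> V.\<close>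

lemma cloud_var_le: "u * M + M \<le> n \<Longrightarrow> cloud_var n M p T u \<le> 9"
proof -
  assume u: "u * M + M \<le> n"
  obtain b where "cloud_var n M p (insert b T) u \<le> cloud_var n M p T u - (cloud_var n M p T u)\<^sup>2 / 9"
    using cloud_var_step[OF u] by blast
  then have "(cloud_var n M p T u)\<^sup>2 / 9 \<le> cloud_var n M p T u" using cloud_var_nonneg[of "insert b T" u] by linarith
  then have "cloud_var n M p T u * cloud_var n M p T u \<le> 9 * cloud_var n M p T u" by (simp add: power2_eq_square)
  then show ?thesis using cloud_var_nonneg[of T u] by (cases "cloud_var n M p T u = 0") auto
qed

text \<open>The \<nu>-average of the variances starts at 9 or below. As long as it exceeds \<eta>, a
  round that adds one well-chosen copy per cloud lowers it by at least \<eta>^2/9, so K >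
  81/\<eta>^2 rounds suffice. The resulting size bound \<open>K * N\<close> is independent of M,
  which is what makes blowing up effective.\<close>

lemma ex_small_conditioning:
  assumes N: "N * M \<le> n" and \<nu>: "\<And>u. u < N \<Longrightarrow> 0 \<le> \<nu> u" "(\<Sum>u<N. \<nu> u) = 1"
    and \<eta>: "\<eta> > 0" and K: "81 < real K * \<eta>\<^sup>2"
  shows "\<exists>T. finite T \<and> card T \<le> K * N \<and> (\<Sum>u<N. \<nu> u * cloud_var n M p T u) \<le> \<eta>"
proof -
  define \<Phi> where "\<Phi> T = (\<Sum>u<N. \<nu> u * cloud_var n M p T u)" for T
  have uN: "u * M + M \<le> n" if "u < N" for u
  proof -
    have "Suc u * M \<le> N * M" using that by (intro mult_le_mono) auto
    then show ?thesis using N by simp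
  qed
  have step: "\<exists>T'. finite T' \<and> card T' \<le> card T + N \<and> \<Phi> T' \<le> \<Phi> T - (\<Phi> T)\<^sup>2 / 9" if T: "finite T" for T
  proof -
    have "\<forall>u\<in>{..<N}. \<exists>b. cloud_var n M p (insert b T) u \<le> cloud_var n M p T u - (cloud_var n M p T u)\<^sup>2 / 9"
      using cloud_var_step[OF uN] by simp
    from bchoice[OF this] obtain b where b: "\<And>u. u < N \<Longrightarrow> cloud_var n M p (insert (b u) T) u \<le> cloud_var n M p T u - (cloud_var n M p T u)\<^sup>2 / 9"
      by auto
    define T' where "T' = T \<union> b ` {..<N}"
    have "card T' \<le> card T + N"
      unfolding T'_def using card_Un_le[of T "b ` {..<N}"] card_image_le[of "{..<N}" b] by simp
    moreover have "\<Phi> T' \<le> \<Phi> T - (\<Phi> T)\<^sup>2 / 9"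
    proof -
      have "\<Phi> T' \<le> (\<Sum>u<N. \<nu> u * (cloud_var n M p T u - (cloud_var n M p T u)\<^sup>2 / 9))"
        unfolding \<Phi>_def
      proof (intro sum_mono mult_left_mono)
        fix u assume "u \<in> {..<N}"
        then have "cloud_var n M p T' u \<le> cloud_var n M p (insert (b u) T) u" by (intro cloud_var_mono) (auto simp: T'_def)
        also have "\<dots> \<le> cloud_var n M p T u - (cloud_var n M p T u)\<^sup>2 / 9" using b \<open>u \<in> _\<close> by simp
        finally show "cloud_var n M p T' u \<le> cloud_var n M p T u - (cloud_var n M p T u)\<^sup>2 / 9" .
      qed (auto simp: \<nu>)
      also have "\<dots> = \<Phi> T - (\<Sum>u<N. \<nu> u * (cloud_var n M p T u)\<^sup>2) / 9"
        by (simp add: \<Phi>_def right_diff_distrib sum_subtractf sum_divide_distrib)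
      also have "\<dots> \<le> \<Phi> T - (\<Phi> T)\<^sup>2 / 9"
      proof -
        \<comment> \<open>Jensen's inequality for the square, as nonnegativity of the \<nu>-variance
          of \<open>cloud_var\<close>: the gains of the separate clouds add up to a decrease
          quadratic in \<Phi>.\<close>
        have "0 \<le> (\<Sum>u<N. \<nu> u * (cloud_var n M p T u - \<Phi> T)\<^sup>2)" by (intro sum_nonneg mult_nonneg_nonneg) (auto simp: \<nu>)
        also have "\<dots> = (\<Sum>u<N. \<nu> u * (cloud_var n M p T u)\<^sup>2) - 2 * \<Phi> T * (\<Sum>u<N. \<nu> u * cloud_var n M p T u) + (\<Phi> T)\<^sup>2 * (\<Sum>u<N. \<nu> u)"
          unfolding sum_distrib_left sum_subtractf[symmetric] sum.distrib[symmetric]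
          by (intro sum.cong refl) (simp add: power2_eq_square algebra_simps)
        also have "\<dots> = (\<Sum>u<N. \<nu> u * (cloud_var n M p T u)\<^sup>2) - (\<Phi> T)\<^sup>2"
          by (simp add: \<nu> \<Phi>_def[symmetric] power2_eq_square)
        finally show ?thesis by simp
      qed
      finally show ?thesis .
    qed
    moreover have "finite T'" using T by (simp add: T'_def)
    ultimately show ?thesis by blast
  qed
  have "\<exists>T. finite T \<and> card T \<le> k * N \<and> (\<Phi> T \<le> \<eta> \<or> \<Phi> T \<le> 9 - real k * (\<eta>\<^sup>2 / 9))" for k
  proof (induction k)
    case 0
    have "\<Phi> {} \<le> (\<Sum>u<N. \<nu> u * 9)" unfolding \<Phi>_def
      by (intro sum_mono mult_left_mono cloud_var_le uN) (auto simp: \<nu>)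
    then have "\<Phi> {} \<le> 9" by (simp add: sum_distrib_right[symmetric] \<nu>)
    then show ?case by (intro exI[of _ "{}"]) auto
  next
    case (Suc k)
    then obtain T where T: "finite T" "card T \<le> k * N" "\<Phi> T \<le> \<eta> \<or> \<Phi> T \<le> 9 - real k * (\<eta>\<^sup>2 / 9)" by blast
    show ?case
    proof (cases "\<Phi> T \<le> \<eta>")
      case True
      with T show ?thesis by (intro exI[of _ T]) auto
    next
      case False
      obtain T' where T': "finite T'" "card T' \<le> card T + N" "\<Phi> T' \<le> \<Phi> T - (\<Phi> T)\<^sup>2 / 9" using step[OF T(1)] by blast
      have "\<eta>\<^sup>2 \<le> (\<Phi> T)\<^sup>2" using False \<eta> by (intro power_mono) auto
      then have "\<Phi> T' \<le> 9 - real (Suc k) * (\<eta>\<^sup>2 / 9)" using T(3) T'(3) False by (simp add: field_simps)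
      with T T' show ?thesis by (intro exI[of _ T']) auto
    qed
  qed
  from this[of K] obtain T where T: "finite T" "card T \<le> K * N" "\<Phi> T \<le> \<eta> \<or> \<Phi> T \<le> 9 - real K * (\<eta>\<^sup>2 / 9)" by blast
  have "0 \<le> \<Phi> T" unfolding \<Phi>_def by (intro sum_nonneg mult_nonneg_nonneg cloud_var_nonneg) (auto simp: \<nu>)
  \<comment> \<open>The other alternative would push the nonnegative \<Phi> below 9 - 81/9 =
    0.\<close>
  then have "\<Phi> T \<le> \<eta>" using T(3) K by auto
  then show ?thesis using T unfolding \<Phi>_def by blast
qed

text \<open>The law of total covariance splits each correlation into one of conditional means and
  one of residuals, and the latter is at least minus half the sum of the two variances. As
  \<open>W\<close> need not be symmetric, the variances are collected with the average of its row
  and column marginals.\<close>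

lemma cloud_correlation_bound:
  assumes N: "N * M \<le> n" and W: "\<And>u v. 0 \<le> W u v"
  defines "\<nu> \<equiv> \<lambda>u. ((\<Sum>v<N. W u v) + (\<Sum>v<N. W v u)) / 2"
  shows "(\<Sum>\<omega>\<in>outcomes n. p \<omega> * (\<Sum>u<N. \<Sum>v<N. W u v *
       (\<Sum>j<3. cexp (outcomes n) p T (cloud_mean M u j) \<omega> * cexp (outcomes n) p T (cloud_mean M v j) \<omega>)))
     - (\<Sum>u<N. \<nu> u * cloud_var n M p T u)
   \<le> (\<Sum>u<N. \<Sum>v<N. W u v * (\<Sum>j<3. \<Sum>\<omega>\<in>outcomes n. p \<omega> * (cloud_mean M u j \<omega> * cloud_mean M v j \<omega>)))"
proof -
  define f where "f u j \<omega> = cexp (outcomes n) p T (cloud_mean M u j) \<omega>" for u j \<omega>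
  define D where "D u j \<omega> = residual n p T (cloud_mean M u j) \<omega>" for u j \<omega>
  have "(\<Sum>j<3. \<Sum>\<omega>\<in>outcomes n. p \<omega> * (f u j \<omega> * f v j \<omega>)) - (cloud_var n M p T u + cloud_var n M p T v) / 2
     \<le> (\<Sum>j<3. \<Sum>\<omega>\<in>outcomes n. p \<omega> * (cloud_mean M u j \<omega> * cloud_mean M v j \<omega>))" for u v
  proof -
    have "(\<Sum>j<3. \<Sum>\<omega>\<in>outcomes n. p \<omega> * (cloud_mean M u j \<omega> * cloud_mean M v j \<omega>)) =
      (\<Sum>j<3. \<Sum>\<omega>\<in>outcomes n. p \<omega> * (f u j \<omega> * f v j \<omega>)) +
      (\<Sum>j<3. \<Sum>\<omega>\<in>outcomes n. p \<omega> * (D u j \<omega> * D v j \<omega>))"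
      unfolding f_def D_def residual_def
      by (subst sum.distrib[symmetric]) (intro sum.cong refl cexp_covariance finite_outcomes pos)
    moreover have "- ((cloud_var n M p T u + cloud_var n M p T v) / 2) \<le> (\<Sum>j<3. \<Sum>\<omega>\<in>outcomes n. p \<omega> * (D u j \<omega> * D v j \<omega>))"
    proof -
      have "0 \<le> (\<Sum>j<3. \<Sum>\<omega>\<in>outcomes n. p \<omega> * (D u j \<omega> + D v j \<omega>)\<^sup>2)"
        by (intro sum_nonneg mult_nonneg_nonneg pos) auto
      also have "\<dots> = cloud_var n M p T u + cloud_var n M p T v + 2 * (\<Sum>j<3. \<Sum>\<omega>\<in>outcomes n. p \<omega> * (D u j \<omega> * D v j \<omega>))"
        unfolding cloud_var_def D_def[symmetric] sum_distrib_left sum.distrib[symmetric]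
        by (intro sum.cong refl) (simp add: power2_eq_square algebra_simps)
      finally show ?thesis by (simp only: field_simps)
    qed
    ultimately show ?thesis by linarith
  qed
  then have "(\<Sum>u<N. \<Sum>v<N. W u v * ((\<Sum>j<3. \<Sum>\<omega>\<in>outcomes n. p \<omega> * (f u j \<omega> * f v j \<omega>)) - (cloud_var n M p T u + cloud_var n M p T v) / 2))
    \<le> (\<Sum>u<N. \<Sum>v<N. W u v * (\<Sum>j<3. \<Sum>\<omega>\<in>outcomes n. p \<omega> * (cloud_mean M u j \<omega> * cloud_mean M v j \<omega>)))"
    by (intro sum_mono mult_left_mono W)
  moreover have "(\<Sum>u<N. \<Sum>v<N. W u v * ((cloud_var n M p T u + cloud_var n M p T v) / 2)) = (\<Sum>u<N. \<nu> u * cloud_var n M p T u)"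
  proof -
    have "(\<Sum>u<N. \<Sum>v<N. W u v * ((cloud_var n M p T u + cloud_var n M p T v) / 2)) =
       (\<Sum>u<N. \<Sum>v<N. W u v * cloud_var n M p T u / 2) + (\<Sum>u<N. \<Sum>v<N. W u v * cloud_var n M p T v / 2)"
      unfolding sum.distrib[symmetric] by (intro sum.cong refl) (simp add: algebra_simps)
    also have "(\<Sum>u<N. \<Sum>v<N. W u v * cloud_var n M p T v / 2) = (\<Sum>v<N. \<Sum>u<N. W u v * cloud_var n M p T v / 2)" by (rule sum.swap)
    also have "(\<Sum>u<N. \<Sum>v<N. W u v * cloud_var n M p T u / 2) + (\<Sum>v<N. \<Sum>u<N. W u v * cloud_var n M p T v / 2) =
        (\<Sum>u<N. \<nu> u * cloud_var n M p T u)"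
      unfolding \<nu>_def
      by (subst sum.distrib[symmetric], intro sum.cong refl)
        (simp only: sum_distrib_right sum_divide_distrib add_divide_distrib distrib_right times_divide_eq_left)
    finally show ?thesis .
  qed
  moreover have "(\<Sum>u<N. \<Sum>v<N. W u v * (\<Sum>j<3. \<Sum>\<omega>\<in>outcomes n. p \<omega> * (f u j \<omega> * f v j \<omega>))) =
    (\<Sum>\<omega>\<in>outcomes n. p \<omega> * (\<Sum>u<N. \<Sum>v<N. W u v * (\<Sum>j<3. f u j \<omega> * f v j \<omega>)))"
  proof -
    have "(\<Sum>j<3. \<Sum>\<omega>\<in>outcomes n. p \<omega> * (f u j \<omega> * f v j \<omega>)) = (\<Sum>\<omega>\<in>outcomes n. p \<omega> * (\<Sum>j<3. f u j \<omega> * f v j \<omega>))" for u v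
      unfolding sum_distrib_left by (rule sum.swap)
    then have "(\<Sum>u<N. \<Sum>v<N. W u v * (\<Sum>j<3. \<Sum>\<omega>\<in>outcomes n. p \<omega> * (f u j \<omega> * f v j \<omega>))) =
      (\<Sum>u<N. \<Sum>v<N. \<Sum>\<omega>\<in>outcomes n. p \<omega> * (W u v * (\<Sum>j<3. f u j \<omega> * f v j \<omega>)))"
      by (simp only: sum_distrib_left[of "W _ _" _ "outcomes n"] mult.left_commute)
    also have "\<dots> = (\<Sum>u<N. \<Sum>\<omega>\<in>outcomes n. \<Sum>v<N. p \<omega> * (W u v * (\<Sum>j<3. f u j \<omega> * f v j \<omega>)))"
      by (intro sum.cong refl sum.swap)
    also have "\<dots> = (\<Sum>\<omega>\<in>outcomes n. \<Sum>u<N. \<Sum>v<N. p \<omega> * (W u v * (\<Sum>j<3. f u j \<omega> * f v j \<omega>)))"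
      by (rule sum.swap)
    finally show ?thesis by (simp only: sum_distrib_left)
  qed
  ultimately show ?thesis unfolding f_def[symmetric] by (simp add: right_diff_distrib sum_subtractf)
qed

end

text \<open>Self-duality of the Euclidean norm, tested at v/|v|, or at 0 when v vanishes, to see
  that P is nonnegative.\<close>

lemma sum_sq_le_if_dual:
  assumes "\<And>r. (\<Sum>j<3. (r j)\<^sup>2) \<le> 1 \<Longrightarrow> (\<Sum>j<3. r j * v j) \<le> (P::real)"
  shows "(\<Sum>j<(3::nat). (v j)\<^sup>2) \<le> P\<^sup>2"
proof -
  define s where "s = sqrt (\<Sum>j<3. (v j)\<^sup>2)"
  have s2: "s\<^sup>2 = (\<Sum>j<3. (v j)\<^sup>2)" unfolding s_def by (simp add: sum_nonneg)
  have s0: "s \<ge> 0" by (simp add: s_def sum_nonneg)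
  have "s \<le> P"
  proof (cases "s = 0")
    case True
    then show ?thesis using assms[of "\<lambda>_. 0"] by simp
  next
    case False
    have "(\<Sum>j<3. (v j / s)\<^sup>2) = (\<Sum>j<3. (v j)\<^sup>2) / s\<^sup>2"
      unfolding sum_divide_distrib by (intro sum.cong) (auto simp: power_divide)
    then have "(\<Sum>j<3. (v j / s)\<^sup>2) \<le> 1" using False unfolding s2[symmetric] by simp
    moreover have "(\<Sum>j<3. v j / s * v j) = s"
    proof -
      have "(\<Sum>j<3. v j / s * v j) = (\<Sum>j<3. (v j)\<^sup>2) / s"
        unfolding sum_divide_distrib by (intro sum.cong) (auto simp: power2_eq_square)
      also have "\<dots> = s" using False unfolding s2[symmetric] by (simp add: power2_eq_square)
      finally show ?thesis .
    qed
    ultimately show ?thesis using assms[of "\<lambda>j. v j / s"] by simp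
  qed
  then have "s\<^sup>2 \<le> P\<^sup>2" using s0 by (intro power_mono)
  then show ?thesis unfolding s2 .
qed

subsection \<open>Variational principle for Hermitian matrices\<close>

definition mat_form :: "nat \<Rightarrow> complex mat \<Rightarrow> (nat \<Rightarrow> complex) \<Rightarrow> complex" where
  "mat_form m A \<psi> = (\<Sum>i<m. \<Sum>j<m. cnj (\<psi> i) * \<psi> j * A $$ (i, j))"

definition hermitian_mat :: "nat \<Rightarrow> complex mat \<Rightarrow> bool" where
  "hermitian_mat m A \<longleftrightarrow> A \<in> carrier_mat m m \<and> (\<forall>i<m. \<forall>j<m. cnj (A $$ (i, j)) = A $$ (j, i))"

lemma mat_form_real:
  assumes "hermitian_mat m A"
  shows "mat_form m A \<psi> = of_real (Re (mat_form m A \<psi>))"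
proof -
  have "cnj (mat_form m A \<psi>) = (\<Sum>i<m. \<Sum>j<m. \<psi> i * cnj (\<psi> j) * cnj (A $$ (i, j)))"
    unfolding mat_form_def by simp
  also have "\<dots> = (\<Sum>j<m. \<Sum>i<m. \<psi> i * cnj (\<psi> j) * cnj (A $$ (i, j)))" by (rule sum.swap)
  also have "\<dots> = mat_form m A \<psi>"
    unfolding mat_form_def using assms by (intro sum.cong refl) (auto simp: hermitian_mat_def)
  finally show ?thesis by (simp add: complex_eq_iff)
qed

lemma mult_mat_vec_index:
  assumes "A \<in> carrier_mat m m" "v \<in> carrier_vec m" "i < m"
  shows "(A *\<^sub>v v) $ i = (\<Sum>j<m. A $$ (i, j) * v $ j)"
  using assms by (simp add: scalar_prod_def atLeast0LessThan)

text \<open>Evaluated at a normalised eigenvector, the form returns the eigenvalue; for Hermitian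
  matrices this also shows that eigenvalues are real.\<close>

lemma eigenvalue_form:
  assumes A: "A \<in> carrier_mat m m" and ev: "eigenvalue A x"
  shows "\<exists>\<psi>. (\<Sum>i<m. (cmod (\<psi> i))\<^sup>2) = 1 \<and> mat_form m A \<psi> = x"
proof -
  from ev obtain v where v: "v \<in> carrier_vec m" "v \<noteq> 0\<^sub>v m" "A *\<^sub>v v = x \<cdot>\<^sub>v v"
    unfolding eigenvalue_def eigenvector_def using A by auto
  define s where "s = (\<Sum>i<m. (cmod (v $ i))\<^sup>2)"
  have "\<exists>i<m. v $ i \<noteq> 0" using v by (metis eq_vecI carrier_vecD index_zero_vec)
  then obtain i where i: "i < m" "v $ i \<noteq> 0" by blast
  have "(cmod (v $ i))\<^sup>2 \<le> s" unfolding s_def using i by (intro member_le_sum) auto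
  moreover have "0 < (cmod (v $ i))\<^sup>2" using i by simp
  ultimately have s: "s > 0" by linarith
  define \<psi> where "\<psi> i = v $ i / of_real (sqrt s)" for i
  have n\<psi>: "(\<Sum>i<m. (cmod (\<psi> i))\<^sup>2) = 1"
  proof -
    have "(\<Sum>i<m. (cmod (\<psi> i))\<^sup>2) = (\<Sum>i<m. (cmod (v $ i))\<^sup>2 / s)"
      using s by (intro sum.cong refl) (auto simp: \<psi>_def norm_divide power_divide)
    then show ?thesis using s by (simp add: sum_divide_distrib[symmetric] s_def)
  qed
  have "(\<Sum>j<m. \<psi> j * A $$ (i, j)) = x * \<psi> i" if "i < m" for i
  proof -
    have "(A *\<^sub>v v) $ i = x * v $ i" using v that by simp
    also have "(A *\<^sub>v v) $ i = (\<Sum>j<m. A $$ (i, j) * v $ j)"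
      by (rule mult_mat_vec_index[OF A v(1) that])
    finally have *: "(\<Sum>j<m. A $$ (i, j) * v $ j) = x * v $ i" .
    have "(\<Sum>j<m. \<psi> j * A $$ (i, j)) = (\<Sum>j<m. A $$ (i, j) * v $ j) / of_real (sqrt s)"
      unfolding sum_divide_distrib by (intro sum.cong refl) (simp add: \<psi>_def)
    then show ?thesis unfolding * by (simp add: \<psi>_def)
  qed
  then have "mat_form m A \<psi> = (\<Sum>i<m. cnj (\<psi> i) * (x * \<psi> i))"
    unfolding mat_form_def by (intro sum.cong refl) (simp add: mult.assoc sum_distrib_left[symmetric])
  also have "\<dots> = x * of_real (\<Sum>i<m. (cmod (\<psi> i))\<^sup>2)"
    unfolding of_real_sum sum_distrib_left by (intro sum.cong refl) (simp only: complex_norm_square mult_ac)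
  finally show ?thesis using n\<psi> by (intro exI[of _ \<psi>]) simp
qed

lemma hermitian_eigenvalue_real:
  assumes "hermitian_mat m A" "eigenvalue A x"
  shows "x = of_real (Re x)"
  using eigenvalue_form[of A m x] mat_form_real[OF assms(1)] assms unfolding hermitian_mat_def by metis

text \<open>Finiteness and nonemptiness give the \<open>Max\<close> in \<open>lambda_max\<close> its
  meaning. Some complex eigenvalue exists in positive dimension, and it is real by
  hermiticity.\<close>

lemma hermitian_real_spectrum:
  assumes h: "hermitian_mat m A" and m: "m > 0"
  shows "finite {x :: real. eigenvalue A (of_real x)}" "{x :: real. eigenvalue A (of_real x)} \<noteq> {}"
proof -
  have A: "A \<in> carrier_mat m m" using h by (simp add: hermitian_mat_def)
  have "complex_of_real ` {x :: real. eigenvalue A (of_real x)} \<subseteq> spectrum A"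
    unfolding spectrum_def by auto
  then have "finite (complex_of_real ` {x :: real. eigenvalue A (of_real x)})"
    using card_finite_spectrum(1)[OF A] finite_subset by blast
  then show "finite {x :: real. eigenvalue A (of_real x)}"
    by (rule finite_imageD) (auto simp: inj_on_def)
  obtain x where x: "eigenvalue A x" using spectrum_non_empty[OF A m] unfolding spectrum_def by blast
  then have "eigenvalue A (of_real (Re x))" using hermitian_eigenvalue_real[OF h x] by simp
  then show "{x :: real. eigenvalue A (of_real x)} \<noteq> {}" by blast
qed

lemma lambda_max_le:
  assumes h: "hermitian_mat m A" and m: "m > 0"
    and c: "\<And>\<psi>. (\<Sum>i<m. (cmod (\<psi> i))\<^sup>2) = 1 \<Longrightarrow> Re (mat_form m A \<psi>) \<le> c"
  shows "lambda_max A \<le> c"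
  unfolding lambda_max_def
proof (subst Max_le_iff[OF hermitian_real_spectrum[OF h m]], safe)
  fix x :: real assume "eigenvalue A (of_real x)"
  then obtain \<psi> where "(\<Sum>i<m. (cmod (\<psi> i))\<^sup>2) = 1" "mat_form m A \<psi> = of_real x"
    using eigenvalue_form[of A m] h unfolding hermitian_mat_def by blast
  then show "x \<le> c" using c[of \<psi>] by simp
qed

lemma hermitian_pow:
  assumes h: "hermitian_mat m B"
  shows "hermitian_mat m (B ^\<^sub>m k)"
proof -
  have B: "B \<in> carrier_mat m m" using h by (simp add: hermitian_mat_def)
  have comm: "B * B ^\<^sub>m k = B ^\<^sub>m k * B" for k
    by (induction k) (use B in \<open>auto simp: assoc_mult_mat[symmetric, of B m m _ m _ m]\<close>)
  show ?thesis
  proof (induction k)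
    case 0
    show ?case using B by (auto simp: hermitian_mat_def)
  next
    case (Suc k)
    have Bk: "B ^\<^sub>m k \<in> carrier_mat m m" using Suc by (simp add: hermitian_mat_def)
    have e1: "(B ^\<^sub>m Suc k) $$ (i, j) = (\<Sum>t<m. (B ^\<^sub>m k) $$ (i, t) * B $$ (t, j))" if "i < m" "j < m" for i j
      using B Bk that by (simp add: scalar_prod_def atLeast0LessThan)
    have e2: "(B ^\<^sub>m Suc k) $$ (i, j) = (\<Sum>t<m. B $$ (i, t) * (B ^\<^sub>m k) $$ (t, j))" if "i < m" "j < m" for i j
      using B Bk that by (simp add: comm[symmetric] scalar_prod_def atLeast0LessThan)
    have "cnj ((B ^\<^sub>m Suc k) $$ (i, j)) = (B ^\<^sub>m Suc k) $$ (j, i)" if "i < m" "j < m" for i j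
    proof -
      have "(B ^\<^sub>m Suc k) $$ (j, i) = (\<Sum>t<m. (B ^\<^sub>m k) $$ (j, t) * B $$ (t, i))" by (rule e1) (fact that)+
      also have "\<dots> = (\<Sum>t<m. cnj ((B ^\<^sub>m k) $$ (t, j)) * cnj (B $$ (i, t)))"
        using Suc h that by (intro sum.cong refl) (auto simp: hermitian_mat_def)
      also have "\<dots> = cnj ((B ^\<^sub>m Suc k) $$ (i, j))"
        unfolding e2[OF that] by (simp add: mult.commute)
      finally show ?thesis by (rule sym)
    qed
    then show ?case using pow_carrier_mat[OF B] unfolding hermitian_mat_def by blast
  qed
qed

text \<open>Cauchy-Schwarz for a unit vector: the form of \<open>C\<close> pairs \<psi> with
  C\<psi>, and the form of \<open>C * C\<close> is |C\<psi>|^2 because \<open>C\<close> is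
  Hermitian.\<close>

lemma mat_form_square:
  assumes h: "hermitian_mat m C" and \<psi>: "(\<Sum>i<m. (cmod (\<psi> i))\<^sup>2) = 1"
  shows "(Re (mat_form m C \<psi>))\<^sup>2 \<le> Re (mat_form m (C * C) \<psi>)"
proof -
  have C: "C \<in> carrier_mat m m" using h by (simp add: hermitian_mat_def)
  define \<phi> where "\<phi> t = (\<Sum>j<m. C $$ (t, j) * \<psi> j)" for t
  have f1: "mat_form m C \<psi> = (\<Sum>t<m. cnj (\<psi> t) * \<phi> t)"
    unfolding mat_form_def \<phi>_def by (simp add: sum_distrib_left mult_ac)
  have "mat_form m (C * C) \<psi> = (\<Sum>i<m. \<Sum>j<m. \<Sum>t<m. cnj (C $$ (t, i) * \<psi> i) * (C $$ (t, j) * \<psi> j))"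
    unfolding mat_form_def
  proof (intro sum.cong refl)
    fix i j assume ij: "i \<in> {..<m}" "j \<in> {..<m}"
    have "(C * C) $$ (i, j) = (\<Sum>t<m. C $$ (i, t) * C $$ (t, j))"
      using C ij by (simp add: scalar_prod_def atLeast0LessThan)
    also have "\<dots> = (\<Sum>t<m. cnj (C $$ (t, i)) * C $$ (t, j))"
      using h ij by (intro sum.cong refl) (auto simp: hermitian_mat_def)
    finally show "cnj (\<psi> i) * \<psi> j * (C * C) $$ (i, j) = (\<Sum>t<m. cnj (C $$ (t, i) * \<psi> i) * (C $$ (t, j) * \<psi> j))"
      by (simp add: sum_distrib_left mult_ac)
  qed
  also have "\<dots> = (\<Sum>i<m. \<Sum>t<m. \<Sum>j<m. cnj (C $$ (t, i) * \<psi> i) * (C $$ (t, j) * \<psi> j))"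
    by (intro sum.cong refl sum.swap)
  also have "\<dots> = (\<Sum>t<m. \<Sum>i<m. \<Sum>j<m. cnj (C $$ (t, i) * \<psi> i) * (C $$ (t, j) * \<psi> j))"
    by (rule sum.swap)
  also have "\<dots> = (\<Sum>t<m. cnj (\<phi> t) * \<phi> t)"
    by (simp only: \<phi>_def cnj_sum sum_product)
  also have "\<dots> = of_real (\<Sum>t<m. (cmod (\<phi> t))\<^sup>2)"
    unfolding of_real_sum by (intro sum.cong refl) (simp only: complex_norm_square mult_ac)
  finally have f2: "Re (mat_form m (C * C) \<psi>) = (\<Sum>t<m. (cmod (\<phi> t))\<^sup>2)" by simp
  have "\<bar>Re (mat_form m C \<psi>)\<bar> \<le> cmod (\<Sum>t<m. cnj (\<psi> t) * \<phi> t)"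
    unfolding f1 by (rule abs_Re_le_cmod)
  also have "\<dots> \<le> (\<Sum>t<m. cmod (\<psi> t) * cmod (\<phi> t))"
    by (rule order_trans[OF norm_sum]) (simp add: norm_mult)
  finally have "(\<bar>Re (mat_form m C \<psi>)\<bar>)\<^sup>2 \<le> (\<Sum>t<m. cmod (\<psi> t) * cmod (\<phi> t))\<^sup>2"
    by (rule power_mono) simp
  also have "\<dots> \<le> (\<Sum>t<m. (cmod (\<psi> t))\<^sup>2) * (\<Sum>t<m. (cmod (\<phi> t))\<^sup>2)"
    by (rule Cauchy_Schwarz_ineq_sum)
  finally show ?thesis unfolding f2 \<psi> by simp
qed

text \<open>If the form exceeded \<open>1\<close>, repeated squaring would make the powers of \<open>B\<close> unbounded.\<close>

lemma mat_form_le_one: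
  assumes h: "hermitian_mat m B" and m: "m > 0" and sr: "spectral_radius B < 1"
    and \<psi>: "(\<Sum>i<m. (cmod (\<psi> i))\<^sup>2) = 1"
  shows "Re (mat_form m B \<psi>) \<le> 1"
proof (rule ccontr)
  assume "\<not> ?thesis"
  then have b: "Re (mat_form m B \<psi>) > 1" by simp
  have B: "B \<in> carrier_mat m m" using h by (simp add: hermitian_mat_def)
  \<comment> \<open>The Jordan normal form turns spectral radius below 1 into one bound
    \<open>c\<close> for the entries of all powers of \<open>B\<close>.\<close>
  have "\<exists>n_as. jordan_nf B n_as"
    using jordan_nf_exists[OF B] char_poly_factorized[OF B] by blast
  then obtain c where c: "\<And>k. norm_bound (B ^\<^sub>m k) c"
    using spectral_radius_jnf_norm_bound_less_1[OF B sr] by blast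
  define f where "f k = Re (mat_form m (B ^\<^sub>m k) \<psi>)" for k
  have pow: "B ^\<^sub>m (k + l) = B ^\<^sub>m k * B ^\<^sub>m l" for k l
  proof (induction l)
    case 0
    show ?case using B by simp
  next
    case (Suc l)
    have "B ^\<^sub>m (k + Suc l) = (B ^\<^sub>m k * B ^\<^sub>m l) * B" by (simp add: Suc)
    also have "\<dots> = B ^\<^sub>m k * (B ^\<^sub>m l * B)"
      by (rule assoc_mult_mat[of _ m m _ m _ m]) (use B in auto)
    finally show ?case by simp
  qed
  have dbl: "(f k)\<^sup>2 \<le> f (k + k)" for k
    unfolding f_def pow by (rule mat_form_square[OF hermitian_pow[OF h] \<psi>])
  have f1: "f 1 = Re (mat_form m B \<psi>)" using B by (simp add: f_def)
  \<comment> \<open>Exponents that are powers of two are reached by squaring alone, so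
    \<open>mat_form_square\<close> yields growth at least like the powers of
    \<open>f 1 > 1\<close>.\<close>
  have low: "f 1 ^ (2 ^ k) \<le> f (2 ^ k)" for k
  proof (induction k)
    case (Suc k)
    have "f 1 ^ (2 ^ Suc k) = (f 1 ^ (2 ^ k))\<^sup>2" by (simp add: power_mult[symmetric] mult.commute)
    also have "\<dots> \<le> (f (2 ^ k))\<^sup>2" using Suc b f1 by (intro power_mono) auto
    also have "\<dots> \<le> f (2 ^ k + 2 ^ k)" by (rule dbl)
    finally show ?case by (simp add: mult_2)
  qed simp
  define Q where "Q = (\<Sum>i<m. \<Sum>j<m. cmod (\<psi> i) * cmod (\<psi> j) * c)"
  have up: "f k \<le> Q" for k
  proof -
    have "f k \<le> cmod (mat_form m (B ^\<^sub>m k) \<psi>)" unfolding f_def by (rule complex_Re_le_cmod)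
    also have "\<dots> \<le> (\<Sum>i<m. \<Sum>j<m. cmod (cnj (\<psi> i) * \<psi> j * (B ^\<^sub>m k) $$ (i, j)))"
      unfolding mat_form_def by (intro order_trans[OF norm_sum] sum_mono norm_sum)
    also have "\<dots> \<le> Q" unfolding Q_def
      using c[of k] B by (intro sum_mono) (auto simp: norm_mult norm_bound_def intro!: mult_left_mono)
    finally show ?thesis .
  qed
  obtain k where "Q < f 1 ^ k" using real_arch_pow[of "f 1" Q] b f1 by auto
  also have "f 1 ^ k \<le> f 1 ^ (2 ^ k)" using b f1 by (intro power_increasing) (auto intro: less_imp_le)
  finally show False using low[of k] up[of "2 ^ k"] by simp
qed

text \<open>Boundedness of powers takes the place of diagonalisation. Adding c, the largest modulus
  of an eigenvalue, makes the spectrum nonnegative; dividing by R, which exceeds the shifted maximum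
  by \<open>e\<close>, brings the spectral radius below 1. The bound by 1 for the new matrix
  translates back with error \<open>e\<close>.\<close>

lemma mat_form_le_lambda_max:
  assumes h: "hermitian_mat m A" and m: "m > 0" and \<psi>: "(\<Sum>i<m. (cmod (\<psi> i))\<^sup>2) = 1"
  shows "Re (mat_form m A \<psi>) \<le> lambda_max A"
proof (rule field_le_epsilon)
  fix e :: real assume e: "e > 0"
  define S where "S = {x :: real. eigenvalue A (of_real x)}"
  have S: "finite S" "S \<noteq> {}" unfolding S_def by (rule hermitian_real_spectrum[OF h m])+
  have A: "A \<in> carrier_mat m m" using h by (simp add: hermitian_mat_def)
  define c where "c = Max (abs ` S)"
  have cS: "\<bar>x\<bar> \<le> c" if "x \<in> S" for x unfolding c_def using S that by auto
  have lS: "x \<le> lambda_max A" if "x \<in> S" for x unfolding lambda_max_def S_def[symmetric] using S that by simp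
  define R where "R = lambda_max A + c + e"
  have R: "R > 0" using S cS lS e unfolding R_def by fastforce
  define B where "B = mat m m (\<lambda>(i, j). (A $$ (i, j) + (if i = j then of_real c else 0)) / of_real R)"
  have B: "B \<in> carrier_mat m m" by (simp add: B_def)
  have hB: "hermitian_mat m B" using h unfolding hermitian_mat_def B_def by auto
  have sr: "spectral_radius B < 1"
  proof -
    obtain \<mu> where \<mu>: "eigenvalue B \<mu>" "spectral_radius B = cmod \<mu>"
      using spectral_radius_mem_max(1)[OF B m] unfolding spectrum_def by auto
    from \<mu>(1) obtain v where v: "v \<in> carrier_vec m" "v \<noteq> 0\<^sub>v m" "B *\<^sub>v v = \<mu> \<cdot>\<^sub>v v"
      unfolding eigenvalue_def eigenvector_def using B by auto
    have "A *\<^sub>v v = (of_real R * \<mu> - of_real c) \<cdot>\<^sub>v v"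
    proof (rule eq_vecI)
      fix i assume "i < dim_vec ((of_real R * \<mu> - of_real c) \<cdot>\<^sub>v v)"
      then have i: "i < m" using v by simp
      have "\<mu> * v $ i = (B *\<^sub>v v) $ i" using v i by simp
      also have "\<dots> = (\<Sum>j<m. B $$ (i, j) * v $ j)"
        by (rule mult_mat_vec_index[OF B v(1) i])
      also have "\<dots> = (\<Sum>j<m. (A $$ (i, j) * v $ j + (if i = j then of_real c * v $ j else 0)) / of_real R)"
        using i by (intro sum.cong refl) (auto simp: B_def field_simps)
      also have "\<dots> = ((\<Sum>j<m. A $$ (i, j) * v $ j) + of_real c * v $ i) / of_real R"
        using i by (simp add: sum_divide_distrib[symmetric] sum.distrib)
      also have "(\<Sum>j<m. A $$ (i, j) * v $ j) = (A *\<^sub>v v) $ i"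
        using mult_mat_vec_index[OF A v(1) i] by simp
      finally show "(A *\<^sub>v v) $ i = ((of_real R * \<mu> - of_real c) \<cdot>\<^sub>v v) $ i"
        using R v i by (simp add: field_simps)
    qed (use A v in auto)
    then have ev: "eigenvalue A (of_real R * \<mu> - of_real c)"
      unfolding eigenvalue_def eigenvector_def using A v by auto
    define x where "x = Re (of_real R * \<mu> - of_real c)"
    have x: "of_real R * \<mu> - of_real c = of_real x"
      unfolding x_def by (rule hermitian_eigenvalue_real[OF h ev])
    then have xS: "x \<in> S" using ev unfolding S_def by simp
    have "\<mu> = of_real ((x + c) / R)" using x R by (simp add: field_simps)
    then have "cmod \<mu> = \<bar>(x + c) / R\<bar>" by (simp only: norm_of_real)
    also have "\<dots> < 1" using cS[OF xS] lS[OF xS] e R by (auto simp: R_def field_simps)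
    finally show ?thesis using \<mu> by simp
  qed
  have eq: "mat_form m B \<psi> = (mat_form m A \<psi> + of_real c) / of_real R"
  proof -
    have "mat_form m B \<psi> = (\<Sum>i<m. \<Sum>j<m. (cnj (\<psi> i) * \<psi> j * A $$ (i, j) + (if i = j then cnj (\<psi> i) * \<psi> j * of_real c else 0)) / of_real R)"
      unfolding mat_form_def B_def by (intro sum.cong refl) (auto simp: field_simps)
    also have "\<dots> = (mat_form m A \<psi> + (\<Sum>i<m. cnj (\<psi> i) * \<psi> i * of_real c)) / of_real R"
      by (simp add: sum_divide_distrib[symmetric] sum.distrib mat_form_def)
    also have "(\<Sum>i<m. cnj (\<psi> i) * \<psi> i * of_real c) = of_real (\<Sum>i<m. (cmod (\<psi> i))\<^sup>2) * of_real c"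
      unfolding of_real_sum sum_distrib_right by (intro sum.cong refl) (simp only: complex_norm_square mult_ac)
    finally show ?thesis by (simp add: \<psi>)
  qed
  have "(Re (mat_form m A \<psi>) + c) / R \<le> 1"
    using mat_form_le_one[OF hB m sr \<psi>] unfolding eq by (simp add: Re_divide_of_real)
  then show "Re (mat_form m A \<psi>) \<le> lambda_max A + e" using R by (simp add: R_def field_simps)
qed

subsection \<open>Energies of the Quantum Max-Cut Hamiltonian\<close>

abbreviation id2 :: "nat \<Rightarrow> nat \<Rightarrow> complex" where
  "id2 \<equiv> \<lambda>a b. if a = b then 1 else 0"

definition site2 :: "nat \<Rightarrow> nat \<Rightarrow> nat \<Rightarrow> nat \<Rightarrow> nat \<Rightarrow> nat \<Rightarrow> complex" where
  "site2 l u v k = (if k = u \<or> k = v then sigma l else id2)"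

definition tensor_entry :: "nat \<Rightarrow> (nat \<Rightarrow> nat \<Rightarrow> nat \<Rightarrow> complex) \<Rightarrow> nat \<Rightarrow> nat \<Rightarrow> complex" where
  "tensor_entry n A i j = (\<Prod>k<n. A k (qbit i k) (qbit j k))"

lemma finite_edges [simp]: "finite (edges n)"
  by (rule finite_subset[of _ "{..<n} \<times> {..<n}"]) (auto simp: edges_def)

lemma h_edge_entry:
  assumes "i < 2^n" "j < 2^n"
  shows "h_edge n u v $$ (i, j) =
    of_real (1/4) * (tensor_entry n (\<lambda>_. id2) i j - (\<Sum>l<3. tensor_entry n (site2 l u v) i j))"
proof -
  have 1: "tensor_ops n (\<lambda>_. pauliI) $$ (i, j) = tensor_entry n (\<lambda>_. id2) i j"
    using assms unfolding tensor_ops_def tensor_entry_def by (simp add: pauliI_entry)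
  have 2: "two_site n P u v $$ (i, j) = tensor_entry n (site2 l u v) i j"
    if "\<And>a b. P $$ (a, b) = sigma l a b" for P l
    using assms that unfolding two_site_def tensor_ops_def tensor_entry_def site2_def
    by (auto simp: pauliI_entry intro!: prod.cong)
  have X: "two_site n pauliX u v $$ (i, j) = tensor_entry n (site2 0 u v) i j"
    by (rule 2) (simp add: sigma_def)
  have Y: "two_site n pauliY u v $$ (i, j) = tensor_entry n (site2 (Suc 0) u v) i j"
    by (rule 2) (simp add: sigma_def)
  have Z: "two_site n pauliZ u v $$ (i, j) = tensor_entry n (site2 2 u v) i j"
    by (rule 2) (simp add: sigma_def)
  have d: "dim_row (two_site n P u v) = 2^n" "dim_col (two_site n P u v) = 2^n" for P
    by (simp_all add: two_site_def tensor_ops_def)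
  have d': "dim_row (tensor_ops n P) = 2^n" "dim_col (tensor_ops n P) = 2^n" for P
    by (simp_all add: tensor_ops_def)
  show ?thesis
    using assms unfolding h_edge_def sum_lessThan_3 X[symmetric] Y[symmetric] Z[symmetric] 1[symmetric]
    by (simp add: d d')
qed

lemma tensor_form_entry: "tensor_form n \<psi> A = (\<Sum>i<2^n. \<Sum>j<2^n. cnj (\<psi> i) * \<psi> j * tensor_entry n A i j)"
  unfolding tensor_form_def tensor_entry_def ..

lemma H_G_entry:
  assumes "i < 2^n" "j < 2^n"
  shows "H_G n w $$ (i, j) = (\<Sum>e\<in>edges n. of_real (w e / 4) *
    (tensor_entry n (\<lambda>_. id2) i j - (\<Sum>l<3. tensor_entry n (site2 l (fst e) (snd e)) i j)))"
  using assms unfolding H_G_def by (simp add: h_edge_entry)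

lemma H_G_form:
  "mat_form (2^n) (H_G n w) \<psi> = (\<Sum>e\<in>edges n. of_real (w e / 4) *
    (tensor_form n \<psi> (\<lambda>_. id2) - (\<Sum>l<3. tensor_form n \<psi> (site2 l (fst e) (snd e)))))"
proof -
  define Q where "Q e i j = tensor_entry n (\<lambda>_. id2) i j - (\<Sum>l<3. tensor_entry n (site2 l (fst e) (snd e)) i j)" for e i j
  have "mat_form (2^n) (H_G n w) \<psi> = (\<Sum>i<2^n. \<Sum>j<2^n. \<Sum>e\<in>edges n. of_real (w e / 4) * (cnj (\<psi> i) * \<psi> j * Q e i j))"
    unfolding mat_form_def Q_def by (intro sum.cong refl) (simp add: H_G_entry sum_distrib_left mult_ac)
  also have "\<dots> = (\<Sum>i<2^n. \<Sum>e\<in>edges n. \<Sum>j<2^n. of_real (w e / 4) * (cnj (\<psi> i) * \<psi> j * Q e i j))"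
    by (intro sum.cong refl sum.swap)
  also have "\<dots> = (\<Sum>e\<in>edges n. \<Sum>i<2^n. \<Sum>j<2^n. of_real (w e / 4) * (cnj (\<psi> i) * \<psi> j * Q e i j))"
    by (rule sum.swap)
  also have "\<dots> = (\<Sum>e\<in>edges n. of_real (w e / 4) * (\<Sum>i<2^n. \<Sum>j<2^n. cnj (\<psi> i) * \<psi> j * Q e i j))"
    by (simp only: sum_distrib_left)
  moreover have "(\<Sum>i<2^n. \<Sum>j<2^n. cnj (\<psi> i) * \<psi> j * Q e i j) =
    tensor_form n \<psi> (\<lambda>_. id2) - (\<Sum>l<3. tensor_form n \<psi> (site2 l (fst e) (snd e)))" for e
    unfolding tensor_form_entry Q_def sum_lessThan_3 right_diff_distrib distrib_left sum_subtractf sum.distrib ..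
  ultimately show ?thesis by simp
qed

lemma less_3_iff: "(l::nat) < 3 \<longleftrightarrow> l = 0 \<or> l = Suc 0 \<or> l = 2" by arith

lemma cnj_sigma: "a < 2 \<Longrightarrow> b < 2 \<Longrightarrow> l < 3 \<Longrightarrow> cnj (sigma l a b) = sigma l b a"
  by (auto simp: less_2_iff less_3_iff)

lemma hermitian_H_G: "hermitian_mat (2^n) (H_G n w)"
proof -
  have i: "cnj (tensor_entry n (\<lambda>_. id2) i j) = tensor_entry n (\<lambda>_. id2) j i" for i j
    unfolding tensor_entry_def cnj_prod by (intro prod.cong) auto
  have s: "cnj (tensor_entry n (site2 l u v) i j) = tensor_entry n (site2 l u v) j i" if "l < 3" for l u v i j
    unfolding tensor_entry_def cnj_prod site2_def using that by (intro prod.cong) (auto simp: cnj_sigma)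
  have "cnj (\<Sum>l<3. tensor_entry n (site2 l u v) i j) = (\<Sum>l<3. tensor_entry n (site2 l u v) j i)" for u v i j
    unfolding cnj_sum using s by (intro sum.cong) auto
  then have "cnj (H_G n w $$ (i, j)) = H_G n w $$ (j, i)" if "i < 2^n" "j < 2^n" for i j
    using that i by (simp add: H_G_entry)
  then show ?thesis unfolding hermitian_mat_def H_G_def by auto
qed

text \<open>A homogeneous form of the variational bound, for the unnormalised vectors into which a
  mixed product state decomposes.\<close>

lemma mat_form_le_lambda_max_norm:
  assumes h: "hermitian_mat m A" and m: "m > 0"
  shows "Re (mat_form m A \<psi>) \<le> lambda_max A * (\<Sum>i<m. (cmod (\<psi> i))\<^sup>2)"
proof -
  define s where "s = (\<Sum>i<m. (cmod (\<psi> i))\<^sup>2)"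
  show ?thesis
  proof (cases "s = 0")
    case True
    then have "\<psi> i = 0" if "i < m" for i
      using that unfolding s_def by (subst (asm) sum_nonneg_eq_0_iff) auto
    then have "mat_form m A \<psi> = 0" unfolding mat_form_def by (intro sum.neutral) auto
    then show ?thesis using True by (simp add: s_def)
  next
    case False
    have s: "s > 0" using False unfolding s_def by (simp add: sum_nonneg order_less_le)
    define \<phi> where "\<phi> i = \<psi> i / of_real (sqrt s)" for i
    have "(\<Sum>i<m. (cmod (\<phi> i))\<^sup>2) = (\<Sum>i<m. (cmod (\<psi> i))\<^sup>2) / s"
      unfolding sum_divide_distrib using s by (intro sum.cong refl) (auto simp: \<phi>_def norm_divide power_divide)
    then have "(\<Sum>i<m. (cmod (\<phi> i))\<^sup>2) = 1" using s by (simp add: s_def[symmetric])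
    from mat_form_le_lambda_max[OF h m this]
    have 1: "Re (mat_form m A \<phi>) \<le> lambda_max A" .
    have ss: "complex_of_real (sqrt s) * of_real (sqrt s) = of_real s"
      using s by (simp only: of_real_mult[symmetric] real_sqrt_mult_self abs_of_pos)
    have "mat_form m A \<psi> = of_real s * mat_form m A \<phi>"
      unfolding mat_form_def sum_distrib_left
    proof (intro sum.cong refl)
      fix i j
      show "cnj (\<psi> i) * \<psi> j * A $$ (i, j) = of_real s * (cnj (\<phi> i) * \<phi> j * A $$ (i, j))"
        unfolding \<phi>_def ss[symmetric] using s by simp
    qed
    then have "Re (mat_form m A \<psi>) = s * Re (mat_form m A \<phi>)" by simp
    also have "\<dots> \<le> s * lambda_max A" using 1 s by simp
    finally show ?thesis by (simp add: s_def mult.commute)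
  qed
qed

text \<open>The product of the density matrices with Bloch vectors \<open>r u\<close> splits through
  its Gram factors into vectors \<open>b t\<close> of total squared norm 1. Their energies add up to
  the energy of the product state, and each is bounded by \<open>lambda_max\<close> times its
  squared norm. Vectors in the interior of the ball, which give mixed states, are thereby
  allowed.\<close>

lemma QMaxCut_ge_product:
  fixes r :: "nat \<Rightarrow> nat \<Rightarrow> real"
  assumes r: "\<And>u. u < n \<Longrightarrow> (\<Sum>l<3. (r u l)\<^sup>2) \<le> 1"
  shows "(\<Sum>e\<in>edges n. w e * (1/4 - 1/4 * (\<Sum>l<3. r (fst e) l * r (snd e) l))) \<le> QMaxCut n w"
proof -
  define R where "R k a b = of_real (1/2) * bloch (r k) a b" for k a b
  have "gram2 (R k)" if "k < n" for k
    unfolding R_def[abs_def] using gram2_scale[OF gram2_bloch[OF r[OF that]], of "1/2"] by simp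
  then obtain b :: "nat \<Rightarrow> nat \<Rightarrow> complex" where b: "\<And>i j. tensor_entry n R i j = (\<Sum>t<2^n. cnj (b t i) * b t j)"
    using gram2_tensor[of n R] unfolding tensor_entry_def by auto
  have S: "(\<Sum>t<2^n. tensor_form n (b t) A) = (\<Prod>k<n. \<Sum>x<2. \<Sum>y<2. A k x y * R k x y)" for A
  proof -
    have "(\<Sum>t<2^n. tensor_form n (b t) A) =
       (\<Sum>t<2^n. \<Sum>i<2^n. \<Sum>j<2^n. cnj (b t i) * b t j * tensor_entry n A i j)"
      unfolding tensor_form_entry ..
    also have "\<dots> = (\<Sum>i<2^n. \<Sum>t<2^n. \<Sum>j<2^n. cnj (b t i) * b t j * tensor_entry n A i j)" by (rule sum.swap)
    also have "\<dots> = (\<Sum>i<2^n. \<Sum>j<2^n. \<Sum>t<2^n. cnj (b t i) * b t j * tensor_entry n A i j)"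
      by (intro sum.cong refl sum.swap)
    also have "\<dots> = (\<Sum>i<2^n. \<Sum>j<2^n. tensor_entry n R i j * tensor_entry n A i j)"
      by (simp only: b sum_distrib_right)
    also have "\<dots> = (\<Sum>i<2^n. \<Sum>j<2^n. \<Prod>k<n. A k (qbit i k) (qbit j k) * R k (qbit i k) (qbit j k))"
      by (simp only: tensor_entry_def prod.distrib mult.commute)
    also have "\<dots> = (\<Prod>k<n. \<Sum>x<2. \<Sum>y<2. A k x y * R k x y)" by (rule sum_qbit_prod2)
    finally show ?thesis .
  qed
  have tr: "(\<Sum>x<2. \<Sum>y<2. id2 x y * R k x y) = 1" for k
    by (simp add: sum_lessThan_2 R_def bloch_def sum_lessThan_3 field_simps)
  \<comment> \<open>Pairing entry with entry computes a trace against the transpose, which reverses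
    the sign of Pauli Y. On an edge the sign occurs twice and cancels.\<close>
  define s where "s l = (if l = Suc 0 then -1 else 1 :: real)" for l :: nat
  have pa: "(\<Sum>x<2. \<Sum>y<2. sigma l x y * R k x y) = of_real (s l * r k l)" if "l < 3" for k l
    using that by (auto simp: less_3_iff sum_lessThan_2 R_def bloch_def sum_lessThan_3 s_def field_simps)
  have S1: "(\<Sum>t<2^n. tensor_form n (b t) (\<lambda>_. id2)) = 1"
    unfolding S by (simp only: tr prod.neutral_const)
  have S2: "(\<Sum>t<2^n. tensor_form n (b t) (site2 l u v)) = of_real (r u l * r v l)" if "u < v" "v < n" "l < 3" for u v l
  proof -
    have "(\<Sum>x<2. \<Sum>y<2. site2 l u v k x y * R k x y) = (if k = u \<or> k = v then of_real (s l * r k l) else 1)" for k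
      unfolding site2_def using pa[OF that(3)] tr by simp
    then have "(\<Sum>t<2^n. tensor_form n (b t) (site2 l u v)) = (\<Prod>k<n. if k = u \<or> k = v then of_real (s l * r k l) else 1)"
      unfolding S by simp
    also have "\<dots> = (\<Prod>k\<in>{u, v}. of_real (s l * r k l))"
      using that by (intro prod.mono_neutral_cong_right) auto
    also have "\<dots> = of_real (s l * r u l) * of_real (s l * r v l)" using that by simp
    also have "\<dots> = of_real (r u l * r v l)" by (simp add: s_def)
    finally show ?thesis .
  qed
  have nb: "(\<Sum>t<2^n. \<Sum>i<2^n. (cmod (b t i))\<^sup>2) = 1"
  proof -
    have "complex_of_real (\<Sum>t<2^n. \<Sum>i<2^n. (cmod (b t i))\<^sup>2) = 1"
      using S1 unfolding tensor_form_id of_real_sum .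
    then show ?thesis by (simp only: of_real_eq_1_iff)
  qed
  have "(\<Sum>t<2^n. mat_form (2^n) (H_G n w) (b t)) =
     (\<Sum>e\<in>edges n. \<Sum>t<2^n. of_real (w e / 4) *
      (tensor_form n (b t) (\<lambda>_. id2) - (\<Sum>l<3. tensor_form n (b t) (site2 l (fst e) (snd e)))))"
    unfolding H_G_form by (rule sum.swap)
  also have "\<dots> = (\<Sum>e\<in>edges n. of_real (w e * (1/4 - 1/4 * (\<Sum>l<3. r (fst e) l * r (snd e) l))))"
  proof (intro sum.cong refl)
    fix e assume e: "e \<in> edges n"
    then have e': "fst e < snd e" "snd e < n" by (auto simp: edges_def)
    have "(\<Sum>t<2^n. of_real (w e / 4) *
      (tensor_form n (b t) (\<lambda>_. id2) - (\<Sum>l<3. tensor_form n (b t) (site2 l (fst e) (snd e))))) =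
      of_real (w e / 4) * ((\<Sum>t<2^n. tensor_form n (b t) (\<lambda>_. id2)) -
       (\<Sum>l<3. \<Sum>t<2^n. tensor_form n (b t) (site2 l (fst e) (snd e))))"
      unfolding sum_distrib_left[symmetric] sum_subtractf
      by (subst sum.swap[of _ "{..<3}"]) (rule refl)
    also have "(\<Sum>l<3. \<Sum>t<2^n. tensor_form n (b t) (site2 l (fst e) (snd e))) =
       (\<Sum>l<3. of_real (r (fst e) l * r (snd e) l))"
      using S2[OF e'] by (intro sum.cong refl) auto
    also have "of_real (w e / 4) * ((\<Sum>t<2^n. tensor_form n (b t) (\<lambda>_. id2)) - (\<Sum>l<3. complex_of_real (r (fst e) l * r (snd e) l))) =
       of_real (w e / 4 * (1 - (\<Sum>l<3. r (fst e) l * r (snd e) l)))"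
      unfolding S1 by (simp only: of_real_mult of_real_diff of_real_1 of_real_sum)
    also have "w e / 4 * (1 - (\<Sum>l<3. r (fst e) l * r (snd e) l)) = w e * (1/4 - 1/4 * (\<Sum>l<3. r (fst e) l * r (snd e) l))"
      by (simp add: right_diff_distrib)
    finally show "(\<Sum>t<2^n. of_real (w e / 4) *
      (tensor_form n (b t) (\<lambda>_. id2) - (\<Sum>l<3. tensor_form n (b t) (site2 l (fst e) (snd e))))) =
      of_real (w e * (1/4 - 1/4 * (\<Sum>l<3. r (fst e) l * r (snd e) l)))"
      .
  qed
  finally have eq: "(\<Sum>t<2^n. Re (mat_form (2^n) (H_G n w) (b t))) =
     (\<Sum>e\<in>edges n. w e * (1/4 - 1/4 * (\<Sum>l<3. r (fst e) l * r (snd e) l)))"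
    by (simp only: Re_sum[symmetric] of_real_sum[symmetric] Re_complex_of_real)
  have "(\<Sum>t<2^n. Re (mat_form (2^n) (H_G n w) (b t))) \<le>
     (\<Sum>t<2^n. lambda_max (H_G n w) * (\<Sum>i<2^n. (cmod (b t i))\<^sup>2))"
    by (intro sum_mono mat_form_le_lambda_max_norm hermitian_H_G) simp
  also have "\<dots> = lambda_max (H_G n w)" by (simp only: sum_distrib_left[symmetric] nb mult_1_right)
  finally show ?thesis unfolding eq QMaxCut_def .
qed

text \<open>Edges join distinct qubits, so the energy of any state, entangled or not, depends only
  on its classical outcome law.\<close>

lemma energy_eq_born:
  assumes "(\<Sum>i<2^n. (cmod (\<psi> i))\<^sup>2) = 1"
  shows "Re (mat_form (2^n) (H_G n w) \<psi>) = (\<Sum>e\<in>edges n. w e *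
    (1/4 - 1/4 * (\<Sum>j<3. \<Sum>\<omega>\<in>outcomes n. born n \<psi> \<omega> * (out_vec (\<omega> (fst e)) j * out_vec (\<omega> (snd e)) j))))"
proof -
  have "Re (mat_form (2^n) (H_G n w) \<psi>) = (\<Sum>e\<in>edges n. w e / 4 *
    (Re (tensor_form n \<psi> (\<lambda>_. id2)) - (\<Sum>l<3. Re (tensor_form n \<psi> (site2 l (fst e) (snd e))))))"
    unfolding H_G_form Re_sum by (intro sum.cong refl) (simp add: Re_sum)
  also have "\<dots> = (\<Sum>e\<in>edges n. w e *
    (1/4 - 1/4 * (\<Sum>j<3. \<Sum>\<omega>\<in>outcomes n. born n \<psi> \<omega> * (out_vec (\<omega> (fst e)) j * out_vec (\<omega> (snd e)) j))))"
  proof (intro sum.cong refl)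
    fix e assume e: "e \<in> edges n"
    then have e': "fst e < n" "snd e < n" "fst e \<noteq> snd e" by (auto simp: edges_def)
    have "(\<Sum>l<3. Re (tensor_form n \<psi> (site2 l (fst e) (snd e)))) =
      (\<Sum>j<3. \<Sum>\<omega>\<in>outcomes n. born n \<psi> \<omega> * (out_vec (\<omega> (fst e)) j * out_vec (\<omega> (snd e)) j))"
      by (intro sum.cong refl) (subst born_correlation[OF e'], auto simp: site2_def[abs_def])
    then show "w e / 4 * (Re (tensor_form n \<psi> (\<lambda>_. id2)) - (\<Sum>l<3. Re (tensor_form n \<psi> (site2 l (fst e) (snd e))))) =
      w e * (1/4 - 1/4 * (\<Sum>j<3. \<Sum>\<omega>\<in>outcomes n. born n \<psi> \<omega> * (out_vec (\<omega> (fst e)) j * out_vec (\<omega> (snd e)) j)))"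
      by (simp only: tensor_form_id assms Re_complex_of_real) (simp add: right_diff_distrib)
  qed
  finally show ?thesis .
qed

subsection \<open>Blown-up graphs\<close>

text \<open>A copy outside \<open>T\<close> has its conditional mean in the Bloch ball; for a copy
  inside \<open>T\<close> there remains the length 3 of an outcome vector. At most
  \<open>card T\<close> copies of the cloud are of the second kind, whence the excess 3 |T| / M over
  1.\<close>

lemma cexp_cloud_mean_le:
  assumes M: "M > 0" and uM: "u * M + M \<le> n" and T: "finite T" and \<omega>: "\<omega> \<in> outcomes n"
    and r: "(\<Sum>j<3. (r j)\<^sup>2) \<le> 1"
  shows "(\<Sum>j<3. r j * cexp (outcomes n) (born n \<psi>) T (cloud_mean M u j) \<omega>) \<le> 1 + 3 * real (card T) / real M"
proof -
  define C where "C = {\<omega>'\<in>outcomes n. \<forall>k\<in>T. \<omega>' k = \<omega> k}"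
  have C': "C = {\<omega>'\<in>outcomes n. \<forall>k\<in>T \<inter> {..<n}. \<omega>' k = \<omega> k}"
  proof -
    have "\<omega>' k = \<omega> k" if "\<omega>' \<in> outcomes n" "k \<notin> {..<n}" for \<omega>' k
      using that \<omega> PiE_arb by metis
    then show ?thesis unfolding C_def by blast
  qed
  define P where "P = (\<Sum>\<omega>'\<in>C. born n \<psi> \<omega>')"
  have P0: "P \<ge> 0" unfolding P_def C_def by (intro sum_nonneg born_nonneg) auto
  define v where "v a j = (\<Sum>\<omega>'\<in>C. born n \<psi> \<omega>' * out_vec (\<omega>' a) j)" for a j
  have ce: "cexp (outcomes n) (born n \<psi>) T (\<lambda>\<omega>. out_vec (\<omega> a) j) \<omega> = v a j / P" for a j
    unfolding cexp_def C_def[symmetric] v_def P_def ..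
  have rj: "\<bar>r j\<bar> \<le> 1" if "j < 3" for j
  proof -
    have "(r j)\<^sup>2 \<le> (\<Sum>j<3. (r j)\<^sup>2)" using that by (intro member_le_sum) auto
    then have "(r j)\<^sup>2 \<le> 1" using r by simp
    then show ?thesis using abs_le_square_iff[of "r j" 1] by simp
  qed
  have b3: "(\<Sum>j<3. r j * v a j) \<le> 3 * P" if a: "a < n" for a
  proof -
    have "(\<Sum>j<3. r j * v a j) = (\<Sum>\<omega>'\<in>C. born n \<psi> \<omega>' * (\<Sum>j<3. r j * out_vec (\<omega>' a) j))"
      unfolding v_def sum_distrib_left by (subst sum.swap) (simp add: mult.left_commute)
    also have "\<dots> \<le> (\<Sum>\<omega>'\<in>C. born n \<psi> \<omega>' * 3)"
    proof (intro sum_mono mult_left_mono)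
      fix \<omega>' assume w: "\<omega>' \<in> C"
      then have "\<omega>' a \<in> outs" using a unfolding C_def by (auto elim: PiE_mem)
      then have f: "fst (\<omega>' a) < 3" by (auto simp: outs_def)
      have "(\<Sum>j<3. r j * out_vec (\<omega>' a) j) = r (fst (\<omega>' a)) * (3 * out_sgn (\<omega>' a))"
        unfolding out_vec_def by (rule sum_single_3[OF f])
      also have "\<dots> \<le> 3" using rj[OF f] by (auto simp: out_sgn_def)
      finally show "(\<Sum>j<3. r j * out_vec (\<omega>' a) j) \<le> 3" .
      show "0 \<le> born n \<psi> \<omega>'" using w unfolding C_def by (auto intro: born_nonneg)
    qed
    also have "\<dots> = 3 * P" by (simp add: P_def sum_distrib_right[symmetric])
    finally show ?thesis .
  qed
  \<comment> \<open>If P = 0 the quotients are 0 by convention and the bound is trivial.\<close>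
  have one: "(\<Sum>j<3. r j * (v a j / P)) \<le> 1 + (if a \<in> T then 3 else 0)" if a: "a < n" for a
  proof (cases "P = 0")
    case False
    with P0 have P: "P > 0" by simp
    have "(\<Sum>j<3. r j * (v a j / P)) = (\<Sum>j<3. r j * v a j) / P" by (simp add: sum_divide_distrib)
    also have "\<dots> \<le> 1 + (if a \<in> T then 3 else 0)"
    proof (cases "a \<in> T")
      case True
      then show ?thesis using b3[OF a] P by (simp add: field_simps)
    next
      case False
      have "(\<Sum>j<3. r j * v a j) \<le> P"
        unfolding v_def P_def C' by (rule born_conditional_ball[OF a False \<omega> r])
      then show ?thesis using False P by (simp add: field_simps)
    qed
    finally show ?thesis .
  qed auto
  have "(\<Sum>j<3. r j * cexp (outcomes n) (born n \<psi>) T (cloud_mean M u j) \<omega>) =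
     (\<Sum>j<3. r j * ((1 / real M) * (\<Sum>a<M. v (u * M + a) j / P)))"
    using M by (simp only: cloud_mean_def[abs_def] cexp_sum ce)
  also have "\<dots> = (1 / real M) * (\<Sum>a<M. \<Sum>j<3. r j * (v (u * M + a) j / P))"
    by (subst sum.swap) (simp only: sum_distrib_left mult.left_commute)
  also have "\<dots> \<le> (1 / real M) * (\<Sum>a<M. 1 + (if u * M + a \<in> T then 3 else 0))"
    using uM by (intro mult_left_mono sum_mono one) auto
  also have "(\<Sum>a<M. 1 + (if u * M + a \<in> T then 3 else 0)) = real M + 3 * real (card {a\<in>{..<M}. u * M + a \<in> T})"
    by (simp add: sum.distrib sum.inter_filter[symmetric])
  also have "(1 / real M) * (real M + 3 * real (card {a\<in>{..<M}. u * M + a \<in> T})) \<le> (1 / real M) * (real M + 3 * real (card T))"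
  proof -
    have "card {a\<in>{..<M}. u * M + a \<in> T} \<le> card T"
      by (rule card_inj_on_le[of "\<lambda>a. u * M + a"]) (use T in \<open>auto simp: inj_on_def\<close>)
    then show ?thesis by (intro mult_left_mono add_mono) auto
  qed
  finally show ?thesis using M by (simp add: field_simps)
qed

text \<open>For every outcome the conditional cloud means, shrunk by \<theta>, form an assignment of
  vectors in the ball, so their weighted correlation is at least \<theta>^2 F. Averaging over
  outcomes and paying \<eta> for the conditional variances transfers this to the unconditional cloud
  correlations of the state.\<close>

lemma born_cloud_bound:
  fixes F \<eta> :: real
  assumes M: "M > 0" and \<psi>: "(\<Sum>i<2^(N*M). (cmod (\<psi> i))\<^sup>2) = 1"
    and W: "\<And>u v. 0 \<le> W u v" "(\<Sum>u<N. \<Sum>v<N. W u v) = 1"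
    and F: "\<And>g. (\<And>u. u < N \<Longrightarrow> (\<Sum>j<3. (g u j)\<^sup>2) \<le> 1) \<Longrightarrow>
      F \<le> (\<Sum>u<N. \<Sum>v<N. W u v * (\<Sum>j<(3::nat). g u j * g v j))"
    and \<eta>: "\<eta> > 0" and K: "81 < real K * \<eta>\<^sup>2"
  defines "n \<equiv> N * M"
  shows "(1 + 3 * real (K * N) / real M)\<^sup>2 * F - \<eta> \<le>
    (\<Sum>u<N. \<Sum>v<N. W u v * (\<Sum>j<3. \<Sum>\<omega>\<in>outcomes n. born n \<psi> \<omega> * (cloud_mean M u j \<omega> * cloud_mean M v j \<omega>)))"
proof -
  define p where "p = born n \<psi>"
  have pos: "\<And>\<omega>. \<omega> \<in> outcomes n \<Longrightarrow> 0 \<le> p \<omega>" unfolding p_def by (rule born_nonneg)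
  have total: "(\<Sum>\<omega>\<in>outcomes n. p \<omega>) = 1" unfolding p_def sum_born n_def by (rule \<psi>)
  define \<nu> where "\<nu> u = ((\<Sum>v<N. W u v) + (\<Sum>v<N. W v u)) / 2" for u
  have \<nu>0: "0 \<le> \<nu> u" for u unfolding \<nu>_def by (intro divide_nonneg_pos add_nonneg_nonneg sum_nonneg W) auto
  have \<nu>1: "(\<Sum>u<N. \<nu> u) = 1"
  proof -
    have "(\<Sum>u<N. \<Sum>v<N. W v u) = 1" by (subst sum.swap) (rule W)
    then show ?thesis using W(2) by (simp add: \<nu>_def sum_divide_distrib[symmetric] sum.distrib)
  qed
  have "\<exists>T. finite T \<and> card T \<le> K * N \<and> (\<Sum>u<N. \<nu> u * cloud_var n M p T u) \<le> \<eta>"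
    by (rule ex_small_conditioning[OF pos total M _ \<nu>0 \<nu>1 \<eta> K]) (auto simp: n_def)
  then obtain T where T: "finite T" "card T \<le> K * N" "(\<Sum>u<N. \<nu> u * cloud_var n M p T u) \<le> \<eta>" by blast
  define \<theta> where "\<theta> = 1 + 3 * real (K * N) / real M"
  have \<theta>: "\<theta> > 0" unfolding \<theta>_def by (intro add_pos_nonneg) auto
  define f where "f u j \<omega> = cexp (outcomes n) p T (cloud_mean M u j) \<omega>" for u j \<omega>
  have ball: "(\<Sum>j<3. (f u j \<omega> / \<theta>)\<^sup>2) \<le> 1" if "u < N" "\<omega> \<in> outcomes n" for u \<omega>
  proof -
    have "Suc u * M \<le> N * M" using that by (intro mult_le_mono) auto
    then have uM: "u * M + M \<le> n" by (simp add: n_def)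
    have "(\<Sum>j<3. r j * f u j \<omega>) \<le> \<theta>" if r: "(\<Sum>j<3. (r j)\<^sup>2) \<le> 1" for r
    proof -
      have "(\<Sum>j<3. r j * f u j \<omega>) \<le> 1 + 3 * real (card T) / real M"
        unfolding f_def p_def by (rule cexp_cloud_mean_le[OF M uM T(1) \<open>\<omega> \<in> _\<close> r])
      also have "\<dots> \<le> \<theta>" unfolding \<theta>_def
      proof (intro add_left_mono divide_right_mono)
        show "3 * real (card T) \<le> 3 * real (K * N)" using T(2) by (simp only: of_nat_le_iff mult_le_cancel_left_pos)
      qed simp
      finally show ?thesis .
    qed
    then have "(\<Sum>j<3. (f u j \<omega>)\<^sup>2) \<le> \<theta>\<^sup>2" by (rule sum_sq_le_if_dual)
    moreover have "(\<Sum>j<3. (f u j \<omega> / \<theta>)\<^sup>2) = (\<Sum>j<3. (f u j \<omega>)\<^sup>2) / \<theta>\<^sup>2"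
      by (simp only: power_divide sum_divide_distrib)
    ultimately show ?thesis using \<theta> by (simp add: divide_le_eq)
  qed
  have point: "\<theta>\<^sup>2 * F \<le> (\<Sum>u<N. \<Sum>v<N. W u v * (\<Sum>j<3. f u j \<omega> * f v j \<omega>))" if w: "\<omega> \<in> outcomes n" for \<omega>
  proof -
    have "F \<le> (\<Sum>u<N. \<Sum>v<N. W u v * (\<Sum>j<3. (f u j \<omega> / \<theta>) * (f v j \<omega> / \<theta>)))"
      using F[of "\<lambda>u j. f u j \<omega> / \<theta>"] ball w by blast
    also have "\<dots> = (\<Sum>u<N. \<Sum>v<N. W u v * (\<Sum>j<3. f u j \<omega> * f v j \<omega>)) / \<theta>\<^sup>2"
      unfolding sum_divide_distrib
      by (intro sum.cong refl) (simp add: sum_divide_distrib[symmetric] power2_eq_square)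
    finally show ?thesis using \<theta> by (simp add: field_simps)
  qed
  have "\<theta>\<^sup>2 * F = (\<Sum>\<omega>\<in>outcomes n. p \<omega> * (\<theta>\<^sup>2 * F))" by (simp only: sum_distrib_right[symmetric] total mult_1)
  also have "\<dots> \<le> (\<Sum>\<omega>\<in>outcomes n. p \<omega> * (\<Sum>u<N. \<Sum>v<N. W u v * (\<Sum>j<3. f u j \<omega> * f v j \<omega>)))"
    by (intro sum_mono mult_left_mono point pos) auto
  finally have 1: "\<theta>\<^sup>2 * F \<le> \<dots>" .
  have 2: "(\<Sum>\<omega>\<in>outcomes n. p \<omega> * (\<Sum>u<N. \<Sum>v<N. W u v * (\<Sum>j<3. f u j \<omega> * f v j \<omega>)))
     - (\<Sum>u<N. \<nu> u * cloud_var n M p T u)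
   \<le> (\<Sum>u<N. \<Sum>v<N. W u v * (\<Sum>j<3. \<Sum>\<omega>\<in>outcomes n. p \<omega> * (cloud_mean M u j \<omega> * cloud_mean M v j \<omega>)))"
    unfolding f_def \<nu>_def by (rule cloud_correlation_bound[OF pos total M _ W(1)]) (auto simp: n_def)
  show ?thesis using 1 2 T(3) unfolding \<theta>_def[symmetric] p_def[symmetric] by linarith
qed

text \<open>The square of ordered vertex pairs is the disjoint union of two triangles, exchanged by
  swapping, and the diagonal.\<close>

lemma sum_edges_symmetric:
  fixes A :: "nat \<Rightarrow> nat \<Rightarrow> real"
  shows "(\<Sum>e\<in>edges n. A (fst e) (snd e) + A (snd e) (fst e)) = (\<Sum>p<n. \<Sum>q<n. A p q) - (\<Sum>p<n. A p p)"
proof -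
  define E2 where "E2 = {(p, q). q < p \<and> p < n}"
  define D where "D = (\<lambda>p. (p, p)) ` {..<n}"
  have f2: "finite E2" unfolding E2_def by (rule finite_subset[of _ "{..<n} \<times> {..<n}"]) auto
  have dis: "(edges n \<union> E2) \<inter> D = {}" "edges n \<inter> E2 = {}" by (auto simp: edges_def E2_def D_def)
  have "{..<n} \<times> {..<n} = (edges n \<union> E2) \<union> D" by (auto simp: edges_def E2_def D_def image_iff)
  then have "(\<Sum>p<n. \<Sum>q<n. A p q) = (\<Sum>e\<in>(edges n \<union> E2) \<union> D. A (fst e) (snd e))"
    by (simp add: sum.cartesian_product split_def)
  also have "\<dots> = (\<Sum>e\<in>edges n \<union> E2. A (fst e) (snd e)) + (\<Sum>e\<in>D. A (fst e) (snd e))"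
    by (rule sum.union_disjoint[OF _ _ dis(1)]) (simp_all add: f2 D_def)
  also have "(\<Sum>e\<in>edges n \<union> E2. A (fst e) (snd e)) = (\<Sum>e\<in>edges n. A (fst e) (snd e)) + (\<Sum>e\<in>E2. A (fst e) (snd e))"
    by (rule sum.union_disjoint[OF _ _ dis(2)]) (simp_all add: f2)
  also have "(\<Sum>e\<in>E2. A (fst e) (snd e)) = (\<Sum>e\<in>edges n. A (snd e) (fst e))"
    by (rule sum.reindex_bij_witness[of _ prod.swap prod.swap]) (auto simp: edges_def E2_def)
  also have "(\<Sum>e\<in>D. A (fst e) (snd e)) = (\<Sum>p<n. A p p)"
    unfolding D_def by (subst sum.reindex) (auto simp: inj_on_def)
  finally show ?thesis by (simp add: sum.distrib)
qed

lemma sum_clouds: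
  fixes h :: "nat \<Rightarrow> real"
  shows "(\<Sum>p<N*M. h p) = (\<Sum>u<N. \<Sum>a<M. h (u * M + a))"
proof -
  have "(\<Sum>p<N*M. h p) = (\<Sum>u<N. \<Sum>p=u*M..<u*M+M. h p)" by (rule sum.nat_group[symmetric])
  moreover have "(\<Sum>p=u*M..<u*M+M. h p) = (\<Sum>a<M. h (u * M + a))" for u
    using sum.shift_bounds_nat_ivl[of h 0 "u*M" M] by (simp add: atLeast0LessThan add.commute)
  ultimately show ?thesis by simp
qed

text \<open>The weight that survives when pairs of a copy with itself are dropped: these are a
  fraction 1/M of the pairs within a cloud.\<close>

definition loop_defect :: "nat \<Rightarrow> nat \<Rightarrow> (nat \<Rightarrow> nat \<Rightarrow> real) \<Rightarrow> real" where
  "loop_defect N M W = 1 - (\<Sum>u<N. W u u) / real M"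

text \<open>Every vertex is blown up into a cloud of \<open>M\<close> copies, with vertex \<open>p\<close> belonging to
  cloud \<open>p div M\<close>. A self-loop of \<open>W\<close> becomes edges inside a cloud, so only a fraction of
  order \<open>1/M\<close> of its weight is lost.\<close>

definition blowup :: "nat \<Rightarrow> nat \<Rightarrow> (nat \<Rightarrow> nat \<Rightarrow> real) \<Rightarrow> nat \<times> nat \<Rightarrow> real" where
  "blowup N M W e = (W (fst e div M) (snd e div M) + W (snd e div M) (fst e div M)) /
     ((real M)\<^sup>2 * loop_defect N M W)"

context
  fixes N M :: nat and W :: "nat \<Rightarrow> nat \<Rightarrow> real"
  assumes M: "M > 1" and W: "\<And>u v. 0 \<le> W u v" "(\<Sum>u<N. \<Sum>v<N. W u v) = 1"
begin

lemma loop_weight: "0 \<le> (\<Sum>u<N. W u u)" "(\<Sum>u<N. W u u) \<le> 1"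
proof -
  show "0 \<le> (\<Sum>u<N. W u u)" by (intro sum_nonneg W)
  have "(\<Sum>u<N. W u u) \<le> (\<Sum>u<N. \<Sum>v<N. W u v)"
    by (intro sum_mono member_le_sum) (auto simp: W)
  then show "(\<Sum>u<N. W u u) \<le> 1" using W by simp
qed

lemma loop_defect_pos: "0 < loop_defect N M W"
proof -
  have "(\<Sum>u<N. W u u) / real M \<le> 1 / real M" by (intro divide_right_mono loop_weight) auto
  also have "\<dots> < 1" using M by simp
  finally show ?thesis unfolding loop_defect_def by simp
qed

text \<open>The edge sum is the sum over all ordered pairs of copies minus the diagonal,
  renormalised; symmetry of \<open>G\<close> lets one edge carry both orders.\<close>

lemma sum_blowup:
  fixes G :: "nat \<Rightarrow> nat \<Rightarrow> real"
  assumes sym: "\<And>p q. G p q = G q p"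
  shows "(\<Sum>e\<in>edges (N*M). blowup N M W e * G (fst e) (snd e)) =
    ((\<Sum>u<N. \<Sum>v<N. W u v * ((\<Sum>a<M. \<Sum>b<M. G (u * M + a) (v * M + b)) / (real M)\<^sup>2)) -
     (\<Sum>u<N. W u u * ((\<Sum>a<M. G (u * M + a) (u * M + a)) / (real M)\<^sup>2))) / loop_defect N M W"
proof -
  define Z where "Z = (real M)\<^sup>2 * loop_defect N M W"
  define A where "A p q = W (p div M) (q div M) * G p q / Z" for p q
  have "(\<Sum>e\<in>edges (N*M). blowup N M W e * G (fst e) (snd e)) = (\<Sum>e\<in>edges (N*M). A (fst e) (snd e) + A (snd e) (fst e))"
  proof (intro sum.cong refl)
    fix e
    show "blowup N M W e * G (fst e) (snd e) = A (fst e) (snd e) + A (snd e) (fst e)"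
      unfolding blowup_def A_def Z_def[symmetric] using sym[of "snd e" "fst e"]
      by (simp add: add_divide_distrib distrib_right)
  qed
  also have "\<dots> = (\<Sum>p<N*M. \<Sum>q<N*M. A p q) - (\<Sum>p<N*M. A p p)" by (rule sum_edges_symmetric)
  also have "(\<Sum>p<N*M. \<Sum>q<N*M. A p q) = (\<Sum>u<N. \<Sum>v<N. W u v * ((\<Sum>a<M. \<Sum>b<M. G (u * M + a) (v * M + b)) / (real M)\<^sup>2)) / loop_defect N M W"
  proof -
    have "(\<Sum>p<N*M. \<Sum>q<N*M. A p q) = (\<Sum>u<N. \<Sum>a<M. \<Sum>v<N. \<Sum>b<M. A (u * M + a) (v * M + b))"
      by (simp only: sum_clouds)
    also have "\<dots> = (\<Sum>u<N. \<Sum>v<N. \<Sum>a<M. \<Sum>b<M. A (u * M + a) (v * M + b))"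
      by (intro sum.cong refl sum.swap)
    also have "\<dots> = (\<Sum>u<N. \<Sum>v<N. W u v * ((\<Sum>a<M. \<Sum>b<M. G (u * M + a) (v * M + b)) / (real M)\<^sup>2) / loop_defect N M W)"
    proof (intro sum.cong refl)
      fix u v
      have "(\<Sum>a<M. \<Sum>b<M. A (u * M + a) (v * M + b)) = (\<Sum>a<M. \<Sum>b<M. W u v / Z * G (u * M + a) (v * M + b))"
        using M by (intro sum.cong refl) (simp add: A_def)
      then show "(\<Sum>a<M. \<Sum>b<M. A (u * M + a) (v * M + b)) =
        W u v * ((\<Sum>a<M. \<Sum>b<M. G (u * M + a) (v * M + b)) / (real M)\<^sup>2) / loop_defect N M W"
        by (simp only: sum_distrib_left[symmetric] Z_def) simp
    qed
    finally show ?thesis by (simp only: sum_divide_distrib)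
  qed
  also have "(\<Sum>p<N*M. A p p) = (\<Sum>u<N. W u u * ((\<Sum>a<M. G (u * M + a) (u * M + a)) / (real M)\<^sup>2)) / loop_defect N M W"
  proof -
    have "(\<Sum>p<N*M. A p p) = (\<Sum>u<N. \<Sum>a<M. A (u * M + a) (u * M + a))" by (simp only: sum_clouds)
    also have "\<dots> = (\<Sum>u<N. W u u * ((\<Sum>a<M. G (u * M + a) (u * M + a)) / (real M)\<^sup>2) / loop_defect N M W)"
    proof (intro sum.cong refl)
      fix u
      have "(\<Sum>a<M. A (u * M + a) (u * M + a)) = (\<Sum>a<M. W u u / Z * G (u * M + a) (u * M + a))"
        using M by (intro sum.cong refl) (simp add: A_def)
      then show "(\<Sum>a<M. A (u * M + a) (u * M + a)) =
        W u u * ((\<Sum>a<M. G (u * M + a) (u * M + a)) / (real M)\<^sup>2) / loop_defect N M W"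
        by (simp only: sum_distrib_left[symmetric] Z_def) simp
    qed
    finally show ?thesis by (simp only: sum_divide_distrib)
  qed
  finally show ?thesis by (simp only: diff_divide_distrib)
qed

lemma weighted_graph_blowup: "weighted_graph (N*M) (blowup N M W)"
proof -
  have "blowup N M W e \<ge> 0" for e
    unfolding blowup_def using loop_defect_pos by (intro divide_nonneg_nonneg add_nonneg_nonneg W) auto
  moreover have "(\<Sum>e\<in>edges (N*M). blowup N M W e) = 1"
  proof -
    have M0: "real M \<noteq> 0" using M by simp
    have "(\<Sum>e\<in>edges (N*M). blowup N M W e) =
      ((\<Sum>u<N. \<Sum>v<N. W u v) - (\<Sum>u<N. W u u * (1 / real M))) / loop_defect N M W"
      using sum_blowup[of "\<lambda>_ _. 1"] M0 by (simp add: power2_eq_square)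
    also have "\<dots> = loop_defect N M W / loop_defect N M W"
      unfolding W loop_defect_def[of N M W] by (simp add: sum_divide_distrib)
    also have "\<dots> = 1" using loop_defect_pos by simp
    finally show ?thesis .
  qed
  ultimately show ?thesis unfolding weighted_graph_def by blast
qed

text \<open>Averaging the outcome correlations over pairs of copies turns them into correlations of
  cloud means, to which \<open>born_cloud_bound\<close> applies. The pairs of a copy with itself
  occur in that average without being edges, and are subtracted.\<close>

lemma QMaxCut_blowup_le:
  fixes F \<eta> :: real
  assumes F: "\<And>g. (\<And>u. u < N \<Longrightarrow> (\<Sum>j<3. (g u j)\<^sup>2) \<le> 1) \<Longrightarrow>
      F \<le> (\<Sum>u<N. \<Sum>v<N. W u v * (\<Sum>j<(3::nat). g u j * g v j))"
    and \<eta>: "\<eta> > 0" and K: "81 < real K * \<eta>\<^sup>2"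
  shows "QMaxCut (N*M) (blowup N M W) \<le>
    1/4 - 1/4 * (((1 + 3 * real (K * N) / real M)\<^sup>2 * F - \<eta> - 9 / real M) / loop_defect N M W)"
  unfolding QMaxCut_def
proof (rule lambda_max_le[OF hermitian_H_G])
  fix \<psi> :: "nat \<Rightarrow> complex" assume \<psi>: "(\<Sum>i<2^(N*M). (cmod (\<psi> i))\<^sup>2) = 1"
  define n where "n = N * M"
  have M0: "M > 0" "real M \<noteq> 0" using M by auto
  define G where "G p q = (\<Sum>j<3. \<Sum>\<omega>\<in>outcomes n. born n \<psi> \<omega> * (out_vec (\<omega> p) j * out_vec (\<omega> q) j))" for p q
  have symG: "G p q = G q p" for p q unfolding G_def by (simp add: mult.commute)
  have "(\<Sum>e\<in>edges n. blowup N M W e * (1/4 - 1/4 * G (fst e) (snd e))) =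
     1/4 * (\<Sum>e\<in>edges n. blowup N M W e) - 1/4 * (\<Sum>e\<in>edges n. blowup N M W e * G (fst e) (snd e))"
    unfolding sum_distrib_left sum_subtractf[symmetric] by (intro sum.cong refl) (simp add: right_diff_distrib)
  also have "(\<Sum>e\<in>edges n. blowup N M W e) = 1"
    using weighted_graph_blowup unfolding weighted_graph_def n_def by blast
  finally have e1: "Re (mat_form (2^n) (H_G n (blowup N M W)) \<psi>) =
      1/4 - 1/4 * (\<Sum>e\<in>edges n. blowup N M W e * G (fst e) (snd e))"
    using energy_eq_born[of \<psi> n "blowup N M W"] \<psi> unfolding G_def n_def by simp
  define Q where "Q = (\<Sum>u<N. \<Sum>v<N. W u v * (\<Sum>j<3. \<Sum>\<omega>\<in>outcomes n. born n \<psi> \<omega> * (cloud_mean M u j \<omega> * cloud_mean M v j \<omega>)))"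
  have GG: "(\<Sum>a<M. \<Sum>b<M. G (u * M + a) (v * M + b)) / (real M)\<^sup>2 =
     (\<Sum>j<3. \<Sum>\<omega>\<in>outcomes n. born n \<psi> \<omega> * (cloud_mean M u j \<omega> * cloud_mean M v j \<omega>))" for u v
  proof -
    have cm: "cloud_mean M u j \<omega> * cloud_mean M v j \<omega> =
       (\<Sum>a<M. \<Sum>b<M. out_vec (\<omega> (u * M + a)) j * out_vec (\<omega> (v * M + b)) j) / (real M)\<^sup>2" for j \<omega>
      using M0 by (simp add: cloud_mean_def sum_product power2_eq_square)
    have "(\<Sum>a<M. \<Sum>b<M. G (u * M + a) (v * M + b)) =
      (\<Sum>a<M. \<Sum>j<3. \<Sum>b<M. \<Sum>\<omega>\<in>outcomes n. born n \<psi> \<omega> * (out_vec (\<omega> (u * M + a)) j * out_vec (\<omega> (v * M + b)) j))"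
      unfolding G_def by (intro sum.cong refl sum.swap)
    also have "\<dots> = (\<Sum>j<3. \<Sum>a<M. \<Sum>b<M. \<Sum>\<omega>\<in>outcomes n. born n \<psi> \<omega> * (out_vec (\<omega> (u * M + a)) j * out_vec (\<omega> (v * M + b)) j))"
      by (rule sum.swap)
    also have "\<dots> = (\<Sum>j<3. \<Sum>a<M. \<Sum>\<omega>\<in>outcomes n. \<Sum>b<M. born n \<psi> \<omega> * (out_vec (\<omega> (u * M + a)) j * out_vec (\<omega> (v * M + b)) j))"
      by (intro sum.cong refl sum.swap)
    also have "\<dots> = (\<Sum>j<3. \<Sum>\<omega>\<in>outcomes n. \<Sum>a<M. \<Sum>b<M. born n \<psi> \<omega> * (out_vec (\<omega> (u * M + a)) j * out_vec (\<omega> (v * M + b)) j))"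
      by (intro sum.cong refl sum.swap)
    finally show ?thesis by (simp only: cm sum_divide_distrib sum_distrib_left times_divide_eq_right)
  qed
  \<comment> \<open>An outcome vector always has squared length 9, so the M diagonal pairs among the
    M^2 pairs of a cloud contribute 9/M to the average.\<close>
  have GD: "(\<Sum>a<M. G (u * M + a) (u * M + a)) / (real M)\<^sup>2 = 9 / real M" if "u < N" for u
  proof -
    have "Suc u * M \<le> N * M" using that by (intro mult_le_mono) auto
    then have uM: "u * M + M \<le> n" by (simp add: n_def)
    have "G (u * M + a) (u * M + a) = 9" if a: "a < M" for a
    proof -
      have "G (u * M + a) (u * M + a) = (\<Sum>\<omega>\<in>outcomes n. born n \<psi> \<omega> * (\<Sum>j<3. (out_vec (\<omega> (u * M + a)) j)\<^sup>2))"
        unfolding G_def by (subst sum.swap) (simp only: power2_eq_square sum_distrib_left)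
      also have "\<dots> = (\<Sum>\<omega>\<in>outcomes n. born n \<psi> \<omega> * 9)"
      proof (intro sum.cong refl)
        fix \<omega> assume "\<omega> \<in> outcomes n"
        then have "\<omega> (u * M + a) \<in> outs" by (rule PiE_mem) (use uM a in simp)
        then show "born n \<psi> \<omega> * (\<Sum>j<3. (out_vec (\<omega> (u * M + a)) j)\<^sup>2) = born n \<psi> \<omega> * 9"
          by (simp only: out_vec_norm)
      qed
      also have "\<dots> = 9" using \<psi> by (simp only: sum_distrib_right[symmetric] sum_born n_def mult_1)
      finally show ?thesis .
    qed
    then show ?thesis using M0 by (simp add: power2_eq_square)
  qed
  have e2: "(\<Sum>e\<in>edges n. blowup N M W e * G (fst e) (snd e)) = (Q - (\<Sum>u<N. W u u) * (9 / real M)) / loop_defect N M W"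
    using sum_blowup[of G, OF symG] GD unfolding n_def[symmetric] Q_def GG by (simp add: sum_distrib_right sum_divide_distrib)
  have "(1 + 3 * real (K * N) / real M)\<^sup>2 * F - \<eta> \<le> Q"
    unfolding Q_def n_def by (rule born_cloud_bound[OF M0(1) \<psi> W F \<eta> K])
  moreover have "(\<Sum>u<N. W u u) * (9 / real M) \<le> 9 / real M"
    using mult_right_mono[OF loop_weight(2), of "9 / real M"] by simp
  ultimately have "((1 + 3 * real (K * N) / real M)\<^sup>2 * F - \<eta> - 9 / real M) / loop_defect N M W \<le>
     (Q - (\<Sum>u<N. W u u) * (9 / real M)) / loop_defect N M W"
    using loop_defect_pos by (intro divide_right_mono) auto
  then have "Re (mat_form (2^n) (H_G n (blowup N M W)) \<psi>) \<le>
    1/4 - 1/4 * (((1 + 3 * real (K * N) / real M)\<^sup>2 * F - \<eta> - 9 / real M) / loop_defect N M W)"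
    unfolding e1 e2 by (intro diff_left_mono mult_left_mono) auto
  then show "Re (mat_form (2^(N*M)) (H_G (N*M) (blowup N M W)) \<psi>) \<le>
    1/4 - 1/4 * (((1 + 3 * real (K * N) / real M)\<^sup>2 * F - \<eta> - 9 / real M) / loop_defect N M W)"
    by (simp only: n_def)
qed simp

end

subsection \<open>Gaussian measures and rotation invariance\<close>

abbreviation normal1 :: "real measure" where
  "normal1 \<equiv> density lborel (\<lambda>x. ennreal (std_normal_density x))"

interpretation normal1: prob_space normal1
  by (rule prob_space_normal_density) simp

lemma product_sigma_finite_normal1: "product_sigma_finite (\<lambda>_. normal1)"
  by (intro product_sigma_finite.intro normal1.sigma_finite_measure_axioms)

text \<open>One standard Gaussian for all Euclidean spaces, so that vectors, matrices and pairs of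
  vectors share the same theory.\<close>

definition std_gauss :: "'a::euclidean_space measure" where
  "std_gauss = density lborel (\<lambda>x. ennreal (\<Prod>b\<in>Basis. std_normal_density (x \<bullet> b)))"

lemma sets_std_gauss [measurable_cong, simp]: "sets std_gauss = sets borel"
  by (simp add: std_gauss_def)

lemma space_std_gauss [simp]: "space std_gauss = UNIV"
  by (simp add: std_gauss_def)

text \<open>The density factorises over the basis; coordinates that \<pi> does not select are left
  unrestricted and integrate to 1.\<close>

lemma emeasure_std_gauss_coords:
  fixes \<pi> :: "'i \<Rightarrow> 'a::euclidean_space"
  assumes I: "finite I" "inj_on \<pi> I" "\<pi> ` I \<subseteq> Basis" and A: "\<And>i. i \<in> I \<Longrightarrow> A i \<in> sets borel"
  shows "emeasure std_gauss {x. \<forall>i\<in>I. x \<bullet> \<pi> i \<in> A i} = (\<Prod>i\<in>I. emeasure normal1 (A i))"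
proof -
  define S where "S = {x. \<forall>i\<in>I. x \<bullet> \<pi> i \<in> A i}"
  define B where "B b = (if b \<in> \<pi> ` I then A (the_inv_into I \<pi> b) else UNIV)" for b
  have B: "B (\<pi> i) = A i" if "i \<in> I" for i
    using that I by (simp add: B_def the_inv_into_f_f)
  have Bm [measurable]: "B b \<in> sets borel" for b
    using A I by (auto simp: B_def the_inv_into_f_f)
  have S_eq: "S = {x. \<forall>b\<in>Basis. x \<bullet> b \<in> B b}"
  proof -
    have "(\<forall>i\<in>I. x \<bullet> \<pi> i \<in> A i) \<longleftrightarrow> (\<forall>b\<in>Basis. x \<bullet> b \<in> B b)" for x
    proof
      assume L: "\<forall>i\<in>I. x \<bullet> \<pi> i \<in> A i"
      show "\<forall>b\<in>Basis. x \<bullet> b \<in> B b"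
      proof
        fix b :: 'a assume "b \<in> Basis"
        show "x \<bullet> b \<in> B b"
        proof (cases "b \<in> \<pi> ` I")
          case True
          then obtain i where "i \<in> I" "b = \<pi> i" by blast
          then show ?thesis using L B by simp
        next
          case False
          then show ?thesis by (simp add: B_def)
        qed
      qed
    next
      assume R: "\<forall>b\<in>Basis. x \<bullet> b \<in> B b"
      show "\<forall>i\<in>I. x \<bullet> \<pi> i \<in> A i"
      proof
        fix i assume i: "i \<in> I"
        then have "\<pi> i \<in> Basis" using I by auto
        then show "x \<bullet> \<pi> i \<in> A i" using R B[OF i] by auto
      qed
    qed
    then show ?thesis by (simp add: S_def)
  qed
  have Sm: "S \<in> sets borel"
    unfolding S_eq by measurable
  have "emeasure std_gauss S = (\<integral>\<^sup>+x. ennreal (\<Prod>b\<in>Basis. std_normal_density (x \<bullet> b)) * indicator S x \<partial>lborel)"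
    unfolding std_gauss_def using Sm by (subst emeasure_density) auto
  also have "\<dots> = (\<integral>\<^sup>+x. (\<Prod>b\<in>Basis. ennreal (std_normal_density (x \<bullet> b)) * indicator (B b) (x \<bullet> b)) \<partial>lborel)"
  proof (intro nn_integral_cong)
    fix x :: 'a
    have "(\<Prod>b\<in>Basis. indicator (B b) (x \<bullet> b)) = (indicator S x :: ennreal)"
    proof (cases "x \<in> S")
      case True
      then have "(\<Prod>b\<in>Basis. indicator (B b) (x \<bullet> b)) = (\<Prod>b\<in>(Basis::'a set). (1::ennreal))"
        unfolding S_eq by (intro prod.cong) auto
      then show ?thesis using True by simp
    next
      case False
      then obtain b where "b \<in> Basis" "x \<bullet> b \<notin> B b" unfolding S_eq by blast
      then have "(\<Prod>b\<in>Basis. indicator (B b) (x \<bullet> b)) = (0::ennreal)"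
        by (intro prod_zero) (auto intro!: bexI[of _ b])
      then show ?thesis using False by simp
    qed
    then show "ennreal (\<Prod>b\<in>Basis. std_normal_density (x \<bullet> b)) * indicator S x =
       (\<Prod>b\<in>Basis. ennreal (std_normal_density (x \<bullet> b)) * indicator (B b) (x \<bullet> b))"
      by (simp add: prod.distrib prod_ennreal)
  qed
  also have "\<dots> = (\<Prod>b\<in>Basis. \<integral>\<^sup>+x. ennreal (std_normal_density x) * indicator (B b) x \<partial>lborel)"
    by (rule nn_integral_lborel_prod) auto
  also have "\<dots> = (\<Prod>b\<in>(Basis::'a set). emeasure normal1 (B b))"
    by (intro prod.cong refl) (subst emeasure_density, auto)
  also have "\<dots> = (\<Prod>b\<in>\<pi> ` I. emeasure normal1 (B b))"
  proof (rule prod.mono_neutral_right)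
    show "\<forall>b\<in>Basis - \<pi> ` I. emeasure normal1 (B b) = 1"
      using normal1.emeasure_space_1 by (auto simp: B_def)
  qed (use I in auto)
  also have "\<dots> = (\<Prod>i\<in>I. emeasure normal1 (A i))"
    using I B by (subst prod.reindex) auto
  finally show ?thesis by (simp add: S_def)
qed

lemma distr_std_gauss_coords:
  fixes \<pi> :: "'i \<Rightarrow> 'a::euclidean_space"
  assumes I: "finite I" "inj_on \<pi> I" "\<pi> ` I \<subseteq> Basis"
  shows "distr std_gauss (PiM I (\<lambda>_. normal1)) (\<lambda>x. \<lambda>i\<in>I. x \<bullet> \<pi> i) = PiM I (\<lambda>_. normal1)"
proof (rule product_sigma_finite.PiM_eqI[OF product_sigma_finite_normal1 I(1)])
  show "sets (distr std_gauss (PiM I (\<lambda>_. normal1)) (\<lambda>x. \<lambda>i\<in>I. x \<bullet> \<pi> i)) = sets (PiM I (\<lambda>_. normal1))"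
    by simp
  fix A :: "'i \<Rightarrow> real set" assume A: "\<And>i. i \<in> I \<Longrightarrow> A i \<in> sets normal1"
  have m: "(\<lambda>x. \<lambda>i\<in>I. x \<bullet> \<pi> i) \<in> std_gauss \<rightarrow>\<^sub>M PiM I (\<lambda>_. normal1)"
    by (intro measurable_restrict) (simp add: measurable_cong_sets[OF sets_std_gauss refl])
  have P: "PiE I A \<in> sets (PiM I (\<lambda>_. normal1))" using A I by (intro sets_PiM_I_finite) auto
  have "emeasure (distr std_gauss (PiM I (\<lambda>_. normal1)) (\<lambda>x. \<lambda>i\<in>I. x \<bullet> \<pi> i)) (PiE I A) =
     emeasure std_gauss {x. \<forall>i\<in>I. x \<bullet> \<pi> i \<in> A i}"
    by (subst emeasure_distr[OF m P]) (auto intro!: arg_cong[where f="emeasure std_gauss"] simp: PiE_iff)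
  also have "\<dots> = (\<Prod>i\<in>I. emeasure normal1 (A i))"
    using A by (intro emeasure_std_gauss_coords I) auto
  finally show "emeasure (distr std_gauss (PiM I (\<lambda>_. normal1)) (\<lambda>x. \<lambda>i\<in>I. x \<bullet> \<pi> i)) (PiE I A) =
     (\<Prod>i\<in>I. emeasure normal1 (A i))" .
qed

lemma measurable_basis_sum [measurable]:
  "(\<lambda>f. \<Sum>b\<in>Basis. f b *\<^sub>R b) \<in> PiM Basis (\<lambda>_. normal1) \<rightarrow>\<^sub>M (borel :: 'a::euclidean_space measure)"
  by (intro borel_measurable_sum borel_measurable_scaleR borel_measurable_const)
    (use measurable_component_singleton[of _ Basis "\<lambda>_. normal1"] in \<open>simp add: measurable_cong_sets[OF refl sets_density]\<close>)

lemma std_gauss_eq_distr_PiM: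
  "(std_gauss :: 'a::euclidean_space measure) = distr (PiM Basis (\<lambda>_. normal1)) borel (\<lambda>f. \<Sum>b\<in>Basis. f b *\<^sub>R b)"
proof -
  have m: "(\<lambda>x. \<lambda>i\<in>Basis. x \<bullet> i) \<in> (std_gauss :: 'a measure) \<rightarrow>\<^sub>M PiM Basis (\<lambda>_. normal1)"
    by (intro measurable_restrict) (simp add: measurable_cong_sets[OF sets_std_gauss refl])
  have "distr (PiM Basis (\<lambda>_. normal1)) borel (\<lambda>f. \<Sum>b\<in>Basis. f b *\<^sub>R b) =
     distr (distr (std_gauss :: 'a measure) (PiM Basis (\<lambda>_. normal1)) (\<lambda>x. \<lambda>i\<in>Basis. x \<bullet> i)) borel (\<lambda>f. \<Sum>b\<in>Basis. f b *\<^sub>R b)"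
    using distr_std_gauss_coords[of Basis "\<lambda>b::'a. b"] by simp
  also have "\<dots> = distr (std_gauss :: 'a measure) borel ((\<lambda>f. \<Sum>b\<in>Basis. f b *\<^sub>R b) \<circ> (\<lambda>x. \<lambda>i\<in>Basis. x \<bullet> i))"
    by (rule distr_distr[OF measurable_basis_sum m])
  also have "(\<lambda>f. \<Sum>b\<in>Basis. f b *\<^sub>R b) \<circ> (\<lambda>x. \<lambda>i\<in>Basis. x \<bullet> i) = (\<lambda>x::'a. x)"
    by (auto simp: fun_eq_iff euclidean_representation)
  also have "distr (std_gauss :: 'a measure) borel (\<lambda>x. x) = std_gauss"
    by (rule distr_id2) simp
  finally show ?thesis ..
qed

text \<open>A map that reads off pairwise distinct coordinates again yields independent standard
  Gaussians. It serves to rearrange a 3 by 2 matrix into its pair of columns.\<close>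

lemma distr_std_gauss_transport:
  fixes \<phi> :: "'a::euclidean_space \<Rightarrow> 'b::euclidean_space" and \<pi> :: "'b \<Rightarrow> 'a"
  assumes \<pi>: "inj_on \<pi> Basis" "\<pi> ` Basis \<subseteq> Basis" and \<phi>: "\<And>x b. b \<in> Basis \<Longrightarrow> \<phi> x \<bullet> b = x \<bullet> \<pi> b"
  shows "distr std_gauss borel \<phi> = std_gauss"
proof -
  have m: "(\<lambda>x. \<lambda>i\<in>Basis. x \<bullet> \<pi> i) \<in> (std_gauss :: 'a measure) \<rightarrow>\<^sub>M PiM Basis (\<lambda>_. normal1)"
    by (intro measurable_restrict) (simp add: measurable_cong_sets[OF sets_std_gauss refl])
  have "\<phi> x = (\<Sum>b\<in>Basis. (x \<bullet> \<pi> b) *\<^sub>R b)" for x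
    using \<phi> by (subst euclidean_representation[symmetric, of "\<phi> x"]) (auto intro!: sum.cong)
  then have \<phi>_eq: "\<phi> = (\<lambda>f. \<Sum>b\<in>Basis. f b *\<^sub>R b) \<circ> (\<lambda>x. \<lambda>i\<in>Basis. x \<bullet> \<pi> i)"
    by (auto simp: fun_eq_iff)
  have "distr std_gauss borel \<phi> = distr (distr std_gauss (PiM Basis (\<lambda>_. normal1)) (\<lambda>x. \<lambda>i\<in>Basis. x \<bullet> \<pi> i)) borel (\<lambda>f. \<Sum>b\<in>Basis. f b *\<^sub>R b)"
    unfolding \<phi>_eq by (rule distr_distr[OF measurable_basis_sum m, symmetric])
  also have "\<dots> = std_gauss"
    using distr_std_gauss_coords[OF finite_Basis \<pi>] by (simp add: std_gauss_eq_distr_PiM)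
  finally show ?thesis .
qed

lemma prob_space_std_gauss: "prob_space (std_gauss :: 'a::euclidean_space measure)"
proof -
  have "prob_space (PiM (Basis :: 'a set) (\<lambda>_. normal1))" by (rule prob_space_PiM) (rule normal1.prob_space_axioms)
  then show ?thesis unfolding std_gauss_eq_distr_PiM
    by (rule prob_space.prob_space_distr) (rule measurable_basis_sum)
qed

lemma std_gauss_pair: "(std_gauss :: ('a::euclidean_space \<times> 'b::euclidean_space) measure) = std_gauss \<Otimes>\<^sub>M std_gauss"
proof -
  interpret b: prob_space "std_gauss :: 'b measure" by (rule prob_space_std_gauss)
  have prod: "(\<Prod>b\<in>Basis. std_normal_density (x \<bullet> b)) =
      (\<Prod>b\<in>Basis. std_normal_density (fst x \<bullet> b)) * (\<Prod>b\<in>Basis. std_normal_density (snd x \<bullet> b))" for x :: "'a \<times> 'b"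
  proof -
    have "(\<Prod>b\<in>Basis. std_normal_density (x \<bullet> b)) =
      (\<Prod>b\<in>(\<lambda>u. (u, 0)) ` Basis. std_normal_density (x \<bullet> b)) * (\<Prod>b\<in>(\<lambda>v. (0, v)) ` Basis. std_normal_density (x \<bullet> b))"
      unfolding Basis_prod_def by (rule prod.union_disjoint) auto
    also have "\<dots> = (\<Prod>b\<in>Basis. std_normal_density (fst x \<bullet> b)) * (\<Prod>b\<in>Basis. std_normal_density (snd x \<bullet> b))"
      by (subst (1 2) prod.reindex) (auto simp: inj_on_def inner_prod_def)
    finally show ?thesis .
  qed
  have "(std_gauss :: 'a measure) \<Otimes>\<^sub>M (std_gauss :: 'b measure) =
     density (lborel \<Otimes>\<^sub>M lborel) (\<lambda>(x, y). ennreal (\<Prod>b\<in>Basis. std_normal_density (x \<bullet> b)) * ennreal (\<Prod>b\<in>Basis. std_normal_density (y \<bullet> b)))"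
    unfolding std_gauss_def
    by (rule pair_measure_density) (auto simp: lborel.sigma_finite_measure_axioms b.sigma_finite_measure_axioms[unfolded std_gauss_def])
  also have "\<dots> = density lborel (\<lambda>x :: 'a \<times> 'b. ennreal (\<Prod>b\<in>Basis. std_normal_density (x \<bullet> b)))"
    unfolding lborel_prod prod by (intro arg_cong[where f="density lborel"]) (auto simp: fun_eq_iff ennreal_mult prod_nonneg)
  finally show ?thesis unfolding std_gauss_def ..
qed

lemma gauss_mat_eq: "gauss_mat = std_gauss"
proof -
  have bij: "bij_betw (\<lambda>(i, j). axis i (axis j 1)) (UNIV \<times> UNIV) (Basis :: (real^2^3) set)"
    unfolding bij_betw_def
  proof
    show "inj_on (\<lambda>(i, j). axis i (axis j 1) :: real^2^3) (UNIV \<times> UNIV)"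
      by (auto simp: inj_on_def axis_eq_axis)
    show "(\<lambda>(i, j). axis i (axis j 1)) ` (UNIV \<times> UNIV) = (Basis :: (real^2^3) set)"
      by (auto simp: Basis_vec_def)
  qed
  have "(\<Prod>i\<in>UNIV. \<Prod>j\<in>UNIV. std_normal_density (Z $ i $ j)) = (\<Prod>b\<in>Basis. std_normal_density (Z \<bullet> b))" for Z :: "real^2^3"
  proof -
    have "(\<Prod>b\<in>Basis. std_normal_density (Z \<bullet> b)) = (\<Prod>p\<in>UNIV \<times> UNIV. std_normal_density (Z \<bullet> (\<lambda>(i, j). axis i (axis j 1)) p))"
      by (rule prod.reindex_bij_betw[OF bij, symmetric])
    also have "\<dots> = (\<Prod>i\<in>UNIV. \<Prod>j\<in>UNIV. std_normal_density (Z $ i $ j))"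
      unfolding prod.cartesian_product by (intro prod.cong refl) (auto simp: inner_axis)
    finally show ?thesis ..
  qed
  then show ?thesis unfolding gauss_mat_def std_gauss_def by simp
qed

section \<open>Rotation invariance\<close>

lemma nn_integral_lborel_shift:
  fixes a :: "'a::euclidean_space"
  assumes [measurable]: "f \<in> borel_measurable borel"
  shows "(\<integral>\<^sup>+x. f (x + a) \<partial>lborel) = (\<integral>\<^sup>+x. f x \<partial>lborel)"
proof -
  have "(\<integral>\<^sup>+x. f x \<partial>lborel) = (\<integral>\<^sup>+x. f x \<partial>distr lborel borel ((+) a))" by (simp add: lborel_distr_plus)
  also have "\<dots> = (\<integral>\<^sup>+x. f (a + x) \<partial>lborel)" by (rule nn_integral_distr) auto
  finally show ?thesis by (simp add: add.commute)
qed

lemma nn_integral_shear_snd: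
  fixes h :: "'a::euclidean_space \<Rightarrow> 'a \<Rightarrow> ennreal"
  assumes [measurable]: "case_prod h \<in> borel_measurable (borel \<Otimes>\<^sub>M borel)"
  shows "(\<integral>\<^sup>+x. \<integral>\<^sup>+y. h x (y + t *\<^sub>R x) \<partial>lborel \<partial>lborel) = (\<integral>\<^sup>+x. \<integral>\<^sup>+y. h x y \<partial>lborel \<partial>lborel)"
  by (intro nn_integral_cong nn_integral_lborel_shift) measurable

lemma nn_integral_swap_lborel:
  fixes h :: "'a::euclidean_space \<Rightarrow> 'b::euclidean_space \<Rightarrow> ennreal"
  assumes [measurable]: "case_prod h \<in> borel_measurable (borel \<Otimes>\<^sub>M borel)"
  shows "(\<integral>\<^sup>+x. \<integral>\<^sup>+y. h x y \<partial>lborel \<partial>lborel) = (\<integral>\<^sup>+y. \<integral>\<^sup>+x. h x y \<partial>lborel \<partial>lborel)"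
  by (rule pair_sigma_finite.Fubini') (unfold_locales, measurable)

lemma nn_integral_shear_fst:
  fixes h :: "'a::euclidean_space \<Rightarrow> 'a \<Rightarrow> ennreal"
  assumes m [measurable]: "case_prod h \<in> borel_measurable (borel \<Otimes>\<^sub>M borel)"
  shows "(\<integral>\<^sup>+x. \<integral>\<^sup>+y. h (x + t *\<^sub>R y) y \<partial>lborel \<partial>lborel) = (\<integral>\<^sup>+x. \<integral>\<^sup>+y. h x y \<partial>lborel \<partial>lborel)"
proof -
  have "(\<integral>\<^sup>+x. \<integral>\<^sup>+y. h (x + t *\<^sub>R y) y \<partial>lborel \<partial>lborel) = (\<integral>\<^sup>+y. \<integral>\<^sup>+x. h (x + t *\<^sub>R y) y \<partial>lborel \<partial>lborel)"
    by (rule nn_integral_swap_lborel) measurable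
  also have "\<dots> = (\<integral>\<^sup>+y. \<integral>\<^sup>+x. h x y \<partial>lborel \<partial>lborel)"
    by (intro nn_integral_cong nn_integral_lborel_shift) measurable
  also have "\<dots> = (\<integral>\<^sup>+x. \<integral>\<^sup>+y. h x y \<partial>lborel \<partial>lborel)"
    by (rule nn_integral_swap_lborel[symmetric]) (rule m)
  finally show ?thesis .
qed

text \<open>A rotation is a product of three shears, and shears preserve Lebesgue measure by translation invariance.\<close>

lemma nn_integral_rotate_lborel:
  fixes h :: "'a::euclidean_space \<Rightarrow> 'a \<Rightarrow> ennreal"
  assumes m [measurable]: "case_prod h \<in> borel_measurable (borel \<Otimes>\<^sub>M borel)"
    and cs: "c\<^sup>2 + s\<^sup>2 = 1" and s: "s \<noteq> 0"
  shows "(\<integral>\<^sup>+x. \<integral>\<^sup>+y. h (c *\<^sub>R x - s *\<^sub>R y) (s *\<^sub>R x + c *\<^sub>R y) \<partial>lborel \<partial>lborel) = (\<integral>\<^sup>+x. \<integral>\<^sup>+y. h x y \<partial>lborel \<partial>lborel)"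
proof -
  \<comment> \<open>For the rotation by \<theta> this is -tan(\<theta>/2), the parameter of the two
    outer shears; the middle one has parameter s.\<close>
  define t where "t = (c - 1) / s"
  have st: "1 + s * t = c" using s by (simp add: t_def)
  have t2: "t * (1 + c) = - s"
  proof -
    have "t * (1 + c) = (c\<^sup>2 - 1) / s" by (simp add: t_def power2_eq_square algebra_simps)
    also have "c\<^sup>2 - 1 = - s\<^sup>2" using cs by simp
    also have "- s\<^sup>2 / s = - s" using s by (simp add: power2_eq_square)
    finally show ?thesis .
  qed
  have X: "c *\<^sub>R x - s *\<^sub>R y = (x + t *\<^sub>R y) + t *\<^sub>R (y + s *\<^sub>R (x + t *\<^sub>R y))" for x y :: 'a
  proof -
    have "(x + t *\<^sub>R y) + t *\<^sub>R (y + s *\<^sub>R (x + t *\<^sub>R y)) = (1 + s * t) *\<^sub>R x + (t * (1 + (1 + s * t))) *\<^sub>R y"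
      by (simp only: scaleR_add_left scaleR_add_right scaleR_scaleR distrib_left distrib_right mult_1_left mult_1_right scaleR_one add_ac mult_ac)
    also have "\<dots> = c *\<^sub>R x + (- s) *\<^sub>R y" by (simp only: st t2)
    finally show ?thesis by simp
  qed
  have Y: "s *\<^sub>R x + c *\<^sub>R y = y + s *\<^sub>R (x + t *\<^sub>R y)" for x y :: 'a
    by (subst st[symmetric]) (simp add: algebra_simps)
  have "(\<integral>\<^sup>+x. \<integral>\<^sup>+y. h (c *\<^sub>R x - s *\<^sub>R y) (s *\<^sub>R x + c *\<^sub>R y) \<partial>lborel \<partial>lborel) =
     (\<integral>\<^sup>+x. \<integral>\<^sup>+y. (\<lambda>x y. h (x + t *\<^sub>R (y + s *\<^sub>R x)) (y + s *\<^sub>R x)) (x + t *\<^sub>R y) y \<partial>lborel \<partial>lborel)"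
    unfolding X Y ..
  also have "\<dots> = (\<integral>\<^sup>+x. \<integral>\<^sup>+y. h (x + t *\<^sub>R (y + s *\<^sub>R x)) (y + s *\<^sub>R x) \<partial>lborel \<partial>lborel)"
    by (rule nn_integral_shear_fst) measurable
  also have "\<dots> = (\<integral>\<^sup>+x. \<integral>\<^sup>+y. h (x + t *\<^sub>R y) y \<partial>lborel \<partial>lborel)"
    by (rule nn_integral_shear_snd[where h="\<lambda>x y. h (x + t *\<^sub>R y) y"]) measurable
  also have "\<dots> = (\<integral>\<^sup>+x. \<integral>\<^sup>+y. h x y \<partial>lborel \<partial>lborel)"
    by (rule nn_integral_shear_fst) (rule m)
  finally show ?thesis .
qed

lemma std_gauss_density: "(\<Prod>b\<in>Basis. std_normal_density (x \<bullet> b)) = (1 / sqrt (2 * pi)) ^ DIM('a) * exp (- (norm x)\<^sup>2 / 2)"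
  for x :: "'a::euclidean_space"
proof -
  have "(\<Prod>b\<in>Basis. std_normal_density (x \<bullet> b)) = (\<Prod>b\<in>(Basis::'a set). (1 / sqrt (2 * pi)) * exp (- (x \<bullet> b)\<^sup>2 / 2))"
    by (simp add: std_normal_density_def)
  also have "\<dots> = (1 / sqrt (2 * pi)) ^ DIM('a) * exp (\<Sum>b\<in>(Basis::'a set). - (x \<bullet> b)\<^sup>2 / 2)"
    by (simp only: prod.distrib prod_constant exp_sum[OF finite_Basis])
  also have "(\<Sum>b\<in>(Basis::'a set). - (x \<bullet> b)\<^sup>2 / 2) = - (norm x)\<^sup>2 / 2"
    by (subst power2_norm_eq_inner, subst euclidean_inner) (simp add: sum_negf sum_divide_distrib[symmetric] power2_eq_square)
  finally show ?thesis .
qed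

lemma nn_integral_std_gauss:
  fixes f :: "'a::euclidean_space \<Rightarrow> ennreal"
  assumes [measurable]: "f \<in> borel_measurable borel"
  shows "(\<integral>\<^sup>+x. f x \<partial>std_gauss) = (\<integral>\<^sup>+x. ennreal ((1 / sqrt (2 * pi)) ^ DIM('a) * exp (- (norm x)\<^sup>2 / 2)) * f x \<partial>lborel)"
  unfolding std_gauss_def by (subst nn_integral_density) (auto simp: std_gauss_density)

text \<open>The joint density depends only on |x|^2 + |y|^2, which the rotation preserves, so the
  claim reduces to Lebesgue measure.\<close>

lemma nn_integral_rotate_std_gauss_aux:
  fixes f :: "'a::euclidean_space \<Rightarrow> 'a \<Rightarrow> ennreal"
  assumes m [measurable]: "case_prod f \<in> borel_measurable (borel \<Otimes>\<^sub>M borel)"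
    and cs: "c\<^sup>2 + s\<^sup>2 = 1" and s: "s \<noteq> 0"
  shows "(\<integral>\<^sup>+x. \<integral>\<^sup>+y. f (c *\<^sub>R x - s *\<^sub>R y) (s *\<^sub>R x + c *\<^sub>R y) \<partial>std_gauss \<partial>std_gauss) = (\<integral>\<^sup>+x. \<integral>\<^sup>+y. f x y \<partial>std_gauss \<partial>std_gauss)"
proof -
  define C where "C = (1 / sqrt (2 * pi)) ^ DIM('a)"
  have C: "C \<ge> 0" by (simp add: C_def)
  define h where "h x y = ennreal (C * C * exp (- ((norm x)\<^sup>2 + (norm y)\<^sup>2) / 2)) * f x y" for x y :: 'a
  have hm [measurable]: "case_prod h \<in> borel_measurable (borel \<Otimes>\<^sub>M borel)" unfolding h_def by measurable
  have gen: "(\<integral>\<^sup>+x. \<integral>\<^sup>+y. g x y \<partial>std_gauss \<partial>std_gauss) =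
    (\<integral>\<^sup>+x. \<integral>\<^sup>+y. ennreal (C * C * exp (- ((norm x)\<^sup>2 + (norm y)\<^sup>2) / 2)) * g x y \<partial>lborel \<partial>lborel)"
    if [measurable]: "case_prod g \<in> borel_measurable (borel \<Otimes>\<^sub>M borel)" for g :: "'a \<Rightarrow> 'a \<Rightarrow> ennreal"
  proof -
    have [measurable]: "(\<lambda>x. \<integral>\<^sup>+y. g x y \<partial>std_gauss) \<in> borel_measurable borel"
    proof -
      interpret prob_space "std_gauss :: 'a measure" by (rule prob_space_std_gauss)
      show ?thesis by measurable
    qed
    have "(\<integral>\<^sup>+x. \<integral>\<^sup>+y. g x y \<partial>std_gauss \<partial>std_gauss) =
      (\<integral>\<^sup>+x. ennreal (C * exp (- (norm x)\<^sup>2 / 2)) * (\<integral>\<^sup>+y. g x y \<partial>std_gauss) \<partial>lborel)"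
      unfolding C_def by (rule nn_integral_std_gauss) measurable
    also have "\<dots> = (\<integral>\<^sup>+x. ennreal (C * exp (- (norm x)\<^sup>2 / 2)) * (\<integral>\<^sup>+y. ennreal (C * exp (- (norm y)\<^sup>2 / 2)) * g x y \<partial>lborel) \<partial>lborel)"
      unfolding C_def by (subst nn_integral_std_gauss) measurable
    also have "\<dots> = (\<integral>\<^sup>+x. \<integral>\<^sup>+y. ennreal (C * exp (- (norm x)\<^sup>2 / 2)) * (ennreal (C * exp (- (norm y)\<^sup>2 / 2)) * g x y) \<partial>lborel \<partial>lborel)"
      by (subst nn_integral_cmult) measurable
    also have "\<dots> = (\<integral>\<^sup>+x. \<integral>\<^sup>+y. ennreal (C * C * exp (- ((norm x)\<^sup>2 + (norm y)\<^sup>2) / 2)) * g x y \<partial>lborel \<partial>lborel)"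
    proof (intro nn_integral_cong)
      fix x y :: 'a
      have "ennreal (C * exp (- (norm x)\<^sup>2 / 2)) * (ennreal (C * exp (- (norm y)\<^sup>2 / 2)) * g x y) =
         ennreal ((C * exp (- (norm x)\<^sup>2 / 2)) * (C * exp (- (norm y)\<^sup>2 / 2))) * g x y"
        using C by (subst ennreal_mult) (auto simp: mult.assoc)
      also have "(C * exp (- (norm x)\<^sup>2 / 2)) * (C * exp (- (norm y)\<^sup>2 / 2)) = C * C * exp (- ((norm x)\<^sup>2 + (norm y)\<^sup>2) / 2)"
        by (simp add: exp_add[symmetric] algebra_simps diff_divide_distrib)
      finally show "ennreal (C * exp (- (norm x)\<^sup>2 / 2)) * (ennreal (C * exp (- (norm y)\<^sup>2 / 2)) * g x y) =
         ennreal (C * C * exp (- ((norm x)\<^sup>2 + (norm y)\<^sup>2) / 2)) * g x y" .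
    qed
    finally show ?thesis .
  qed
  have inv: "(norm (c *\<^sub>R x - s *\<^sub>R y))\<^sup>2 + (norm (s *\<^sub>R x + c *\<^sub>R y))\<^sup>2 = (norm x)\<^sup>2 + (norm y)\<^sup>2" for x y :: 'a
  proof -
    have "(norm (c *\<^sub>R x - s *\<^sub>R y))\<^sup>2 + (norm (s *\<^sub>R x + c *\<^sub>R y))\<^sup>2 = (c\<^sup>2 + s\<^sup>2) * (x \<bullet> x) + (c\<^sup>2 + s\<^sup>2) * (y \<bullet> y)"
      unfolding power2_norm_eq_inner
      by (simp add: inner_diff_left inner_diff_right inner_add_left inner_add_right inner_commute power2_eq_square algebra_simps)
    then show ?thesis by (simp add: cs power2_norm_eq_inner)
  qed
  have "(\<integral>\<^sup>+x. \<integral>\<^sup>+y. f (c *\<^sub>R x - s *\<^sub>R y) (s *\<^sub>R x + c *\<^sub>R y) \<partial>std_gauss \<partial>std_gauss) =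
     (\<integral>\<^sup>+x. \<integral>\<^sup>+y. h (c *\<^sub>R x - s *\<^sub>R y) (s *\<^sub>R x + c *\<^sub>R y) \<partial>lborel \<partial>lborel)"
    by (subst gen) (auto simp: h_def inv)
  also have "\<dots> = (\<integral>\<^sup>+x. \<integral>\<^sup>+y. h x y \<partial>lborel \<partial>lborel)"
    by (rule nn_integral_rotate_lborel[OF hm cs s])
  also have "\<dots> = (\<integral>\<^sup>+x. \<integral>\<^sup>+y. f x y \<partial>std_gauss \<partial>std_gauss)"
    unfolding h_def by (rule gen[symmetric]) (rule m)
  finally show ?thesis .
qed

lemma nn_integral_rotate_std_gauss:
  fixes f :: "'a::euclidean_space \<Rightarrow> 'a \<Rightarrow> ennreal"
  assumes m [measurable]: "case_prod f \<in> borel_measurable (borel \<Otimes>\<^sub>M borel)"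
    and cs: "c\<^sup>2 + s\<^sup>2 = 1"
  shows "(\<integral>\<^sup>+x. \<integral>\<^sup>+y. f (c *\<^sub>R x - s *\<^sub>R y) (s *\<^sub>R x + c *\<^sub>R y) \<partial>std_gauss \<partial>std_gauss) = (\<integral>\<^sup>+x. \<integral>\<^sup>+y. f x y \<partial>std_gauss \<partial>std_gauss)"
proof (cases "s = 0")
  case False
  then show ?thesis by (rule nn_integral_rotate_std_gauss_aux[OF m cs])
next
  case True
  then have "c = 1 \<or> c = -1" using cs by (simp add: power2_eq_1_iff)
  then show ?thesis
  proof
    assume "c = 1"
    then show ?thesis using True by simp
  next
    assume c: "c = -1"
    \<comment> \<open>The half turn has s = 0, where the shear parameter is undefined; it is
      composed of two quarter turns.\<close>
    define g where "g x y = f (- y) x" for x y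
    have gm [measurable]: "case_prod g \<in> borel_measurable (borel \<Otimes>\<^sub>M borel)" unfolding g_def by measurable
    have "(\<integral>\<^sup>+x. \<integral>\<^sup>+y. f (c *\<^sub>R x - s *\<^sub>R y) (s *\<^sub>R x + c *\<^sub>R y) \<partial>std_gauss \<partial>std_gauss) =
      (\<integral>\<^sup>+x. \<integral>\<^sup>+y. g (0 *\<^sub>R x - 1 *\<^sub>R y) (1 *\<^sub>R x + 0 *\<^sub>R y) \<partial>std_gauss \<partial>std_gauss)"
      by (simp add: True c g_def)
    also have "\<dots> = (\<integral>\<^sup>+x. \<integral>\<^sup>+y. g x y \<partial>std_gauss \<partial>std_gauss)"
      by (rule nn_integral_rotate_std_gauss_aux[OF gm]) auto
    also have "\<dots> = (\<integral>\<^sup>+x. \<integral>\<^sup>+y. f (0 *\<^sub>R x - 1 *\<^sub>R y) (1 *\<^sub>R x + 0 *\<^sub>R y) \<partial>std_gauss \<partial>std_gauss)"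
      by (simp add: g_def)
    also have "\<dots> = (\<integral>\<^sup>+x. \<integral>\<^sup>+y. f x y \<partial>std_gauss \<partial>std_gauss)"
      by (rule nn_integral_rotate_std_gauss_aux[OF m]) auto
    finally show ?thesis .
  qed
qed

section \<open>The rounding correlation and its different forms\<close>

definition hat_inner :: "real^3 \<Rightarrow> real^3 \<Rightarrow> real" where
  "hat_inner x y = inner ((1 / norm x) *\<^sub>R x) ((1 / norm y) *\<^sub>R y)"

lemma measurable_hat_inner [measurable]:
  "case_prod hat_inner \<in> borel_measurable (borel \<Otimes>\<^sub>M borel)"
  unfolding hat_inner_def by measurable

lemma abs_hat_inner_le: "\<bar>hat_inner x y\<bar> \<le> 1"
proof -
  have n: "norm ((1 / norm x) *\<^sub>R x) \<le> 1" for x :: "real^3" by simp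
  have "\<bar>hat_inner x y\<bar> \<le> norm ((1 / norm x) *\<^sub>R x) * norm ((1 / norm y) *\<^sub>R y)"
    unfolding hat_inner_def by (rule Cauchy_Schwarz_ineq2)
  also have "\<dots> \<le> 1 * 1" by (intro mult_mono n) auto
  finally show ?thesis by simp
qed

definition gp_corr :: "real \<Rightarrow> real" where
  "gp_corr \<rho> = (\<integral>p. hat_inner (fst p) (\<rho> *\<^sub>R fst p + sqrt (1 - \<rho>\<^sup>2) *\<^sub>R snd p) \<partial>(std_gauss \<Otimes>\<^sub>M std_gauss))"

lemma measurable_gp [measurable]:
  "(\<lambda>p. hat_inner (fst p) (a *\<^sub>R fst p + b *\<^sub>R snd p)) \<in> borel_measurable (borel \<Otimes>\<^sub>M borel)"
  by measurable

text \<open>Both matrix-vector products are combinations of the two columns of \<open>Z\<close>,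
  which are independent standard Gaussians in three dimensions.\<close>

lemma F_star3_eq: "F_star3 \<rho> = gp_corr \<rho>"
proof -
  define \<phi> :: "real^2^3 \<Rightarrow> (real^3) \<times> (real^3)" where "\<phi> Z = (\<chi> i. Z $ i $ 1, \<chi> i. Z $ i $ 2)" for Z
  define \<pi> :: "(real^3) \<times> (real^3) \<Rightarrow> real^2^3" where "\<pi> b = (\<chi> i. vector [fst b $ i, snd b $ i])" for b
  have "distr std_gauss borel \<phi> = std_gauss"
  proof (rule distr_std_gauss_transport[of \<pi>])
    show "inj_on \<pi> Basis"
    proof (rule inj_onI)
      fix x y assume eq: "\<pi> x = \<pi> y"
      have "fst x $ i = fst y $ i \<and> snd x $ i = snd y $ i" for i
        using arg_cong[OF eq, of "\<lambda>Z. Z $ i $ 1"] arg_cong[OF eq, of "\<lambda>Z. Z $ i $ 2"] by (simp add: \<pi>_def)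
      then show "x = y" by (simp add: prod_eq_iff Finite_Cartesian_Product.vec_eq_iff)
    qed
    show "\<pi> ` Basis \<subseteq> Basis"
    proof safe
      fix a b :: "real^3" assume "(a, b) \<in> Basis"
      then consider i where "a = axis i 1" "b = 0" | i where "a = 0" "b = axis i 1"
        unfolding Basis_prod_def by (auto simp: Basis_vec_def)
      then show "\<pi> (a, b) \<in> Basis"
      proof cases
        case 1
        have "\<pi> (a, b) = axis i (axis 1 1)"
          using 1 by (simp add: \<pi>_def Finite_Cartesian_Product.vec_eq_iff axis_def forall_2)
        then show ?thesis by (auto simp: Basis_vec_def)
      next
        case 2
        have "\<pi> (a, b) = axis i (axis 2 1)"
          using 2 by (simp add: \<pi>_def Finite_Cartesian_Product.vec_eq_iff axis_def forall_2)
        then show ?thesis by (auto simp: Basis_vec_def)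
      qed
    qed
    show "\<phi> x \<bullet> b = x \<bullet> \<pi> b" for x b
      by (simp add: \<phi>_def \<pi>_def inner_prod_def inner_vec_def sum_2 sum.distrib)
  qed
  then have d: "distr std_gauss borel \<phi> = std_gauss \<Otimes>\<^sub>M std_gauss" unfolding std_gauss_pair .
  have [measurable]: "\<phi> \<in> borel_measurable borel"
    unfolding \<phi>_def by (intro borel_measurable_continuous_onI continuous_intros)
  have m: "(\<lambda>p::(real^3)\<times>(real^3). hat_inner (fst p) (\<rho> *\<^sub>R fst p + sqrt (1 - \<rho>\<^sup>2) *\<^sub>R snd p)) \<in> borel_measurable borel"
    using measurable_gp unfolding borel_prod .
  have "gp_corr \<rho> = (\<integral>Z. hat_inner (fst (\<phi> Z)) (\<rho> *\<^sub>R fst (\<phi> Z) + sqrt (1 - \<rho>\<^sup>2) *\<^sub>R snd (\<phi> Z)) \<partial>std_gauss)"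
    unfolding gp_corr_def d[symmetric] by (rule integral_distr[OF _ m]) simp
  moreover have "Z *v vector [1, 0] = fst (\<phi> Z)" "Z *v vector [\<rho>, sqrt (1 - \<rho>\<^sup>2)] = \<rho> *\<^sub>R fst (\<phi> Z) + sqrt (1 - \<rho>\<^sup>2) *\<^sub>R snd (\<phi> Z)" for Z
    by (simp_all add: \<phi>_def matrix_vector_mult_def Finite_Cartesian_Product.vec_eq_iff sum_2)
  ultimately show ?thesis unfolding F_star3_def Let_def gauss_mat_eq hat_inner_def by simp
qed

lemma sets_gauss [measurable_cong]: "sets (gauss n) = sets (PiM {..<n} (\<lambda>_. borel))"
  unfolding gauss_def by (rule sets_PiM_cong) auto

lemma prob_space_gauss: "prob_space (gauss n)"
  unfolding gauss_def by (rule prob_space_PiM) (rule normal1.prob_space_axioms)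

lemma measurable_gauss_component:
  "i < d \<Longrightarrow> (\<lambda>x. x i) \<in> borel_measurable (gauss d)"
  using measurable_component_singleton[of i "{..<d}" "\<lambda>_. borel"]
  by (simp add: measurable_cong_sets[OF sets_gauss refl])

lemma measurable_vector3:
  assumes "3 \<le> n"
  shows "(\<lambda>x. vector [x 0, x 1, x 2] :: real^3) \<in> gauss n \<rightarrow>\<^sub>M borel"
proof -
  have "(\<lambda>x. x 0 *\<^sub>R axis 1 1 + x 1 *\<^sub>R axis 2 1 + x 2 *\<^sub>R axis 3 1 :: real^3) \<in> gauss n \<rightarrow>\<^sub>M borel"
    using assms by (intro borel_measurable_add borel_measurable_scaleR measurable_gauss_component borel_measurable_const) auto
  moreover have "vector [x 0, x 1, x 2] = (x 0 *\<^sub>R axis 1 1 + x 1 *\<^sub>R axis 2 1 + x 2 *\<^sub>R axis 3 1 :: real^3)" for x :: "nat \<Rightarrow> real"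
    by (simp add: Finite_Cartesian_Product.vec_eq_iff forall_3 axis_def)
  ultimately show ?thesis by simp
qed

lemma distr_gauss_vector3:
  assumes n: "3 \<le> n"
  shows "distr (gauss n) borel (\<lambda>x. vector [x 0, x 1, x 2]) = (std_gauss :: (real^3) measure)"
proof -
  define \<iota> :: "real^3 \<Rightarrow> nat" where "\<iota> b = (if b = axis 1 1 then 0 else if b = axis 2 1 then 1 else 2)" for b
  have B: "(Basis :: (real^3) set) = {axis 1 1, axis 2 1, axis 3 1}"
    by (auto simp: Basis_vec_def UNIV_3)
  have ne: "axis 1 1 \<noteq> (axis 2 1 :: real^3)" "axis 1 1 \<noteq> (axis 3 1 :: real^3)" "axis 2 1 \<noteq> (axis 3 1 :: real^3)"
    by (auto simp: axis_eq_axis)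
  have "distr (gauss n) (\<Pi>\<^sub>M i\<in>Basis. normal1) (\<lambda>\<omega>. \<lambda>b\<in>Basis. \<omega> (\<iota> b)) = (\<Pi>\<^sub>M i\<in>Basis. normal1)"
    unfolding gauss_def
  proof (rule distr_PiM_reindex)
    show "inj_on \<iota> Basis" unfolding B using ne by (auto simp: inj_on_def \<iota>_def)
    show "\<iota> \<in> Basis \<rightarrow> {..<n}" using n by (auto simp: \<iota>_def)
  qed (rule normal1.prob_space_axioms)
  then have "std_gauss = distr (distr (gauss n) (\<Pi>\<^sub>M i\<in>Basis. normal1) (\<lambda>\<omega>. \<lambda>b\<in>Basis. \<omega> (\<iota> b))) borel (\<lambda>f. \<Sum>b\<in>Basis. f b *\<^sub>R b :: real^3)"
    by (simp add: std_gauss_eq_distr_PiM)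
  also have "\<dots> = distr (gauss n) borel ((\<lambda>f. \<Sum>b\<in>Basis. f b *\<^sub>R b :: real^3) \<circ> (\<lambda>\<omega>. \<lambda>b\<in>Basis. \<omega> (\<iota> b)))"
  proof (rule distr_distr[OF measurable_basis_sum])
    show "(\<lambda>\<omega>. \<lambda>b\<in>Basis. \<omega> (\<iota> b)) \<in> gauss n \<rightarrow>\<^sub>M (\<Pi>\<^sub>M i\<in>(Basis::(real^3) set). normal1)"
      unfolding gauss_def using n by (intro measurable_restrict measurable_component_singleton) (auto simp: \<iota>_def)
  qed
  also have "(\<lambda>f. \<Sum>b\<in>Basis. f b *\<^sub>R b :: real^3) \<circ> (\<lambda>\<omega>. \<lambda>b\<in>Basis. \<omega> (\<iota> b)) = (\<lambda>x. vector [x 0, x 1, x 2])"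
    unfolding B using ne by (auto simp: fun_eq_iff Finite_Cartesian_Product.vec_eq_iff forall_3 axis_def \<iota>_def)
  finally show ?thesis ..
qed

text \<open>\<open>f_opt3\<close> sees only the first three coordinates, so its stability is the
  same in every dimension. Through \<open>gp_corr\<close> the hypothesis is linked to
  \<open>F_star3\<close>.\<close>

lemma Stab_f_opt3:
  assumes n: "3 \<le> n"
  shows "Stab n \<rho> f_opt3 = gp_corr \<rho>"
proof -
  define V where "V x = (vector [x 0, x 1, x 2] :: real^3)" for x :: "nat \<Rightarrow> real"
  note V = distr_gauss_vector3[OF n, folded V_def[abs_def]] measurable_vector3[OF n, folded V_def[abs_def]]
  interpret g: prob_space "gauss n" by (rule prob_space_gauss)
  interpret s: prob_space "std_gauss :: (real^3) measure" by (rule prob_space_std_gauss)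
  have "distr (gauss n) borel V \<Otimes>\<^sub>M distr (gauss n) borel V = distr (gauss n \<Otimes>\<^sub>M gauss n) (borel \<Otimes>\<^sub>M borel) (\<lambda>(x, y). (V x, V y))"
    by (rule pair_measure_distr[OF V(2) V(2)]) (simp add: V(1) s.sigma_finite_measure_axioms)
  then have d: "std_gauss \<Otimes>\<^sub>M std_gauss = distr (gauss n \<Otimes>\<^sub>M gauss n) (borel \<Otimes>\<^sub>M borel) (\<lambda>p. (V (fst p), V (snd p)))"
    by (simp add: V(1) case_prod_unfold)
  have "gp_corr \<rho> = (\<integral>p. hat_inner (V (fst p)) (\<rho> *\<^sub>R V (fst p) + sqrt (1 - \<rho>\<^sup>2) *\<^sub>R V (snd p)) \<partial>(gauss n \<Otimes>\<^sub>M gauss n))"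
    unfolding gp_corr_def d
  proof (subst integral_distr)
    show "(\<lambda>p. (V (fst p), V (snd p))) \<in> gauss n \<Otimes>\<^sub>M gauss n \<rightarrow>\<^sub>M borel \<Otimes>\<^sub>M borel"
      using V(2) by measurable
  qed auto
  moreover have "V (corr n \<rho> x z) = \<rho> *\<^sub>R V x + sqrt (1 - \<rho>\<^sup>2) *\<^sub>R V z" for x z
    using n by (simp add: V_def corr_def Finite_Cartesian_Product.vec_eq_iff forall_3)
  ultimately show ?thesis unfolding Stab_def f_opt3_def Let_def V_def[symmetric] hat_inner_def by simp
qed

section \<open>Joint law of two Gaussian projections\<close>

lemma rotation_onto_axis: "\<exists>C S. C\<^sup>2 + S\<^sup>2 = 1 \<and> sqrt (a\<^sup>2 + u\<^sup>2) * C = a \<and> sqrt (a\<^sup>2 + u\<^sup>2) * S = (u::real)"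
proof (cases "a\<^sup>2 + u\<^sup>2 = 0")
  case True
  then have "a = 0" "u = 0" by (auto simp: sum_power2_eq_zero_iff)
  then show ?thesis by (intro exI[of _ 1] exI[of _ 0]) auto
next
  case False
  then have p: "a\<^sup>2 + u\<^sup>2 > 0" by (metis not_sum_power2_lt_zero linorder_neqE_linordered_idom)
  define r where "r = sqrt (a\<^sup>2 + u\<^sup>2)"
  have r: "r > 0" "r\<^sup>2 = a\<^sup>2 + u\<^sup>2" using p by (auto simp: r_def)
  have "(a / r)\<^sup>2 + (u / r)\<^sup>2 = (a\<^sup>2 + u\<^sup>2) / r\<^sup>2" by (simp add: power_divide add_divide_distrib)
  also have "\<dots> = 1" unfolding r(2) by (rule divide_self) (rule less_imp_neq[OF p, symmetric])
  finally show ?thesis unfolding r_def[symmetric] using r by (intro exI[of _ "a / r"] exI[of _ "u / r"]) auto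
qed

text \<open>The two projections of an independent Gaussian family are distributed like the
  triangular image (a x, b x + c y) of an independent pair. Nonnegative integrals avoid
  integrability conditions; the type argument fixes the space in which the Gaussians live.\<close>

definition two_projection_law :: "'a::euclidean_space itself \<Rightarrow> (nat \<Rightarrow> real) \<Rightarrow> (nat \<Rightarrow> real) \<Rightarrow> nat \<Rightarrow> real \<Rightarrow> real \<Rightarrow> real \<Rightarrow> bool" where
  "two_projection_law _ u v n a b c \<longleftrightarrow>
    (\<forall>f :: 'a \<Rightarrow> 'a \<Rightarrow> ennreal. case_prod f \<in> borel_measurable (borel \<Otimes>\<^sub>M borel) \<longrightarrow>
      (\<integral>\<^sup>+X. f (\<Sum>i<n. u i *\<^sub>R X i) (\<Sum>i<n. v i *\<^sub>R X i) \<partial>PiM {..<n} (\<lambda>_. std_gauss)) =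
      (\<integral>\<^sup>+x. \<integral>\<^sup>+y. f (a *\<^sub>R x) (b *\<^sub>R x + c *\<^sub>R y) \<partial>std_gauss \<partial>std_gauss))"

text \<open>The numbers a, b, c form a Cholesky factor of the Gram matrix of u and v. In the
  induction the new Gaussian is a third variable besides p and q: one rotation removes it from the
  first projection, and another merges it with q in the second.\<close>

lemma ex_two_projection_law:
  "\<exists>a b c. 0 \<le> a \<and> 0 \<le> c \<and> a\<^sup>2 = (\<Sum>i<n. (u i)\<^sup>2) \<and> a * b = (\<Sum>i<n. u i * v i) \<and> b\<^sup>2 + c\<^sup>2 = (\<Sum>i<n. (v i)\<^sup>2) \<and>
    two_projection_law TYPE('a::euclidean_space) u v n a b c"
proof (induction n)
  case 0
  interpret s: prob_space "std_gauss :: 'a measure" by (rule prob_space_std_gauss)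
  show ?case
    using s.emeasure_space_1 prob_space.emeasure_space_1[OF prob_space_PiM, of "{}" "\<lambda>_::nat. std_gauss :: 'a measure"]
    by (intro exI[of _ 0]) (simp add: two_projection_law_def)
next
  case (Suc n)
  then obtain a b c where abc: "0 \<le> a" "0 \<le> c" "a\<^sup>2 = (\<Sum>i<n. (u i)\<^sup>2)" "a * b = (\<Sum>i<n. u i * v i)" "b\<^sup>2 + c\<^sup>2 = (\<Sum>i<n. (v i)\<^sup>2)"
    and IH': "two_projection_law TYPE('a) u v n a b c" by blast
  note IH = IH'[unfolded two_projection_law_def, rule_format]
  interpret s: prob_space "std_gauss :: 'a measure" by (rule prob_space_std_gauss)
  interpret ps: product_sigma_finite "\<lambda>_::nat. std_gauss :: 'a measure"
    by (intro product_sigma_finite.intro s.sigma_finite_measure_axioms)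
  interpret pp: pair_sigma_finite "std_gauss :: 'a measure" "std_gauss :: 'a measure" ..
  define un vn where "un = u n" and "vn = v n"
  define r where "r = sqrt (a\<^sup>2 + un\<^sup>2)"
  \<comment> \<open>Rotation by the polar angle of (a, un) collects a p + un y into a single
    Gaussian with coefficient r.\<close>
  obtain C S where CS: "C\<^sup>2 + S\<^sup>2 = 1" "r * C = a" "r * S = un"
    using rotation_onto_axis[of a un] unfolding r_def by blast
  define b' v' where "b' = b * C + vn * S" and "v' = vn * C - b * S"
  define r2 where "r2 = sqrt (c\<^sup>2 + v'\<^sup>2)"
  obtain C2 S2 where CS2: "C2\<^sup>2 + S2\<^sup>2 = 1" "r2 * C2 = c" "r2 * S2 = v'"
    using rotation_onto_axis[of c v'] unfolding r2_def by blast
  have r0: "r \<ge> 0" "r2 \<ge> 0" by (simp_all add: r_def r2_def)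
  have rr: "r\<^sup>2 = a\<^sup>2 + un\<^sup>2" "r2\<^sup>2 = c\<^sup>2 + v'\<^sup>2" by (simp_all add: r_def r2_def)
  have "r * b' = b * (r * C) + vn * (r * S)" by (simp add: b'_def algebra_simps)
  then have rb: "r * b' = a * b + un * vn" by (simp add: CS)
  have "b'\<^sup>2 + v'\<^sup>2 = (b\<^sup>2 + vn\<^sup>2) * (C\<^sup>2 + S\<^sup>2)" by (simp add: b'_def v'_def power2_eq_square algebra_simps)
  then have bb: "b'\<^sup>2 + r2\<^sup>2 = b\<^sup>2 + c\<^sup>2 + vn\<^sup>2" using CS rr by simp
  have e1: "a * C + un * S = r"
  proof -
    have "a * C + un * S = r * (C\<^sup>2 + S\<^sup>2)" by (simp add: CS(2,3)[symmetric] power2_eq_square algebra_simps)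
    then show ?thesis by (simp add: CS)
  qed
  have e2: "un * C - a * S = 0" by (simp add: CS(2,3)[symmetric])
  have e3: "c * C2 + v' * S2 = r2"
  proof -
    have "c * C2 + v' * S2 = r2 * (C2\<^sup>2 + S2\<^sup>2)" by (simp add: CS2(2,3)[symmetric] power2_eq_square algebra_simps)
    then show ?thesis by (simp add: CS2)
  qed
  have e4: "v' * C2 - c * S2 = 0" by (simp add: CS2(2,3)[symmetric])
  have "(\<integral>\<^sup>+X. f (\<Sum>i<Suc n. u i *\<^sub>R X i) (\<Sum>i<Suc n. v i *\<^sub>R X i) \<partial>PiM {..<Suc n} (\<lambda>_. std_gauss)) =
      (\<integral>\<^sup>+x. \<integral>\<^sup>+y. f (r *\<^sub>R x) (b' *\<^sub>R x + r2 *\<^sub>R y) \<partial>std_gauss \<partial>std_gauss)"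
    if fm [measurable]: "case_prod f \<in> borel_measurable (borel \<Otimes>\<^sub>M borel)" for f :: "'a \<Rightarrow> 'a \<Rightarrow> ennreal"
  proof -
    have comp [measurable]: "(\<lambda>X. X i) \<in> PiM J (\<lambda>_. std_gauss) \<rightarrow>\<^sub>M (borel :: 'a measure)" if "i \<in> J" for i :: nat and J
      using measurable_component_singleton[OF that, of "\<lambda>_. std_gauss :: 'a measure"]
      by (simp add: measurable_cong_sets[OF refl sets_std_gauss])
    have F1: "(\<lambda>X. f (\<Sum>i<Suc n. u i *\<^sub>R X i) (\<Sum>i<Suc n. v i *\<^sub>R X i)) \<in> borel_measurable (PiM {..<Suc n} (\<lambda>_. std_gauss))"
    proof -
      have s: "(\<lambda>X. \<Sum>i<Suc n. w i *\<^sub>R X i) \<in> PiM {..<Suc n} (\<lambda>_. std_gauss) \<rightarrow>\<^sub>M (borel :: 'a measure)" for w :: "nat \<Rightarrow> real"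
        by (intro borel_measurable_sum borel_measurable_scaleR borel_measurable_const comp)
      have "(\<lambda>X. case_prod f (\<Sum>i<Suc n. u i *\<^sub>R X i, \<Sum>i<Suc n. v i *\<^sub>R X i)) \<in> borel_measurable (PiM {..<Suc n} (\<lambda>_. std_gauss))"
        by (rule measurable_compose[OF measurable_Pair[OF s s] fm])
      then show ?thesis by simp
    qed
    have "(\<integral>\<^sup>+X. f (\<Sum>i<Suc n. u i *\<^sub>R X i) (\<Sum>i<Suc n. v i *\<^sub>R X i) \<partial>PiM {..<Suc n} (\<lambda>_. std_gauss)) =
      (\<integral>\<^sup>+y. \<integral>\<^sup>+X. f (\<Sum>i<Suc n. u i *\<^sub>R (X(n := y)) i) (\<Sum>i<Suc n. v i *\<^sub>R (X(n := y)) i) \<partial>PiM {..<n} (\<lambda>_. std_gauss) \<partial>std_gauss)"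
      using ps.product_nn_integral_insert_rev[of "{..<n}" n, OF _ _ F1[unfolded lessThan_Suc]]
      unfolding lessThan_Suc by simp
    also have "\<dots> = (\<integral>\<^sup>+y. \<integral>\<^sup>+X. (\<lambda>p q. f (p + un *\<^sub>R y) (q + vn *\<^sub>R y)) (\<Sum>i<n. u i *\<^sub>R X i) (\<Sum>i<n. v i *\<^sub>R X i) \<partial>PiM {..<n} (\<lambda>_. std_gauss) \<partial>std_gauss)"
      by (simp add: un_def vn_def)
    also have "\<dots> = (\<integral>\<^sup>+y. \<integral>\<^sup>+p. \<integral>\<^sup>+q. f (a *\<^sub>R p + un *\<^sub>R y) (b *\<^sub>R p + c *\<^sub>R q + vn *\<^sub>R y) \<partial>std_gauss \<partial>std_gauss \<partial>std_gauss)"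
      by (intro nn_integral_cong IH) measurable
    also have "\<dots> = (\<integral>\<^sup>+p. \<integral>\<^sup>+y. \<integral>\<^sup>+q. f (a *\<^sub>R p + un *\<^sub>R y) (b *\<^sub>R p + c *\<^sub>R q + vn *\<^sub>R y) \<partial>std_gauss \<partial>std_gauss \<partial>std_gauss)"
      by (rule pp.Fubini') measurable
    also have "\<dots> = (\<integral>\<^sup>+p. \<integral>\<^sup>+y. (\<lambda>p y. \<integral>\<^sup>+q. f (a *\<^sub>R p + un *\<^sub>R y) (b *\<^sub>R p + c *\<^sub>R q + vn *\<^sub>R y) \<partial>std_gauss)
        (C *\<^sub>R p - S *\<^sub>R y) (S *\<^sub>R p + C *\<^sub>R y) \<partial>std_gauss \<partial>std_gauss)"
      by (rule nn_integral_rotate_std_gauss[OF _ CS(1), symmetric]) measurable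
    also have "\<dots> = (\<integral>\<^sup>+p. \<integral>\<^sup>+y. \<integral>\<^sup>+q. f (r *\<^sub>R p) (b' *\<^sub>R p + (c *\<^sub>R q + v' *\<^sub>R y)) \<partial>std_gauss \<partial>std_gauss \<partial>std_gauss)"
    proof -
      have E1: "a *\<^sub>R (C *\<^sub>R p - S *\<^sub>R y) + un *\<^sub>R (S *\<^sub>R p + C *\<^sub>R y) = (a * C + un * S) *\<^sub>R p + (un * C - a * S) *\<^sub>R y" for p y :: 'a
        by (simp add: algebra_simps)
      have E2: "b *\<^sub>R (C *\<^sub>R p - S *\<^sub>R y) + c *\<^sub>R q + vn *\<^sub>R (S *\<^sub>R p + C *\<^sub>R y) = b' *\<^sub>R p + (c *\<^sub>R q + v' *\<^sub>R y)" for p y q :: 'a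
        by (simp add: b'_def v'_def algebra_simps)
      show ?thesis by (simp only: E1 E2 e1 e2 scaleR_zero_left add_0_right)
    qed
    also have "\<dots> = (\<integral>\<^sup>+p. \<integral>\<^sup>+y. f (r *\<^sub>R p) (b' *\<^sub>R p + r2 *\<^sub>R y) \<partial>std_gauss \<partial>std_gauss)"
    proof (rule nn_integral_cong)
      fix p :: 'a
      have "(\<integral>\<^sup>+y. \<integral>\<^sup>+q. f (r *\<^sub>R p) (b' *\<^sub>R p + (c *\<^sub>R q + v' *\<^sub>R y)) \<partial>std_gauss \<partial>std_gauss) =
         (\<integral>\<^sup>+q. \<integral>\<^sup>+y. f (r *\<^sub>R p) (b' *\<^sub>R p + (c *\<^sub>R q + v' *\<^sub>R y)) \<partial>std_gauss \<partial>std_gauss)"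
        by (rule pp.Fubini') measurable
      also have "\<dots> = (\<integral>\<^sup>+q. \<integral>\<^sup>+y. (\<lambda>q y. f (r *\<^sub>R p) (b' *\<^sub>R p + (c *\<^sub>R q + v' *\<^sub>R y))) (C2 *\<^sub>R q - S2 *\<^sub>R y) (S2 *\<^sub>R q + C2 *\<^sub>R y) \<partial>std_gauss \<partial>std_gauss)"
        by (rule nn_integral_rotate_std_gauss[OF _ CS2(1), symmetric]) measurable
      also have "\<dots> = (\<integral>\<^sup>+q. \<integral>\<^sup>+y. f (r *\<^sub>R p) (b' *\<^sub>R p + r2 *\<^sub>R q) \<partial>(std_gauss::'a measure) \<partial>std_gauss)"
      proof -
        have "c *\<^sub>R (C2 *\<^sub>R q - S2 *\<^sub>R y) + v' *\<^sub>R (S2 *\<^sub>R q + C2 *\<^sub>R y) = (c * C2 + v' * S2) *\<^sub>R q + (v' * C2 - c * S2) *\<^sub>R y" for q y :: 'a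
          by (simp add: algebra_simps)
        then show ?thesis by (simp add: e3 e4)
      qed
      also have "\<dots> = (\<integral>\<^sup>+q. f (r *\<^sub>R p) (b' *\<^sub>R p + r2 *\<^sub>R q) \<partial>std_gauss)"
        using s.emeasure_space_1 by simp
      finally show "(\<integral>\<^sup>+y. \<integral>\<^sup>+q. f (r *\<^sub>R p) (b' *\<^sub>R p + (c *\<^sub>R q + v' *\<^sub>R y)) \<partial>std_gauss \<partial>std_gauss) =
         (\<integral>\<^sup>+q. f (r *\<^sub>R p) (b' *\<^sub>R p + r2 *\<^sub>R q) \<partial>std_gauss)" .
    qed
    finally show ?thesis .
  qed
  then have "two_projection_law TYPE('a) u v (Suc n) r b' r2" unfolding two_projection_law_def by blast
  moreover have "r\<^sup>2 = (\<Sum>i<Suc n. (u i)\<^sup>2)" "r * b' = (\<Sum>i<Suc n. u i * v i)" "b'\<^sup>2 + r2\<^sup>2 = (\<Sum>i<Suc n. (v i)\<^sup>2)"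
    using rr(1) rb bb abc by (simp_all add: un_def vn_def)
  ultimately show ?case using r0 by blast
qed

text \<open>The projection laws speak of nonnegative integrals; adding 1 makes a function bounded by
  1 in modulus nonnegative.\<close>

lemma integral_eq_enn2real_shift:
  fixes g :: "'a \<Rightarrow> real"
  assumes "prob_space M" and [measurable]: "g \<in> borel_measurable M" and g: "\<And>x. \<bar>g x\<bar> \<le> 1"
  shows "(\<integral>x. g x \<partial>M) = enn2real (\<integral>\<^sup>+x. ennreal (g x + 1) \<partial>M) - 1"
proof -
  interpret prob_space M by fact
  have i: "integrable M g" by (rule integrable_const_bound[of _ 1]) (use g in auto)
  have "(\<integral>x. g x + 1 \<partial>M) = enn2real (\<integral>\<^sup>+x. ennreal (g x + 1) \<partial>M)"
  proof (intro integral_eq_nn_integral AE_I2)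
    show "0 \<le> g x + 1" for x using g[of x] by linarith
  qed measurable
  moreover have "(\<integral>x. g x + 1 \<partial>M) = (\<integral>x. g x \<partial>M) + 1" using i by (simp add: prob_space)
  ultimately show ?thesis by simp
qed

lemma measurable_projection:
  fixes w :: "nat \<Rightarrow> real" and n :: nat
  shows "(\<lambda>X. \<Sum>i<n. w i *\<^sub>R X i) \<in> PiM {..<n} (\<lambda>_. std_gauss) \<rightarrow>\<^sub>M (borel :: 'a::euclidean_space measure)"
proof -
  have "(\<lambda>X. X i) \<in> PiM {..<n} (\<lambda>_. std_gauss) \<rightarrow>\<^sub>M (borel :: 'a measure)" if "i < n" for i :: nat
    using measurable_component_singleton[of i "{..<n}" "\<lambda>_. std_gauss :: 'a measure"] that
    by (simp add: measurable_cong_sets[OF refl sets_std_gauss])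
  then show ?thesis by (intro borel_measurable_sum borel_measurable_scaleR borel_measurable_const) auto
qed

text \<open>For unit vectors the triangular form has a = 1, b = \<rho> and c = sqrt(1 - \<rho>^2),
  exactly the pair in \<open>gp_corr\<close>; only the inner product of the vectors
  survives.\<close>

lemma hat_inner_projections:
  fixes u v :: "nat \<Rightarrow> real"
  assumes u: "(\<Sum>i<n. (u i)\<^sup>2) = 1" and v: "(\<Sum>i<n. (v i)\<^sup>2) = 1"
  shows "(\<integral>X. hat_inner (\<Sum>i<n. u i *\<^sub>R X i) (\<Sum>i<n. v i *\<^sub>R X i) \<partial>PiM {..<n} (\<lambda>_. std_gauss)) = gp_corr (\<Sum>i<n. u i * v i)"
proof -
  define \<rho> where "\<rho> = (\<Sum>i<n. u i * v i)"
  define f where "f x y = ennreal (hat_inner x y + 1)" for x y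
  have fm [measurable]: "case_prod f \<in> borel_measurable (borel \<Otimes>\<^sub>M borel)" unfolding f_def by measurable
  obtain a b c where abc: "0 \<le> a" "0 \<le> c" "a\<^sup>2 = (\<Sum>i<n. (u i)\<^sup>2)" "a * b = (\<Sum>i<n. u i * v i)" "b\<^sup>2 + c\<^sup>2 = (\<Sum>i<n. (v i)\<^sup>2)"
    and law': "two_projection_law TYPE(real^3) u v n a b c"
    using ex_two_projection_law[where ?'a="real^3" and n=n and u=u and v=v] by blast
  note law = law'[unfolded two_projection_law_def, rule_format, OF fm]
  have a: "a = 1" using abc u by (simp add: power2_eq_1_iff)
  have b: "b = \<rho>" using abc a by (simp add: \<rho>_def)
  have c: "c = sqrt (1 - \<rho>\<^sup>2)" 
  proof -
    have "c\<^sup>2 = 1 - \<rho>\<^sup>2" using abc(5) v b by simp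
    then show ?thesis using abc(2) by (simp add: real_sqrt_unique)
  qed
  interpret s: prob_space "std_gauss :: (real^3) measure" by (rule prob_space_std_gauss)
  interpret pp: pair_prob_space "std_gauss :: (real^3) measure" "std_gauss :: (real^3) measure" ..
  have P: "prob_space (PiM {..<n} (\<lambda>_. std_gauss :: (real^3) measure))"
    by (intro prob_space_PiM s.prob_space_axioms)
  have "(\<lambda>X. case_prod hat_inner (\<Sum>i<n. u i *\<^sub>R X i, \<Sum>i<n. v i *\<^sub>R X i)) \<in> borel_measurable (PiM {..<n} (\<lambda>_. std_gauss))"
    by (rule measurable_compose[OF measurable_Pair[OF measurable_projection measurable_projection] measurable_hat_inner])
  then have "(\<integral>X. hat_inner (\<Sum>i<n. u i *\<^sub>R X i) (\<Sum>i<n. v i *\<^sub>R X i) \<partial>PiM {..<n} (\<lambda>_. std_gauss)) =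
     enn2real (\<integral>\<^sup>+X. f (\<Sum>i<n. u i *\<^sub>R X i) (\<Sum>i<n. v i *\<^sub>R X i) \<partial>PiM {..<n} (\<lambda>_. std_gauss)) - 1"
    unfolding f_def by (intro integral_eq_enn2real_shift[OF P] abs_hat_inner_le) simp
  also have "\<dots> = enn2real (\<integral>\<^sup>+x. \<integral>\<^sup>+y. f x (\<rho> *\<^sub>R x + sqrt (1 - \<rho>\<^sup>2) *\<^sub>R y) \<partial>std_gauss \<partial>std_gauss) - 1"
    unfolding law a b c by simp
  also have "(\<integral>\<^sup>+x. \<integral>\<^sup>+y. f x (\<rho> *\<^sub>R x + sqrt (1 - \<rho>\<^sup>2) *\<^sub>R y) \<partial>std_gauss \<partial>std_gauss) =
     (\<integral>\<^sup>+p. f (fst p) (\<rho> *\<^sub>R fst p + sqrt (1 - \<rho>\<^sup>2) *\<^sub>R snd p) \<partial>(std_gauss \<Otimes>\<^sub>M std_gauss))"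
  proof -
    have "(\<lambda>p. f (fst p) (\<rho> *\<^sub>R fst p + sqrt (1 - \<rho>\<^sup>2) *\<^sub>R snd p)) \<in> borel_measurable (std_gauss \<Otimes>\<^sub>M std_gauss)"
      by measurable
    from s.nn_integral_fst[OF this] show ?thesis by simp
  qed
  also have "enn2real \<dots> - 1 = gp_corr \<rho>"
    unfolding gp_corr_def f_def
    by (rule integral_eq_enn2real_shift[symmetric, OF pp.prob_space_axioms]) (auto simp: abs_hat_inner_le)
  finally show ?thesis by (simp add: \<rho>_def)
qed

subsection \<open>Rounding\<close>

definition coord3 :: "nat \<Rightarrow> 3" where
  "coord3 l = (if l = 0 then 1 else if l = 1 then 2 else 3)"

lemma sum_coord3: "(\<Sum>l<3. (a :: real^3) $ coord3 l * b $ coord3 l) = a \<bullet> b"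
  by (simp add: sum_lessThan_3 coord3_def inner_vec_def sum_3)

text \<open>The maximum dominates the average over random product states. Where a projection
  vanishes, the convention 1/0 = 0 yields the zero Bloch vector, a maximally mixed qubit, so the
  bound holds for every \<open>X\<close> and not merely almost everywhere.\<close>

lemma QMaxCut_ge_gp_corr:
  assumes f: "f \<in> sphere_maps n"
  shows "(\<Sum>e\<in>edges n. w e * (1/4 - 1/4 * gp_corr (\<Sum>i<n. f (fst e) i * f (snd e) i))) \<le> QMaxCut n w"
proof -
  let ?P = "PiM {..<n} (\<lambda>_. std_gauss :: (real^3) measure)"
  interpret P: prob_space ?P by (intro prob_space_PiM prob_space_std_gauss)
  define Y where "Y u X = (\<Sum>i<n. f u i *\<^sub>R X i)" for u and X :: "nat \<Rightarrow> real^3"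
  define E where "E X = (\<Sum>e\<in>edges n. w e * (1/4 - 1/4 * hat_inner (Y (fst e) X) (Y (snd e) X)))" for X
  have le: "E X \<le> QMaxCut n w" for X
  proof -
    define r where "r u l = ((1 / norm (Y u X)) *\<^sub>R Y u X) $ coord3 l" for u l
    have s: "(\<Sum>l<3. r u l * r v l) = hat_inner (Y u X) (Y v X)" for u v
      unfolding r_def sum_coord3 hat_inner_def ..
    have "(\<Sum>l<3. (r u l)\<^sup>2) \<le> 1" for u
      using s[of u u] abs_hat_inner_le[of "Y u X" "Y u X"] by (simp add: power2_eq_square)
    from QMaxCut_ge_product[of n r w, OF this] show ?thesis unfolding E_def s .
  qed
  have int: "integrable ?P (\<lambda>X. hat_inner (Y u X) (Y v X))" for u v
  proof (rule P.integrable_const_bound[of _ 1])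
    have "(\<lambda>X. case_prod hat_inner (Y u X, Y v X)) \<in> borel_measurable ?P"
      unfolding Y_def
      by (rule measurable_compose[OF measurable_Pair[OF measurable_projection measurable_projection] measurable_hat_inner])
    then show "(\<lambda>X. hat_inner (Y u X) (Y v X)) \<in> borel_measurable ?P" by simp
  qed (use abs_hat_inner_le in auto)
  have "(\<Sum>e\<in>edges n. w e * (1/4 - 1/4 * gp_corr (\<Sum>i<n. f (fst e) i * f (snd e) i))) = (\<integral>X. E X \<partial>?P)"
  proof -
    have "(\<integral>X. E X \<partial>?P) = (\<Sum>e\<in>edges n. w e * (1/4 - 1/4 * (\<integral>X. hat_inner (Y (fst e) X) (Y (snd e) X) \<partial>?P)))"
      unfolding E_def using int by (simp add: P.prob_space)
    also have "\<dots> = (\<Sum>e\<in>edges n. w e * (1/4 - 1/4 * gp_corr (\<Sum>i<n. f (fst e) i * f (snd e) i)))"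
    proof (intro sum.cong refl)
      fix e assume "e \<in> edges n"
      then have "fst e < n" "snd e < n" by (auto simp: edges_def)
      then have "(\<Sum>i<n. (f (fst e) i)\<^sup>2) = 1" "(\<Sum>i<n. (f (snd e) i)\<^sup>2) = 1" using f by (auto simp: sphere_maps_def)
      then show "w e * (1/4 - 1/4 * (\<integral>X. hat_inner (Y (fst e) X) (Y (snd e) X) \<partial>?P)) =
        w e * (1/4 - 1/4 * gp_corr (\<Sum>i<n. f (fst e) i * f (snd e) i))"
        unfolding Y_def by (simp only: hat_inner_projections)
    qed
    finally show ?thesis ..
  qed
  also have "\<dots> \<le> QMaxCut n w"
  proof (rule P.integral_le_const)
    show "integrable ?P E" unfolding E_def[abs_def] using int by simp
  qed (use le in auto)
  finally show ?thesis .
qed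

section \<open>The ratio function, SDP values and the lower bound\<close>

definition gp_ratio :: "real \<Rightarrow> real" where
  "gp_ratio \<rho> = (1/4 - 1/4 * gp_corr \<rho>) / (1/4 - 3/4 * \<rho>)"

lemma alpha_GP_eq: "alpha_GP = (INF \<rho>\<in>{-1..<1/3}. gp_ratio \<rho>)"
  unfolding alpha_GP_def gp_ratio_def F_star3_eq ..

lemma gp_corr_le: "gp_corr \<rho> \<le> 1"
proof -
  interpret s: prob_space "std_gauss :: (real^3) measure" by (rule prob_space_std_gauss)
  interpret pp: pair_prob_space "std_gauss :: (real^3) measure" "std_gauss :: (real^3) measure" ..
  have m: "(\<lambda>p. hat_inner (fst p) (\<rho> *\<^sub>R fst p + sqrt (1 - \<rho>\<^sup>2) *\<^sub>R snd p)) \<in> borel_measurable (std_gauss \<Otimes>\<^sub>M std_gauss)"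
    by measurable
  show ?thesis unfolding gp_corr_def
    by (rule pp.integral_le_const[OF pp.integrable_const_bound[of _ 1, OF _ m]])
      (use abs_hat_inner_le in \<open>auto intro: order_trans[OF abs_ge_self]\<close>)
qed

lemma gp_ratio_nonneg: "\<rho> < 1/3 \<Longrightarrow> 0 \<le> gp_ratio \<rho>"
  unfolding gp_ratio_def using gp_corr_le[of \<rho>] by (intro divide_nonneg_nonneg) auto

lemma alpha_GP_nonneg: "0 \<le> alpha_GP"
  unfolding alpha_GP_eq by (rule cINF_greatest) (auto intro: gp_ratio_nonneg)

lemma alpha_GP_le: "-1 \<le> \<rho> \<Longrightarrow> \<rho> < 1/3 \<Longrightarrow> alpha_GP \<le> gp_ratio \<rho>"
  unfolding alpha_GP_eq by (rule cINF_lower) (auto intro!: bdd_belowI[of _ 0] gp_ratio_nonneg)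

text \<open>SDP vectors may have any inner product in [-1,1]. With the denominator cleared, the
  inequality persists for \<rho> \<ge> 1/3, where the left side is nonpositive and the right side
  nonnegative.\<close>

lemma alpha_GP_mult_le:
  assumes "-1 \<le> \<rho>"
  shows "alpha_GP * (1/4 - 3/4 * \<rho>) \<le> 1/4 - 1/4 * gp_corr \<rho>"
proof (cases "\<rho> < 1/3")
  case True
  then show ?thesis using alpha_GP_le[OF assms True] by (simp add: gp_ratio_def pos_le_divide_eq)
next
  case False
  then have "alpha_GP * (1/4 - 3/4 * \<rho>) \<le> 0" using alpha_GP_nonneg by (intro mult_nonneg_nonpos) auto
  also have "0 \<le> 1/4 - 1/4 * gp_corr \<rho>" using gp_corr_le[of \<rho>] by simp
  finally show ?thesis .
qed

definition sdp_value :: "nat \<Rightarrow> (nat \<times> nat \<Rightarrow> real) \<Rightarrow> (nat \<Rightarrow> nat \<Rightarrow> real) \<Rightarrow> real" where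
  "sdp_value n w f = (\<Sum>e\<in>edges n. w e * (1/4 - 3/4 * (\<Sum>i<n. f (fst e) i * f (snd e) i)))"

lemma sphere_maps_inner:
  assumes "f \<in> sphere_maps n" "u < n" "v < n"
  shows "\<bar>\<Sum>i<n. f u i * f v i\<bar> \<le> 1"
proof -
  have "(\<Sum>i<n. f u i * f v i)\<^sup>2 \<le> (\<Sum>i<n. (f u i)\<^sup>2) * (\<Sum>i<n. (f v i)\<^sup>2)" by (rule Cauchy_Schwarz_ineq_sum)
  also have "\<dots> = 1" using assms by (simp add: sphere_maps_def)
  finally show ?thesis by (simp add: abs_square_le_1)
qed

lemma sdp_value_le:
  assumes w: "weighted_graph n w" and f: "f \<in> sphere_maps n"
  shows "sdp_value n w f \<le> 1"
proof -
  have "sdp_value n w f \<le> (\<Sum>e\<in>edges n. w e * 1)"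
    unfolding sdp_value_def
  proof (intro sum_mono mult_left_mono)
    fix e assume e: "e \<in> edges n"
    then have "\<bar>\<Sum>i<n. f (fst e) i * f (snd e) i\<bar> \<le> 1" by (intro sphere_maps_inner[OF f]) (auto simp: edges_def)
    then show "1/4 - 3/4 * (\<Sum>i<n. f (fst e) i * f (snd e) i) \<le> 1" by linarith
    show "0 \<le> w e" using w e by (simp add: weighted_graph_def)
  qed
  then show ?thesis using w by (simp add: weighted_graph_def)
qed

lemma SDP_QMC_ge:
  assumes w: "weighted_graph n w" and f: "f \<in> sphere_maps n"
  shows "sdp_value n w f \<le> SDP_QMC n w"
  unfolding SDP_QMC_def sdp_value_def[symmetric] using sdp_value_le[OF w]
  by (intro cSUP_upper f) (auto intro!: bdd_aboveI[of _ 1])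

text \<open>An orthonormal assignment makes every edge contribute 1/4. All ratios thus have positive
  denominators.\<close>

lemma SDP_QMC_pos:
  assumes w: "weighted_graph n w"
  shows "1/4 \<le> SDP_QMC n w"
proof -
  define f :: "nat \<Rightarrow> nat \<Rightarrow> real" where "f u i = (if i = u then 1 else 0)" for u i
  have "(\<Sum>i<n. (f u i)\<^sup>2) = 1" if "u < n" for u
    using that by (simp add: f_def if_distrib[of "\<lambda>x. x\<^sup>2"] cong: if_cong)
  then have f: "f \<in> sphere_maps n" by (auto simp: sphere_maps_def f_def)
  have "(\<Sum>i<n. f u i * f v i) = 0" if "u \<noteq> v" for u v
    using that by (intro sum.neutral) (auto simp: f_def)
  then have "sdp_value n w f = (\<Sum>e\<in>edges n. w e * (1/4))"
    unfolding sdp_value_def by (intro sum.cong refl) (auto simp: edges_def)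
  also have "\<dots> = 1/4" using w by (simp only: sum_distrib_right[symmetric] weighted_graph_def mult_1)
  finally show ?thesis using SDP_QMC_ge[OF w f] by simp
qed

lemma QMaxCut_ratio_ge:
  assumes w: "weighted_graph n w"
  shows "alpha_GP \<le> QMaxCut n w / SDP_QMC n w"
proof -
  have val: "alpha_GP * sdp_value n w f \<le> QMaxCut n w" if f: "f \<in> sphere_maps n" for f
  proof -
    have "alpha_GP * sdp_value n w f =
      (\<Sum>e\<in>edges n. w e * (alpha_GP * (1/4 - 3/4 * (\<Sum>i<n. f (fst e) i * f (snd e) i))))"
      unfolding sdp_value_def sum_distrib_left by (intro sum.cong refl) (simp only: mult.left_commute)
    also have "\<dots> \<le> (\<Sum>e\<in>edges n. w e * (1/4 - 1/4 * gp_corr (\<Sum>i<n. f (fst e) i * f (snd e) i)))"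
    proof (intro sum_mono mult_left_mono alpha_GP_mult_le)
      fix e assume e: "e \<in> edges n"
      then have "\<bar>\<Sum>i<n. f (fst e) i * f (snd e) i\<bar> \<le> 1" by (intro sphere_maps_inner[OF f]) (auto simp: edges_def)
      then show "-1 \<le> (\<Sum>i<n. f (fst e) i * f (snd e) i)" by linarith
      show "0 \<le> w e" using w e by (simp add: weighted_graph_def)
    qed
    also have "\<dots> \<le> QMaxCut n w" by (rule QMaxCut_ge_gp_corr[OF f])
    finally show ?thesis .
  qed
  have ne: "sphere_maps n \<noteq> {}"
  proof -
    have "(\<lambda>u i. if i = u then 1 else 0) \<in> sphere_maps n"
      by (auto simp: sphere_maps_def if_distrib[of "\<lambda>x. x\<^sup>2"] cong: if_cong)
    then show ?thesis by blast
  qed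
  have "alpha_GP * SDP_QMC n w \<le> QMaxCut n w"
  \<comment> \<open>If \<open>alpha_GP\<close> vanishes, the claim is nonnegativity of
    \<open>QMaxCut\<close>, which any single sphere map shows; otherwise it can be divided out of
    the supremum.\<close>
  proof (cases "alpha_GP = 0")
    case True
    then show ?thesis using val ne by auto
  next
    case False
    then have a: "alpha_GP > 0" using alpha_GP_nonneg by simp
    have "SDP_QMC n w \<le> QMaxCut n w / alpha_GP"
      unfolding SDP_QMC_def sdp_value_def[symmetric]
      using val a by (intro cSUP_least ne) (simp add: pos_le_divide_eq mult.commute)
    then show ?thesis using a by (simp add: pos_le_divide_eq mult.commute)
  qed
  moreover have "SDP_QMC n w > 0" using SDP_QMC_pos[OF w] by simp
  ultimately show ?thesis by (simp add: pos_le_divide_eq)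
qed

subsection \<open>Stability of the radial field\<close>

lemma std_gauss_real: "(std_gauss :: real measure) = normal1"
  by (simp add: std_gauss_def)

text \<open>The map \<open>corr\<close> completed to a rotation of pairs of vectors. Its invariance
  carries statements about x over to the correlated partner y.\<close>

definition gauss_rot :: "nat \<Rightarrow> real \<Rightarrow> (nat \<Rightarrow> real) \<times> (nat \<Rightarrow> real) \<Rightarrow> (nat \<Rightarrow> real) \<times> (nat \<Rightarrow> real)" where
  "gauss_rot d \<rho> p = (corr d \<rho> (fst p) (snd p), \<lambda>i\<in>{..<d}. \<rho> * snd p i - sqrt (1 - \<rho>\<^sup>2) * fst p i)"

text \<open>Reduction to one coordinate: a pair of d-vectors is regrouped as d independent pairs of
  reals, and \<open>R\<close> acts on each. With \<open>R\<close> the identity it says that the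
  regrouping itself preserves the law.\<close>

lemma distr_gauss_pairing:
  fixes R :: "real \<times> real \<Rightarrow> real \<times> real"
  assumes R [measurable]: "R \<in> borel \<Otimes>\<^sub>M borel \<rightarrow>\<^sub>M borel \<Otimes>\<^sub>M borel"
    and inv: "\<And>A. A \<in> sets (borel \<Otimes>\<^sub>M borel) \<Longrightarrow>
      (\<integral>\<^sup>+x. \<integral>\<^sup>+y. indicator A (R (x, y)) \<partial>normal1 \<partial>normal1) = (\<integral>\<^sup>+x. \<integral>\<^sup>+y. indicator A (x, y) \<partial>normal1 \<partial>normal1)"
  shows "distr (gauss d \<Otimes>\<^sub>M gauss d) (PiM {..<d} (\<lambda>_. normal1 \<Otimes>\<^sub>M normal1)) (\<lambda>p. \<lambda>i\<in>{..<d}. R (fst p i, snd p i))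
     = PiM {..<d} (\<lambda>_. normal1 \<Otimes>\<^sub>M normal1)"
proof -
  interpret pp: pair_prob_space normal1 normal1 ..
  interpret g: prob_space "gauss d" by (rule prob_space_gauss)
  interpret gg: pair_prob_space "gauss d" "gauss d" ..
  interpret P: product_sigma_finite "\<lambda>_::nat. normal1 \<Otimes>\<^sub>M normal1"
    by (intro product_sigma_finite.intro pp.sigma_finite_measure_axioms)
  interpret N: product_sigma_finite "\<lambda>_::nat. normal1" by (rule product_sigma_finite_normal1)
  note comp = measurable_gauss_component
  have Ri: "(\<lambda>p. R (fst p i, snd p i)) \<in> gauss d \<Otimes>\<^sub>M gauss d \<rightarrow>\<^sub>M borel \<Otimes>\<^sub>M borel" if "i < d" for i
    using measurable_compose[OF measurable_fst comp[OF that]] measurable_compose[OF measurable_snd comp[OF that]]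
    by (intro measurable_compose[OF _ R] measurable_Pair) auto
  have sp: "sets (normal1 \<Otimes>\<^sub>M normal1) = sets (borel \<Otimes>\<^sub>M borel)"
    by (rule sets_pair_measure_cong) auto
  have m: "(\<lambda>p. \<lambda>i\<in>{..<d}. R (fst p i, snd p i)) \<in> gauss d \<Otimes>\<^sub>M gauss d \<rightarrow>\<^sub>M PiM {..<d} (\<lambda>_. normal1 \<Otimes>\<^sub>M normal1)"
    by (intro measurable_restrict) (use Ri in \<open>simp add: measurable_cong_sets[OF refl sp]\<close>)
  show ?thesis
  proof (rule P.PiM_eqI)
    fix A :: "nat \<Rightarrow> (real \<times> real) set" assume A: "\<And>i. i \<in> {..<d} \<Longrightarrow> A i \<in> sets (normal1 \<Otimes>\<^sub>M normal1)"
    have A' [measurable]: "A i \<in> sets (borel \<Otimes>\<^sub>M borel)" if "i < d" for i using A that sp by auto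
    define S where "S = (\<lambda>p. \<lambda>i\<in>{..<d}. R (fst p i, snd p i)) -` PiE {..<d} A \<inter> space (gauss d \<Otimes>\<^sub>M gauss d)"
    have PA: "PiE {..<d} A \<in> sets (PiM {..<d} (\<lambda>_. normal1 \<Otimes>\<^sub>M normal1))" using A by (intro sets_PiM_I_finite) auto
    have Sm: "S \<in> sets (gauss d \<Otimes>\<^sub>M gauss d)" unfolding S_def by (rule measurable_sets[OF m PA])
    have ind: "indicator S (x, z) = (\<Prod>i<d. indicator (A i) (R (x i, z i)) :: ennreal)" if "x \<in> space (gauss d)" "z \<in> space (gauss d)" for x z
    proof (cases "\<forall>i<d. R (x i, z i) \<in> A i")
      case True
      then have "(x, z) \<in> S" using that by (auto simp: S_def space_pair_measure)
      moreover have "(\<Prod>i<d. indicator (A i) (R (x i, z i)) :: ennreal) = 1" using True by (intro prod.neutral) auto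
      ultimately show ?thesis by simp
    next
      case False
      then obtain i where i: "i < d" "R (x i, z i) \<notin> A i" by blast
      then have "(x, z) \<notin> S" by (auto simp: S_def PiE_iff)
      moreover have "(\<Prod>i<d. indicator (A i) (R (x i, z i)) :: ennreal) = 0"
        using i by (intro prod_zero) (auto intro!: bexI[of _ i])
      ultimately show ?thesis by simp
    qed
    have "emeasure (distr (gauss d \<Otimes>\<^sub>M gauss d) (PiM {..<d} (\<lambda>_. normal1 \<Otimes>\<^sub>M normal1)) (\<lambda>p. \<lambda>i\<in>{..<d}. R (fst p i, snd p i))) (PiE {..<d} A)
       = emeasure (gauss d \<Otimes>\<^sub>M gauss d) S"
      unfolding S_def by (rule emeasure_distr[OF m PA])
    also have "\<dots> = (\<integral>\<^sup>+p. indicator S p \<partial>(gauss d \<Otimes>\<^sub>M gauss d))" using Sm by simp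
    also have "\<dots> = (\<integral>\<^sup>+x. \<integral>\<^sup>+z. indicator S (x, z) \<partial>gauss d \<partial>gauss d)"
      by (rule g.nn_integral_fst[symmetric]) (use Sm in measurable)
    also have "\<dots> = (\<integral>\<^sup>+x. \<integral>\<^sup>+z. (\<Prod>i<d. indicator (A i) (R (x i, z i))) \<partial>gauss d \<partial>gauss d)"
      by (intro nn_integral_cong ind)
    also have "\<dots> = (\<integral>\<^sup>+x. (\<Prod>i<d. \<integral>\<^sup>+z. indicator (A i) (R (x i, z)) \<partial>normal1) \<partial>gauss d)"
      unfolding gauss_def by (intro nn_integral_cong N.product_nn_integral_prod) auto
    also have "\<dots> = (\<Prod>i<d. \<integral>\<^sup>+x. \<integral>\<^sup>+z. indicator (A i) (R (x, z)) \<partial>normal1 \<partial>normal1)"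
      unfolding gauss_def
    proof (rule N.product_nn_integral_prod)
      fix i assume "i \<in> {..<d}"
      then have [measurable]: "A i \<in> sets (borel \<Otimes>\<^sub>M borel)" by (auto intro: A')
      show "(\<lambda>x. \<integral>\<^sup>+z. indicator (A i) (R (x, z)) \<partial>normal1) \<in> borel_measurable normal1"
        by measurable
    qed simp
    also have "\<dots> = (\<Prod>i<d. emeasure (normal1 \<Otimes>\<^sub>M normal1) (A i))"
    proof (intro prod.cong refl)
      fix i assume i: "i \<in> {..<d}"
      have "(\<integral>\<^sup>+x. \<integral>\<^sup>+z. indicator (A i) (R (x, z)) \<partial>normal1 \<partial>normal1) = (\<integral>\<^sup>+x. \<integral>\<^sup>+z. indicator (A i) (x, z) \<partial>normal1 \<partial>normal1)"
        using i by (intro inv A') auto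
      also have "\<dots> = (\<integral>\<^sup>+p. indicator (A i) p \<partial>(normal1 \<Otimes>\<^sub>M normal1))"
        by (rule normal1.nn_integral_fst) (use A[OF i] in measurable)
      also have "\<dots> = emeasure (normal1 \<Otimes>\<^sub>M normal1) (A i)" using A[OF i] by simp
      finally show "(\<integral>\<^sup>+x. \<integral>\<^sup>+z. indicator (A i) (R (x, z)) \<partial>normal1 \<partial>normal1) = emeasure (normal1 \<Otimes>\<^sub>M normal1) (A i)" .
    qed
    finally show "emeasure (distr (gauss d \<Otimes>\<^sub>M gauss d) (PiM {..<d} (\<lambda>_. normal1 \<Otimes>\<^sub>M normal1)) (\<lambda>p. \<lambda>i\<in>{..<d}. R (fst p i, snd p i))) (PiE {..<d} A)
       = (\<Prod>i<d. emeasure (normal1 \<Otimes>\<^sub>M normal1) (A i))" .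
  qed simp_all
qed

lemma measurable_gauss_rot: "gauss_rot d \<rho> \<in> gauss d \<Otimes>\<^sub>M gauss d \<rightarrow>\<^sub>M gauss d \<Otimes>\<^sub>M gauss d"
proof -
  have c: "(\<lambda>p. fst p i) \<in> borel_measurable (gauss d \<Otimes>\<^sub>M gauss d)" "(\<lambda>p. snd p i) \<in> borel_measurable (gauss d \<Otimes>\<^sub>M gauss d)" if "i < d" for i
    using measurable_compose[OF measurable_fst measurable_gauss_component[OF that]]
      measurable_compose[OF measurable_snd measurable_gauss_component[OF that]] by auto
  have r: "(\<lambda>p. \<lambda>i\<in>{..<d}. a * fst p i + b * snd p i) \<in> gauss d \<Otimes>\<^sub>M gauss d \<rightarrow>\<^sub>M gauss d" for a b
  proof -
    have "(\<lambda>p. \<lambda>i\<in>{..<d}. a * fst p i + b * snd p i) \<in> gauss d \<Otimes>\<^sub>M gauss d \<rightarrow>\<^sub>M PiM {..<d} (\<lambda>_. borel)"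
      using c by (intro measurable_restrict borel_measurable_add borel_measurable_times borel_measurable_const) auto
    then show ?thesis by (simp add: measurable_cong_sets[OF refl sets_gauss])
  qed
  have "gauss_rot d \<rho> = (\<lambda>p. (\<lambda>i\<in>{..<d}. \<rho> * fst p i + sqrt (1 - \<rho>\<^sup>2) * snd p i, \<lambda>i\<in>{..<d}. (- sqrt (1 - \<rho>\<^sup>2)) * fst p i + \<rho> * snd p i))"
    by (auto simp: fun_eq_iff gauss_rot_def corr_def)
  then show ?thesis using measurable_Pair[OF r r] by simp
qed

lemma distr_gauss_rot:
  assumes \<rho>: "\<bar>\<rho>\<bar> \<le> 1"
  shows "distr (gauss d \<Otimes>\<^sub>M gauss d) (gauss d \<Otimes>\<^sub>M gauss d) (gauss_rot d \<rho>) = gauss d \<Otimes>\<^sub>M gauss d"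
proof -
  define \<sigma> where "\<sigma> = sqrt (1 - \<rho>\<^sup>2)"
  have "\<rho>\<^sup>2 \<le> 1" using \<rho> by (simp add: abs_square_le_1)
  then have cs: "\<rho>\<^sup>2 + (- \<sigma>)\<^sup>2 = 1" by (simp add: \<sigma>_def)
  define R where "R p = (\<rho> * fst p + \<sigma> * snd p, \<rho> * snd p - \<sigma> * fst p)" for p :: "real \<times> real"
  have R [measurable]: "R \<in> borel \<Otimes>\<^sub>M borel \<rightarrow>\<^sub>M borel \<Otimes>\<^sub>M borel" unfolding R_def by measurable
  have inv: "(\<integral>\<^sup>+x. \<integral>\<^sup>+y. indicator A (R (x, y)) \<partial>normal1 \<partial>normal1) = (\<integral>\<^sup>+x. \<integral>\<^sup>+y. indicator A (x, y) \<partial>normal1 \<partial>normal1)"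
    if [measurable]: "A \<in> sets (borel \<Otimes>\<^sub>M borel)" for A
  proof -
    have "case_prod (\<lambda>x y. indicator A (x, y) :: ennreal) \<in> borel_measurable (borel \<Otimes>\<^sub>M borel)" by measurable
    from nn_integral_rotate_std_gauss[OF this cs] show ?thesis
      unfolding std_gauss_real by (simp add: R_def algebra_simps)
  qed
  let ?\<Gamma> = "PiM {..<d} (\<lambda>_. normal1 \<Otimes>\<^sub>M normal1)" and ?gg = "gauss d \<Otimes>\<^sub>M gauss d"
  define \<Psi> where "\<Psi> q = (\<lambda>i\<in>{..<d}. fst (q i), \<lambda>i\<in>{..<d}. snd (q i))" for q :: "nat \<Rightarrow> real \<times> real"
  have \<Psi>: "\<Psi> \<in> ?\<Gamma> \<rightarrow>\<^sub>M ?gg"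
    unfolding \<Psi>_def[abs_def] gauss_def
  proof (intro measurable_Pair measurable_restrict)
    fix i assume i: "i \<in> {..<d}"
    show "(\<lambda>q. fst (q i)) \<in> ?\<Gamma> \<rightarrow>\<^sub>M normal1"
      by (rule measurable_compose[OF measurable_component_singleton[OF i] measurable_fst])
    show "(\<lambda>q. snd (q i)) \<in> ?\<Gamma> \<rightarrow>\<^sub>M normal1"
      by (rule measurable_compose[OF measurable_component_singleton[OF i] measurable_snd])
  qed
  have comp: "(\<lambda>p. fst p i) \<in> borel_measurable ?gg" "(\<lambda>p. snd p i) \<in> borel_measurable ?gg" if "i < d" for i
    using measurable_compose[OF measurable_fst measurable_gauss_component[OF that]]
      measurable_compose[OF measurable_snd measurable_gauss_component[OF that]] by auto
  have sp: "sets (normal1 \<Otimes>\<^sub>M normal1) = sets (borel \<Otimes>\<^sub>M borel)"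
    by (rule sets_pair_measure_cong) auto
  have pm: "(\<lambda>p. \<lambda>i\<in>{..<d}. Q (fst p i, snd p i)) \<in> ?gg \<rightarrow>\<^sub>M ?\<Gamma>"
    if Q: "Q \<in> borel \<Otimes>\<^sub>M borel \<rightarrow>\<^sub>M borel \<Otimes>\<^sub>M borel" for Q :: "real \<times> real \<Rightarrow> real \<times> real"
  proof (rule measurable_restrict)
    fix i assume "i \<in> {..<d}"
    then have "(\<lambda>p. Q (fst p i, snd p i)) \<in> ?gg \<rightarrow>\<^sub>M borel \<Otimes>\<^sub>M borel"
      using comp[of i] by (intro measurable_compose[OF _ Q] measurable_Pair) auto
    then show "(\<lambda>p. Q (fst p i, snd p i)) \<in> ?gg \<rightarrow>\<^sub>M normal1 \<Otimes>\<^sub>M normal1" by (simp add: measurable_cong_sets[OF refl sp])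
  qed
  have "distr ?gg ?gg (gauss_rot d \<rho>) = distr ?gg ?gg (\<Psi> \<circ> (\<lambda>p. \<lambda>i\<in>{..<d}. R (fst p i, snd p i)))"
    by (intro arg_cong[where f="distr ?gg ?gg"]) (auto simp: fun_eq_iff gauss_rot_def corr_def \<Psi>_def R_def \<sigma>_def)
  also have "\<dots> = distr (distr ?gg ?\<Gamma> (\<lambda>p. \<lambda>i\<in>{..<d}. R (fst p i, snd p i))) ?gg \<Psi>"
    by (rule distr_distr[OF \<Psi> pm[OF R], symmetric])
  also have "\<dots> = distr ?\<Gamma> ?gg \<Psi>" by (simp only: distr_gauss_pairing[OF R inv])
  \<comment> \<open>The regrouping is used once more, now with the identity, to recognise the image
    under \<Psi> as the original product measure.\<close>
  also have "\<dots> = distr (distr ?gg ?\<Gamma> (\<lambda>p. \<lambda>i\<in>{..<d}. (\<lambda>q. q) (fst p i, snd p i))) ?gg \<Psi>"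
    by (subst distr_gauss_pairing) auto
  also have "\<dots> = distr ?gg ?gg (\<Psi> \<circ> (\<lambda>p. \<lambda>i\<in>{..<d}. (\<lambda>q. q) (fst p i, snd p i)))"
    by (rule distr_distr[OF \<Psi> pm]) simp
  also have "\<dots> = distr ?gg ?gg (\<lambda>p. p)"
  proof (rule distr_cong[OF refl refl])
    fix p assume "p \<in> space ?gg"
    then have "fst p \<in> extensional {..<d}" "snd p \<in> extensional {..<d}"
      by (auto simp: space_pair_measure gauss_def space_PiM PiE_def)
    then have "(\<lambda>i\<in>{..<d}. fst p i) = fst p" "(\<lambda>i\<in>{..<d}. snd p i) = snd p" by (auto simp: extensional_restrict)
    moreover have "(\<Psi> \<circ> (\<lambda>p. \<lambda>i\<in>{..<d}. (\<lambda>q. q) (fst p i, snd p i))) p = (\<lambda>i\<in>{..<d}. fst p i, \<lambda>i\<in>{..<d}. snd p i)"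
      by (auto simp: \<Psi>_def restrict_def fun_eq_iff)
    ultimately show "(\<Psi> \<circ> (\<lambda>p. \<lambda>i\<in>{..<d}. (\<lambda>q. q) (fst p i, snd p i))) p = p" by simp
  qed
  also have "\<dots> = ?gg" by (rule distr_id2) simp
  finally show ?thesis .
qed

section \<open>Moments of the Gaussian norm\<close>

lemma integrable_normal1_power: "integrable normal1 (\<lambda>t. t ^ k)"
  by (subst integrable_real_density) (auto simp: integrable_std_normal_moment)

lemma integral_normal1: "f \<in> borel_measurable borel \<Longrightarrow> (\<integral>t. f t \<partial>normal1) = (\<integral>t. std_normal_density t * f t \<partial>lborel)"
  by (subst integral_real_density) auto

lemma normal1_moments:
  "(\<integral>t. t ^ 0 \<partial>normal1) = 1" "(\<integral>t. t ^ 1 \<partial>normal1) = 0" "(\<integral>t. t ^ 2 \<partial>normal1) = 1" "(\<integral>t. t ^ 4 \<partial>normal1) = 3"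
proof -
  show "(\<integral>t. t ^ 0 \<partial>normal1) = 1" using normal1.prob_space by simp
  show "(\<integral>t. t ^ 1 \<partial>normal1) = 0"
    using integral_std_normal_moment_odd[of 0] by (subst integral_normal1) auto
  show "(\<integral>t. t ^ 2 \<partial>normal1) = 1"
    using integral_std_normal_moment_even[of 1] by (subst integral_normal1) (auto simp: fact_numeral)
  show "(\<integral>t. t ^ 4 \<partial>normal1) = 3"
    using integral_std_normal_moment_even[of 2] by (subst integral_normal1) (auto simp: fact_numeral)
qed

lemma gauss_monomial:
  fixes a :: "nat \<Rightarrow> nat"
  shows "integrable (gauss d) (\<lambda>x. \<Prod>k<d. x k ^ a k)"
    and "(\<integral>x. (\<Prod>k<d. x k ^ a k) \<partial>gauss d) = (\<Prod>k<d. \<integral>t. t ^ a k \<partial>normal1)"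
proof -
  interpret N: product_sigma_finite "\<lambda>_::nat. normal1" by (rule product_sigma_finite_normal1)
  show "integrable (gauss d) (\<lambda>x. \<Prod>k<d. x k ^ a k)"
    unfolding gauss_def by (rule N.product_integrable_prod) (auto simp: integrable_normal1_power)
  show "(\<integral>x. (\<Prod>k<d. x k ^ a k) \<partial>gauss d) = (\<Prod>k<d. \<integral>t. t ^ a k \<partial>normal1)"
    unfolding gauss_def by (rule N.product_integral_prod) (auto simp: integrable_normal1_power)
qed

lemma gauss_component_power:
  assumes i: "i < d"
  shows "integrable (gauss d) (\<lambda>x. x i ^ m)" "(\<integral>x. x i ^ m \<partial>gauss d) = (\<integral>t. t ^ m \<partial>normal1)"
proof -
  have e: "(\<Prod>k<d. f k (if k = i then m else 0)) = f i m" if "\<And>k. f k 0 = 1" for f :: "nat \<Rightarrow> nat \<Rightarrow> real"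
  proof -
    have "(\<Prod>k<d. f k (if k = i then m else 0)) = (\<Prod>k\<in>{i}. f k (if k = i then m else 0))"
      using i that by (intro prod.mono_neutral_right) auto
    then show ?thesis by simp
  qed
  have e1: "(\<Prod>k<d. x k ^ (if k = i then m else 0)) = x i ^ m" for x :: "nat \<Rightarrow> real"
    by (rule e[of "\<lambda>k n. x k ^ n"]) simp
  show "integrable (gauss d) (\<lambda>x. x i ^ m)"
    using gauss_monomial(1)[of d "\<lambda>k. if k = i then m else 0"] unfolding e1 .
  show "(\<integral>x. x i ^ m \<partial>gauss d) = (\<integral>t. t ^ m \<partial>normal1)"
    using gauss_monomial(2)[of d "\<lambda>k. if k = i then m else 0"] e[of "\<lambda>k n. \<integral>t. t ^ n \<partial>normal1"] normal1_moments(1)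
    unfolding e1 by simp
qed

lemma gauss_sq_sq:
  assumes i: "i < d" "j < d"
  shows "integrable (gauss d) (\<lambda>x. (x i)\<^sup>2 * (x j)\<^sup>2)" "(\<integral>x. (x i)\<^sup>2 * (x j)\<^sup>2 \<partial>gauss d) = (if i = j then 3 else 1)"
proof -
  have "integrable (gauss d) (\<lambda>x. (x i)\<^sup>2 * (x j)\<^sup>2) \<and> (\<integral>x. (x i)\<^sup>2 * (x j)\<^sup>2 \<partial>gauss d) = (if i = j then 3 else 1)"
  proof (cases "i = j")
    case True
    have "(x i)\<^sup>2 * (x j)\<^sup>2 = x i ^ 4" for x :: "nat \<Rightarrow> real" using True by (simp flip: power_add)
    then show ?thesis using True gauss_component_power[OF i(1), of 4] normal1_moments(4) by simp
  next
    case False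
    define a where "a k = (if k = i \<or> k = j then 2 else 0 :: nat)" for k
    have e: "(\<Prod>k<d. f k (a k)) = f i 2 * f j 2" if "\<And>k. f k 0 = 1" for f :: "nat \<Rightarrow> nat \<Rightarrow> real"
    proof -
      have "(\<Prod>k<d. f k (a k)) = (\<Prod>k\<in>{i, j}. f k (a k))"
        using i that by (intro prod.mono_neutral_right) (auto simp: a_def)
      then show ?thesis using False by (simp add: a_def)
    qed
    have e1: "(\<Prod>k<d. x k ^ a k) = (x i)\<^sup>2 * (x j)\<^sup>2" for x :: "nat \<Rightarrow> real"
      by (rule e[of "\<lambda>k n. x k ^ n"]) simp
    have "integrable (gauss d) (\<lambda>x. (x i)\<^sup>2 * (x j)\<^sup>2)" using gauss_monomial(1)[of d a] unfolding e1 .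
    moreover have "(\<integral>x. (x i)\<^sup>2 * (x j)\<^sup>2 \<partial>gauss d) = 1"
      using gauss_monomial(2)[of d a] e[of "\<lambda>k n. \<integral>t. t ^ n \<partial>normal1"] normal1_moments(1,3) unfolding e1 by simp
    ultimately show ?thesis using False by simp
  qed
  then show "integrable (gauss d) (\<lambda>x. (x i)\<^sup>2 * (x j)\<^sup>2)" "(\<integral>x. (x i)\<^sup>2 * (x j)\<^sup>2 \<partial>gauss d) = (if i = j then 3 else 1)" by auto
qed

definition nrm :: "nat \<Rightarrow> (nat \<Rightarrow> real) \<Rightarrow> real" where
  "nrm d x = sqrt (\<Sum>i<d. (x i)\<^sup>2)"

lemma nrm_nonneg: "0 \<le> nrm d x" by (simp add: nrm_def sum_nonneg)

lemma nrm_sq: "(nrm d x)\<^sup>2 = (\<Sum>i<d. (x i)\<^sup>2)" by (simp add: nrm_def sum_nonneg)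

lemma gauss_nrm_sq: "integrable (gauss d) (\<lambda>x. (nrm d x)\<^sup>2)" "(\<integral>x. (nrm d x)\<^sup>2 \<partial>gauss d) = real d"
proof -
  show "integrable (gauss d) (\<lambda>x. (nrm d x)\<^sup>2)"
    unfolding nrm_sq by (intro Bochner_Integration.integrable_sum gauss_component_power) simp
  have "(\<integral>x. (\<Sum>i<d. (x i)\<^sup>2) \<partial>gauss d) = (\<Sum>i<d. \<integral>x. (x i)\<^sup>2 \<partial>gauss d)"
    by (intro Bochner_Integration.integral_sum gauss_component_power) simp
  also have "\<dots> = (\<Sum>i<d. 1)"
    using gauss_component_power(2)[of _ d 2] normal1_moments(3) by (intro sum.cong) auto
  finally show "(\<integral>x. (nrm d x)\<^sup>2 \<partial>gauss d) = real d" unfolding nrm_sq by simp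
qed

text \<open>Diagonal terms have mean 3 and the others 1, giving 3d + d(d - 1).\<close>

lemma gauss_nrm_4: "integrable (gauss d) (\<lambda>x. (nrm d x) ^ 4)" "(\<integral>x. (nrm d x) ^ 4 \<partial>gauss d) = real d * (real d + 2)"
proof -
  have e: "(nrm d x) ^ 4 = (\<Sum>i<d. \<Sum>j<d. (x i)\<^sup>2 * (x j)\<^sup>2)" for x
  proof -
    have "(nrm d x) ^ 4 = (nrm d x)\<^sup>2 * (nrm d x)\<^sup>2" by (simp flip: power_add)
    then show ?thesis by (simp only: nrm_sq sum_product)
  qed
  show "integrable (gauss d) (\<lambda>x. (nrm d x) ^ 4)" unfolding e
    by (intro Bochner_Integration.integrable_sum gauss_sq_sq) auto
  have "(\<integral>x. (nrm d x) ^ 4 \<partial>gauss d) = (\<Sum>i<d. \<Sum>j<d. if i = j then 3 else 1)"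
  proof -
    have "(\<integral>x. (\<Sum>i<d. \<Sum>j<d. (x i)\<^sup>2 * (x j)\<^sup>2) \<partial>gauss d) = (\<Sum>i<d. \<integral>x. (\<Sum>j<d. (x i)\<^sup>2 * (x j)\<^sup>2) \<partial>gauss d)"
      by (intro Bochner_Integration.integral_sum Bochner_Integration.integrable_sum gauss_sq_sq) auto
    also have "\<dots> = (\<Sum>i<d. \<Sum>j<d. \<integral>x. (x i)\<^sup>2 * (x j)\<^sup>2 \<partial>gauss d)"
      by (intro sum.cong refl Bochner_Integration.integral_sum gauss_sq_sq) auto
    also have "\<dots> = (\<Sum>i<d. \<Sum>j<d. if i = j then 3 else 1)"
      by (intro sum.cong refl gauss_sq_sq) auto
    finally show ?thesis unfolding e .
  qed
  also have "\<dots> = (\<Sum>i<d. \<Sum>j<d. (if i = j then 2 else 0) + (1::real))" by (intro sum.cong) auto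
  also have "\<dots> = real d * (real d + 2)" by (simp add: sum.distrib algebra_simps)
  finally show "(\<integral>x. (nrm d x) ^ 4 \<partial>gauss d) = real d * (real d + 2)" .
qed

lemma measurable_nrm [measurable]: "nrm d \<in> borel_measurable (gauss d)"
proof -
  have "(\<lambda>x. sqrt (\<Sum>i<d. (x i)\<^sup>2)) \<in> borel_measurable (gauss d)"
    by (intro measurable_compose[OF _ borel_measurable_sqrt] borel_measurable_sum borel_measurable_power measurable_gauss_component) auto
  then show ?thesis by (simp add: nrm_def[abs_def])
qed

text \<open>The lower bound integrates the quartic minorant (3q^2 - q^4)/2 \<le> q for q \<ge> 0,
  tangent at q = 1. The scale s with s^2 = d + 2, the ratio of the fourth to the second moment, is
  the optimal place for the tangency.\<close>

lemma gauss_nrm: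
  shows "integrable (gauss d) (nrm d)" "real d / sqrt (real d + 2) \<le> (\<integral>x. nrm d x \<partial>gauss d)"
proof -
  interpret g: prob_space "gauss d" by (rule prob_space_gauss)
  show i: "integrable (gauss d) (nrm d)"
  proof (rule Bochner_Integration.integrable_bound[of _ "\<lambda>x. 1 + (nrm d x)\<^sup>2"])
    show "integrable (gauss d) (\<lambda>x. 1 + (nrm d x)\<^sup>2)" using gauss_nrm_sq(1) by simp
    have "nrm d x \<le> 1 + (nrm d x)\<^sup>2" for x
      using zero_le_power2[of "nrm d x - 1"] nrm_nonneg[of d x] by (simp add: power2_diff)
    then show "AE x in gauss d. norm (nrm d x) \<le> norm (1 + (nrm d x)\<^sup>2)"
      using nrm_nonneg by (intro AE_I2) (auto simp: abs_of_nonneg)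
  qed measurable
  define s where "s = sqrt (real d + 2)"
  have s: "s > 0" "s\<^sup>2 = real d + 2" by (auto simp: s_def)
  have pt: "3 / (2 * s) * (nrm d x)\<^sup>2 - 1 / (2 * s ^ 3) * (nrm d x) ^ 4 \<le> nrm d x" for x
  proof -
    define q where "q = nrm d x / s"
    have q: "q \<ge> 0" "nrm d x = q * s" using nrm_nonneg[of d x] s by (auto simp: q_def)
    have "0 \<le> q * ((q - 1)\<^sup>2 * (q + 2))" using q by auto
    also have "q * ((q - 1)\<^sup>2 * (q + 2)) = q ^ 4 - 3 * q\<^sup>2 + 2 * q"
      by (simp add: power2_eq_square power4_eq_xxxx algebra_simps)
    finally have "3 * q\<^sup>2 - q ^ 4 \<le> 2 * q" by simp
    then have "(3 * q\<^sup>2 - q ^ 4) * (s / 2) \<le> 2 * q * (s / 2)" using s by (intro mult_right_mono) auto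
    also have "(3 * q\<^sup>2 - q ^ 4) * (s / 2) = 3 / (2 * s) * (q * s)\<^sup>2 - 1 / (2 * s ^ 3) * (q * s) ^ 4"
      using s(1) by (simp add: power_mult_distrib field_simps power2_eq_square power3_eq_cube power4_eq_xxxx)
    finally show ?thesis unfolding q(2) by simp
  qed
  have "(\<integral>x. 3 / (2 * s) * (nrm d x)\<^sup>2 - 1 / (2 * s ^ 3) * (nrm d x) ^ 4 \<partial>gauss d) \<le> (\<integral>x. nrm d x \<partial>gauss d)"
    using gauss_nrm_sq(1) gauss_nrm_4(1) by (intro integral_mono i pt) auto
  moreover have "(\<integral>x. 3 / (2 * s) * (nrm d x)\<^sup>2 - 1 / (2 * s ^ 3) * (nrm d x) ^ 4 \<partial>gauss d) =
     3 / (2 * s) * real d - 1 / (2 * s ^ 3) * (real d * (real d + 2))"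
    using gauss_nrm_sq gauss_nrm_4 by simp
  moreover have "3 / (2 * s) * real d - 1 / (2 * s ^ 3) * (real d * (real d + 2)) = real d / s"
    unfolding s(2)[symmetric] using s(1) by (simp add: field_simps power2_eq_square power3_eq_cube)
  ultimately show "real d / sqrt (real d + 2) \<le> (\<integral>x. nrm d x \<partial>gauss d)" by (simp add: s_def)
qed

text \<open>Subtracting the linear part \<open>c x\<close> from the radial field makes the remainder small in
  \<open>L\<^sup>2\<close>, while the linear part contributes exactly \<open>\<rho>\<close>.\<close>

lemma radial_stability_le:
  fixes h :: "(nat \<Rightarrow> real) \<Rightarrow> nat \<Rightarrow> real"
  assumes \<rho>: "\<bar>\<rho>\<bar> \<le> 1" and d: "d > 0"
    and hm: "\<And>i. i < d \<Longrightarrow> (\<lambda>x. h x i) \<in> borel_measurable (gauss d)"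
    and h1: "\<And>x. (\<Sum>i<d. (h x i)\<^sup>2) \<le> 1"
    and hx: "\<And>x. (\<Sum>i<d. h x i * x i) = nrm d x"
  shows "(\<integral>p. (\<Sum>i<d. h (fst p) i * h (corr d \<rho> (fst p) (snd p)) i) \<partial>(gauss d \<Otimes>\<^sub>M gauss d)) \<le> \<rho> + 2 * (1 - \<rho>) / (real d + 2)"
proof -
  let ?M = "gauss d \<Otimes>\<^sub>M gauss d"
  interpret g: prob_space "gauss d" by (rule prob_space_gauss)
  interpret gg: pair_prob_space "gauss d" "gauss d" ..
  have fst_int: "integrable ?M (\<lambda>p. f (fst p))" "(\<integral>p. f (fst p) \<partial>?M) = (\<integral>x. f x \<partial>gauss d)"
    if f: "integrable (gauss d) f" for f :: "(nat \<Rightarrow> real) \<Rightarrow> real"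
  proof -
    have D: "distr ?M (gauss d) fst = gauss d" by (rule g.distr_pair_fst)
    show "integrable ?M (\<lambda>p. f (fst p))" by (rule integrable_distr[OF measurable_fst]) (simp add: D f)
    show "(\<integral>p. f (fst p) \<partial>?M) = (\<integral>x. f x \<partial>gauss d)"
      using integral_distr[OF measurable_fst, of f "gauss d" "gauss d"] f by (simp add: D)
  qed
  have rot: "integrable ?M (\<lambda>p. F (gauss_rot d r p))" "(\<integral>p. F (gauss_rot d r p) \<partial>?M) = (\<integral>p. F p \<partial>?M)"
    if F: "integrable ?M F" and r: "\<bar>r\<bar> \<le> 1" for F :: "(nat \<Rightarrow> real) \<times> (nat \<Rightarrow> real) \<Rightarrow> real" and r
  proof -
    note D = distr_gauss_rot[OF r, of d]
    show "integrable ?M (\<lambda>p. F (gauss_rot d r p))" by (rule integrable_distr[OF measurable_gauss_rot]) (simp add: D F)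
    show "(\<integral>p. F (gauss_rot d r p) \<partial>?M) = (\<integral>p. F p \<partial>?M)"
      using integral_distr[OF measurable_gauss_rot, of F d r] F by (simp add: D)
  qed
  define \<sigma> where "\<sigma> = sqrt (1 - \<rho>\<^sup>2)"
  have "\<rho>\<^sup>2 \<le> 1" using \<rho> by (simp add: abs_square_le_1)
  then have cs: "\<rho> * \<rho> + \<sigma> * \<sigma> = 1" by (simp add: \<sigma>_def power2_eq_square)
  define y where "y p = corr d \<rho> (fst p) (snd p)" for p
  have y: "y p i = \<rho> * fst p i + \<sigma> * snd p i" if "i < d" for p i using that by (simp add: y_def corr_def \<sigma>_def)
  have y_rot: "y p = fst (gauss_rot d \<rho> p)" for p by (simp add: y_def gauss_rot_def)
  have z_int: "integrable ?M (\<lambda>p. (snd p i)\<^sup>2)" "integrable ?M (\<lambda>p. snd p i)" if i: "i < d" for i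
  proof -
    \<comment> \<open>A quarter turn carries integrability from x over to z.\<close>
    have z: "fst (gauss_rot d 0 p) i = snd p i" for p using i by (simp add: gauss_rot_def corr_def)
    have "integrable (gauss d) (\<lambda>x. x i)" using gauss_component_power(1)[OF i, of 1] by simp
    from rot(1)[OF fst_int(1)[OF this], of 0] show "integrable ?M (\<lambda>p. snd p i)" by (simp add: z)
    from rot(1)[OF fst_int(1)[OF gauss_component_power(1)[OF i, of 2]], of 0]
    show "integrable ?M (\<lambda>p. (snd p i)\<^sup>2)" by (simp add: z)
  qed
  have x_int: "integrable ?M (\<lambda>p. fst p i)" "integrable ?M (\<lambda>p. (fst p i)\<^sup>2)" "(\<integral>p. (fst p i)\<^sup>2 \<partial>?M) = 1" if i: "i < d" for i
    using fst_int[OF gauss_component_power(1)[OF i, of 1]] fst_int[OF gauss_component_power(1)[OF i, of 2]]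
      gauss_component_power(2)[OF i, of 2] normal1_moments(3) by simp_all
  have hb: "\<bar>h x i\<bar> \<le> 1" if "i < d" for x i
  proof -
    have "(h x i)\<^sup>2 \<le> (\<Sum>i<d. (h x i)\<^sup>2)" using that by (intro member_le_sum) auto
    then have "(h x i)\<^sup>2 \<le> 1" using h1[of x] by simp
    then show ?thesis by (simp add: abs_square_le_1)
  qed
  have hM: "(\<lambda>p. h (fst p) i) \<in> borel_measurable ?M" if "i < d" for i
    by (rule measurable_compose[OF measurable_fst hm[OF that]])
  have hyM: "(\<lambda>p. h (y p) i) \<in> borel_measurable ?M" if "i < d" for i
    unfolding y_rot by (rule measurable_compose[OF measurable_gauss_rot hM[OF that]])
  have hbd: "integrable ?M (\<lambda>p. h (fst p) i * f p)" if i: "i < d" and f: "integrable ?M f" for f i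
  proof (rule Bochner_Integration.integrable_bound[OF f])
    show "(\<lambda>p. h (fst p) i * f p) \<in> borel_measurable ?M" using hM[OF i] f by auto
    show "AE p in ?M. norm (h (fst p) i * f p) \<le> norm (f p)"
      using hb[OF i] by (intro AE_I2) (simp add: abs_mult mult_left_le_one_le)
  qed
  have zmean: "(\<integral>z. z i \<partial>gauss d) = 0" if "i < d" for i
    using gauss_component_power(2)[OF that, of 1] normal1_moments(2) by simp
  have hz: "(\<integral>p. h (fst p) i * snd p i \<partial>?M) = 0" if i: "i < d" for i
  proof -
    have "(\<integral>p. h (fst p) i * snd p i \<partial>?M) = (\<integral>x. (\<integral>z. h x i * z i \<partial>gauss d) \<partial>gauss d)"
      using gg.integral_fst'[OF hbd[OF i z_int(2)[OF i]]] by simp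
    then show ?thesis by (simp add: zmean[OF i])
  qed
  have xz: "integrable ?M (\<lambda>p. fst p i * snd p i)" "(\<integral>p. fst p i * snd p i \<partial>?M) = 0" if i: "i < d" for i
  proof -
    show I: "integrable ?M (\<lambda>p. fst p i * snd p i)"
    proof (rule Bochner_Integration.integrable_bound[of _ "\<lambda>p. (fst p i)\<^sup>2 + (snd p i)\<^sup>2"])
      show "integrable ?M (\<lambda>p. (fst p i)\<^sup>2 + (snd p i)\<^sup>2)" using x_int(2)[OF i] z_int(1)[OF i] by simp
      show "(\<lambda>p. fst p i * snd p i) \<in> borel_measurable ?M" using x_int(1)[OF i] z_int(2)[OF i] by auto
      have "\<bar>a * b\<bar> \<le> a\<^sup>2 + b\<^sup>2" for a b :: real
        using sum_squares_bound[of "\<bar>a\<bar>" "\<bar>b\<bar>"] abs_ge_zero[of "a * b"] unfolding abs_mult power2_abs by linarith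
      then show "AE p in ?M. norm (fst p i * snd p i) \<le> norm ((fst p i)\<^sup>2 + (snd p i)\<^sup>2)"
        by (intro AE_I2) (simp add: abs_of_nonneg)
    qed
    have "(\<integral>p. fst p i * snd p i \<partial>?M) = (\<integral>x. (\<integral>z. x i * z i \<partial>gauss d) \<partial>gauss d)"
      using gg.integral_fst'[OF I] by simp
    then show "(\<integral>p. fst p i * snd p i \<partial>?M) = 0" by (simp add: zmean[OF i])
  qed
  define m where "m = (\<integral>x. nrm d x \<partial>gauss d)"
  have hxx: "integrable ?M (\<lambda>p. h (fst p) i * fst p i)" if "i < d" for i by (rule hbd[OF that x_int(1)[OF that]])
  have sum_hx: "(\<Sum>i<d. \<integral>p. h (fst p) i * fst p i \<partial>?M) = m"
  proof -
    have "(\<Sum>i<d. \<integral>p. h (fst p) i * fst p i \<partial>?M) = (\<integral>p. (\<Sum>i<d. h (fst p) i * fst p i) \<partial>?M)"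
      using hxx by (subst Bochner_Integration.integral_sum) auto
    then show ?thesis unfolding hx m_def using fst_int(2)[OF gauss_nrm(1)] by simp
  qed
  have A: "integrable ?M (\<lambda>p. \<Sum>i<d. h (fst p) i * y p i)" "(\<integral>p. (\<Sum>i<d. h (fst p) i * y p i) \<partial>?M) = \<rho> * m"
  proof -
    have e: "(\<Sum>i<d. h (fst p) i * y p i) = (\<Sum>i<d. \<rho> * (h (fst p) i * fst p i) + \<sigma> * (h (fst p) i * snd p i))" for p
      by (intro sum.cong refl) (simp add: y algebra_simps)
    have t: "integrable ?M (\<lambda>p. \<rho> * (h (fst p) i * fst p i) + \<sigma> * (h (fst p) i * snd p i))" if "i < d" for i
      using hxx[OF that] hbd[OF that z_int(2)[OF that]] by simp
    show "integrable ?M (\<lambda>p. \<Sum>i<d. h (fst p) i * y p i)" unfolding e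
      by (intro Bochner_Integration.integrable_sum t) simp
    have "(\<integral>p. (\<Sum>i<d. h (fst p) i * y p i) \<partial>?M) = (\<Sum>i<d. \<rho> * (\<integral>p. h (fst p) i * fst p i \<partial>?M))"
      unfolding e using t hxx hbd z_int(2) by (subst Bochner_Integration.integral_sum) (auto simp: hz)
    then show "(\<integral>p. (\<Sum>i<d. h (fst p) i * y p i) \<partial>?M) = \<rho> * m" by (simp add: sum_distrib_left[symmetric] sum_hx)
  qed
  have B: "integrable ?M (\<lambda>p. \<Sum>i<d. fst p i * h (y p) i)" "(\<integral>p. (\<Sum>i<d. fst p i * h (y p) i) \<partial>?M) = \<rho> * m"
  proof -
    \<comment> \<open>The rotation is undone here: if (y, z') is the rotated pair, then \<rho> y -
      \<sigma> z' = x. So F at the rotated pair is the inner product of x with h(y), and its mean is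
      that of F itself.\<close>
    define F where "F p = (\<Sum>i<d. \<rho> * (h (fst p) i * fst p i) - \<sigma> * (h (fst p) i * snd p i))" for p
    have t: "integrable ?M (\<lambda>p. \<rho> * (h (fst p) i * fst p i) - \<sigma> * (h (fst p) i * snd p i))" if "i < d" for i
      using hxx[OF that] hbd[OF that z_int(2)[OF that]] by simp
    have FI: "integrable ?M F" unfolding F_def
      by (intro Bochner_Integration.integrable_sum t) simp
    have "(\<integral>p. F p \<partial>?M) = (\<Sum>i<d. \<rho> * (\<integral>p. h (fst p) i * fst p i \<partial>?M))"
      unfolding F_def using t hxx hbd z_int(2) by (subst Bochner_Integration.integral_sum) (auto simp: hz)
    then have FE: "(\<integral>p. F p \<partial>?M) = \<rho> * m" by (simp add: sum_distrib_left[symmetric] sum_hx)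
    have e: "F (gauss_rot d \<rho> p) = (\<Sum>i<d. fst p i * h (y p) i)" for p
      unfolding F_def
    proof (intro sum.cong refl)
      fix i assume "i \<in> {..<d}"
      then have i: "i < d" by simp
      have s: "snd (gauss_rot d \<rho> p) i = \<rho> * snd p i - \<sigma> * fst p i" using i by (simp add: gauss_rot_def \<sigma>_def)
      have "\<rho> * (\<rho> * fst p i + \<sigma> * snd p i) - \<sigma> * (\<rho> * snd p i - \<sigma> * fst p i) = (\<rho> * \<rho> + \<sigma> * \<sigma>) * fst p i"
        by (simp add: algebra_simps)
      then have "\<rho> * y p i - \<sigma> * snd (gauss_rot d \<rho> p) i = fst p i" by (simp add: cs s y[OF i])
      then show "\<rho> * (h (fst (gauss_rot d \<rho> p)) i * fst (gauss_rot d \<rho> p) i) - \<sigma> * (h (fst (gauss_rot d \<rho> p)) i * snd (gauss_rot d \<rho> p) i) = fst p i * h (y p) i"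
        unfolding y_rot[symmetric] by (metis (no_types, opaque_lifting) mult.commute mult.left_commute right_diff_distrib)
    qed
    show "integrable ?M (\<lambda>p. \<Sum>i<d. fst p i * h (y p) i)" using rot(1)[OF FI \<rho>] unfolding e .
    show "(\<integral>p. (\<Sum>i<d. fst p i * h (y p) i) \<partial>?M) = \<rho> * m" using rot(2)[OF FI \<rho>] unfolding e FE .
  qed
  have Cc: "integrable ?M (\<lambda>p. \<Sum>i<d. fst p i * y p i)" "(\<integral>p. (\<Sum>i<d. fst p i * y p i) \<partial>?M) = \<rho> * real d"
  proof -
    have e: "(\<Sum>i<d. fst p i * y p i) = (\<Sum>i<d. \<rho> * (fst p i)\<^sup>2 + \<sigma> * (fst p i * snd p i))" for p
      by (intro sum.cong refl) (simp add: y algebra_simps power2_eq_square)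
    have t: "integrable ?M (\<lambda>p. \<rho> * (fst p i)\<^sup>2 + \<sigma> * (fst p i * snd p i))" if "i < d" for i
      using x_int(2)[OF that] xz(1)[OF that] by simp
    show "integrable ?M (\<lambda>p. \<Sum>i<d. fst p i * y p i)" unfolding e
      by (intro Bochner_Integration.integrable_sum t) simp
    show "(\<integral>p. (\<Sum>i<d. fst p i * y p i) \<partial>?M) = \<rho> * real d"
      unfolding e using t x_int xz by (subst Bochner_Integration.integral_sum) auto
  qed
  have N: "integrable ?M (\<lambda>p. nrm d (fst p))" "(\<integral>p. nrm d (fst p) \<partial>?M) = m"
    "integrable ?M (\<lambda>p. (nrm d (fst p))\<^sup>2)" "(\<integral>p. (nrm d (fst p))\<^sup>2 \<partial>?M) = real d"
    using fst_int[OF gauss_nrm(1)] fst_int[OF gauss_nrm_sq(1)] gauss_nrm_sq(2) by (auto simp: m_def)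
  have Ny: "integrable ?M (\<lambda>p. nrm d (y p))" "(\<integral>p. nrm d (y p) \<partial>?M) = m"
    "integrable ?M (\<lambda>p. (nrm d (y p))\<^sup>2)" "(\<integral>p. (nrm d (y p))\<^sup>2 \<partial>?M) = real d"
    using rot[OF N(1) \<rho>] rot[OF N(3) \<rho>] N(2,4) unfolding y_rot by auto
  \<comment> \<open>The coefficient that minimises 1 - 2 c m + c^2 d, the bound for the mean square
    of h(x) - c x.\<close>
  define c where "c = m / real d"
  \<comment> \<open>An integrable majorant: the product of the two remainders is replaced by half
    the sum of their squares, and the terms linear in x or y are kept exactly.\<close>
  define U where "U p = 1 - c * nrm d (fst p) - c * nrm d (y p) + c\<^sup>2 / 2 * (nrm d (fst p))\<^sup>2 + c\<^sup>2 / 2 * (nrm d (y p))\<^sup>2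
      + c * (\<Sum>i<d. h (fst p) i * y p i) + c * (\<Sum>i<d. fst p i * h (y p) i) - c\<^sup>2 * (\<Sum>i<d. fst p i * y p i)" for p
  have pt: "(\<Sum>i<d. h (fst p) i * h (y p) i) \<le> U p" for p
  proof -
    define a where "a i = h (fst p) i - c * fst p i" for i
    define b where "b i = h (y p) i - c * y p i" for i
    have sq: "(\<Sum>i<d. (h x i - c * x i)\<^sup>2) \<le> 1 - 2 * c * nrm d x + c\<^sup>2 * (nrm d x)\<^sup>2" for x
    proof -
      have "(\<Sum>i<d. (h x i - c * x i)\<^sup>2) = (\<Sum>i<d. (h x i)\<^sup>2) - 2 * c * (\<Sum>i<d. h x i * x i) + c\<^sup>2 * (\<Sum>i<d. (x i)\<^sup>2)"
        unfolding sum_distrib_left sum_subtractf[symmetric] sum.distrib[symmetric]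
        by (intro sum.cong refl) (simp add: power2_eq_square algebra_simps)
      then show ?thesis using h1[of x] by (simp add: hx nrm_sq)
    qed
    have "(\<Sum>i<d. a i * b i) \<le> (\<Sum>i<d. ((a i)\<^sup>2 + (b i)\<^sup>2) / 2)"
      using sum_squares_bound[of "a _" "b _"] by (intro sum_mono) (simp add: field_simps)
    also have "\<dots> = (\<Sum>i<d. (a i)\<^sup>2) / 2 + (\<Sum>i<d. (b i)\<^sup>2) / 2"
      by (simp add: sum.distrib add_divide_distrib sum_divide_distrib)
    also have "\<dots> \<le> (1 - 2 * c * nrm d (fst p) + c\<^sup>2 * (nrm d (fst p))\<^sup>2) / 2 + (1 - 2 * c * nrm d (y p) + c\<^sup>2 * (nrm d (y p))\<^sup>2) / 2"
      unfolding a_def b_def by (intro add_mono divide_right_mono sq) auto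
    finally have ab: "(\<Sum>i<d. a i * b i) \<le> 1 - c * nrm d (fst p) - c * nrm d (y p) + c\<^sup>2 / 2 * (nrm d (fst p))\<^sup>2 + c\<^sup>2 / 2 * (nrm d (y p))\<^sup>2"
      by (simp add: field_simps)
    have "(\<Sum>i<d. h (fst p) i * h (y p) i) = (\<Sum>i<d. a i * b i) + c * (\<Sum>i<d. h (fst p) i * y p i)
        + c * (\<Sum>i<d. fst p i * h (y p) i) - c\<^sup>2 * (\<Sum>i<d. fst p i * y p i)"
      unfolding sum_distrib_left sum_subtractf[symmetric] sum.distrib[symmetric] a_def b_def
      by (intro sum.cong refl) (simp add: power2_eq_square algebra_simps)
    then show ?thesis using ab unfolding U_def by linarith
  qed
  have UI: "integrable ?M U" unfolding U_def using A(1) B(1) Cc(1) N(1,3) Ny(1,3) by simp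
  have UE: "(\<integral>p. U p \<partial>?M) = 1 - (1 - \<rho>) * (2 * c * m - c\<^sup>2 * real d)"
    unfolding U_def using A B Cc N Ny by (simp add: gg.prob_space algebra_simps)
  have "(\<integral>p. (\<Sum>i<d. h (fst p) i * h (y p) i) \<partial>?M) \<le> (\<integral>p. U p \<partial>?M)"
  proof (rule integral_mono[OF _ UI])
    show "integrable ?M (\<lambda>p. \<Sum>i<d. h (fst p) i * h (y p) i)"
    proof (intro Bochner_Integration.integrable_sum hbd)
      fix i assume "i \<in> {..<d}"
      then have i: "i < d" by simp
      show "integrable ?M (\<lambda>p. h (y p) i)"
        by (rule gg.integrable_const_bound[of _ 1, OF _ hyM[OF i]]) (use hb[OF i] in auto)
    qed auto
  qed (rule pt)
  also have "\<dots> = 1 - (1 - \<rho>) * (m\<^sup>2 / real d)"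
    unfolding UE c_def using d by (simp add: power2_eq_square)
  also have "\<dots> \<le> 1 - (1 - \<rho>) * (real d / (real d + 2))"
  proof -
    have "(real d / sqrt (real d + 2))\<^sup>2 \<le> m\<^sup>2" unfolding m_def by (rule power_mono[OF gauss_nrm(2)]) simp
    then have "(real d)\<^sup>2 / (real d + 2) \<le> m\<^sup>2" by (simp add: power_divide)
    then have "(real d)\<^sup>2 / (real d + 2) / real d \<le> m\<^sup>2 / real d" using d by (intro divide_right_mono) auto
    moreover have "(real d)\<^sup>2 / (real d + 2) / real d = real d / (real d + 2)" using d by (simp add: power2_eq_square)
    ultimately have "real d / (real d + 2) \<le> m\<^sup>2 / real d" by simp
    then show ?thesis using \<rho> by (intro diff_left_mono mult_left_mono) auto
  qed
  also have "\<dots> = \<rho> + 2 * (1 - \<rho>) / (real d + 2)" by (simp add: field_simps)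
  finally show ?thesis by (simp add: y_def)
qed

subsection \<open>Gap instances\<close>

lemma radial_hat:
  fixes d :: nat
  defines "h \<equiv> \<lambda>x i. x i / nrm d x"
  shows "(\<Sum>i<d. (h x i)\<^sup>2) \<le> 1" "(\<Sum>i<d. h x i * x i) = nrm d x" "nrm d x \<noteq> 0 \<Longrightarrow> (\<Sum>i<d. (h x i)\<^sup>2) = 1"
proof -
  have e: "(\<Sum>i<d. (h x i)\<^sup>2) = (nrm d x)\<^sup>2 / (nrm d x)\<^sup>2"
    unfolding h_def by (simp only: power_divide sum_divide_distrib[symmetric] nrm_sq)
  then show "(\<Sum>i<d. (h x i)\<^sup>2) \<le> 1" by (simp add: divide_le_eq_1)
  show "(\<Sum>i<d. (h x i)\<^sup>2) = 1" if "nrm d x \<noteq> 0" using e that by simp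
  have "(\<Sum>i<d. h x i * x i) = (nrm d x)\<^sup>2 / nrm d x"
    unfolding h_def nrm_sq sum_divide_distrib by (intro sum.cong refl) (simp add: power2_eq_square)
  then show "(\<Sum>i<d. h x i * x i) = nrm d x" by (simp add: power2_eq_square)
qed

text \<open>In dimension 3 the field \<open>f_opt3\<close> is itself the radial field, so the radial
  bound applies with d + 2 = 5.\<close>

lemma gp_corr_le_linear:
  assumes \<rho>: "\<bar>\<rho>\<bar> \<le> 1"
  shows "gp_corr \<rho> \<le> \<rho> + 2 * (1 - \<rho>) / 5"
proof -
  define h where "h x i = x i / nrm 3 x" for x :: "nat \<Rightarrow> real" and i
  have n: "norm (vector [x 0, x 1, x 2] :: real^3) = nrm 3 x" for x :: "nat \<Rightarrow> real"
    by (simp add: norm_eq_sqrt_inner inner_vec_def sum_3 nrm_def sum_lessThan_3 power2_eq_square)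
  have "inner (f_opt3 x) (f_opt3 y) = (\<Sum>i<3. h x i * h y i)" for x y
    unfolding f_opt3_def Let_def n h_def by (simp add: inner_vec_def sum_3 sum_lessThan_3)
  then have "gp_corr \<rho> = (\<integral>p. (\<Sum>i<3. h (fst p) i * h (corr 3 \<rho> (fst p) (snd p)) i) \<partial>(gauss 3 \<Otimes>\<^sub>M gauss 3))"
    using Stab_f_opt3[of 3 \<rho>] unfolding Stab_def by simp
  also have "\<dots> \<le> \<rho> + 2 * (1 - \<rho>) / (real 3 + 2)"
  proof (rule radial_stability_le[OF \<rho>])
    show "(\<lambda>x. h x i) \<in> borel_measurable (gauss 3)" if "i < 3" for i
      unfolding h_def using measurable_gauss_component[OF that] by measurable
  qed (use radial_hat[where d=3] in \<open>auto simp: h_def\<close>)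
  finally show ?thesis by simp
qed

text \<open>The bound \<open>-1 \<le> gp_corr (-1)\<close> suffices, as the denominator equals 1 at
  -1.\<close>

lemma gp_ratio_minus_one_le: "gp_ratio (-1) \<le> 1/2"
proof -
  interpret s: prob_space "std_gauss :: (real^3) measure" by (rule prob_space_std_gauss)
  interpret pp: pair_prob_space "std_gauss :: (real^3) measure" "std_gauss :: (real^3) measure" ..
  have m: "(\<lambda>p. hat_inner (fst p) ((-1) *\<^sub>R fst p + sqrt (1 - (-1)\<^sup>2) *\<^sub>R snd p)) \<in> borel_measurable (std_gauss \<Otimes>\<^sub>M std_gauss)"
    by measurable
  have "-1 \<le> gp_corr (-1)" unfolding gp_corr_def
  proof (rule pp.integral_ge_const[OF pp.integrable_const_bound[of _ 1, OF _ m]])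
    show "AE p in std_gauss \<Otimes>\<^sub>M std_gauss. -1 \<le> hat_inner (fst p) ((-1) *\<^sub>R fst p + sqrt (1 - (-1)\<^sup>2) *\<^sub>R snd p)"
    proof (rule AE_I2)
      fix p :: "(real^3) \<times> (real^3)"
      show "-1 \<le> hat_inner (fst p) ((-1) *\<^sub>R fst p + sqrt (1 - (-1)\<^sup>2) *\<^sub>R snd p)"
        using abs_hat_inner_le[of "fst p" "(-1) *\<^sub>R fst p + sqrt (1 - (-1)\<^sup>2) *\<^sub>R snd p"] by linarith
    qed
  qed (use abs_hat_inner_le in auto)
  then show ?thesis by (simp add: gp_ratio_def)
qed

text \<open>For \<rho> \<ge> 0 the linear bound 2/5 + 3\<rho>/5 stays below 1/2 + 3\<rho>/2, the
  value of \<open>gp_corr\<close> at which the ratio would be 1/2.\<close>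

lemma gp_ratio_ge_half:
  assumes "0 \<le> \<rho>" "\<rho> < 1/3"
  shows "1/2 \<le> gp_ratio \<rho>"
proof -
  have "gp_corr \<rho> \<le> \<rho> + 2 * (1 - \<rho>) / 5" using assms by (intro gp_corr_le_linear) auto
  then have "1/2 * (1/4 - 3/4 * \<rho>) \<le> 1/4 - 1/4 * gp_corr \<rho>" using assms(1) by (simp add: field_simps)
  then show ?thesis using assms by (simp only: gp_ratio_def) (subst pos_le_divide_eq, auto)
qed

section \<open>Discretisation of Gaussian space by directions\<close>

definition unit_dir :: "nat \<Rightarrow> (nat \<Rightarrow> real) \<Rightarrow> nat \<Rightarrow> real" where
  "unit_dir d x i = (if d \<le> i then 0 else if nrm d x = 0 then (if i = 0 then 1 else 0) else x i / nrm d x)"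

text \<open>The default direction at the origin makes these identities hold at every point: the
  values serve as SDP vectors, which have to be unit vectors without exception.\<close>

lemma unit_dir:
  assumes d: "d > 0"
  shows "(\<Sum>i<d. (unit_dir d x i)\<^sup>2) = 1" "(\<Sum>i<d. unit_dir d x i * x i) = nrm d x"
proof -
  have "(\<Sum>i<d. (unit_dir d x i)\<^sup>2) = 1 \<and> (\<Sum>i<d. unit_dir d x i * x i) = nrm d x"
  proof (cases "nrm d x = 0")
    case False
    have "(\<Sum>i<d. (unit_dir d x i)\<^sup>2) = (\<Sum>i<d. (x i / nrm d x)\<^sup>2)" "(\<Sum>i<d. unit_dir d x i * x i) = (\<Sum>i<d. x i / nrm d x * x i)"
      using False by (auto intro!: sum.cong simp: unit_dir_def)
    then show ?thesis using radial_hat[where d=d and x=x] False by simp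
  next
    case True
    then have "(\<Sum>i<d. (x i)\<^sup>2) = 0" using nrm_sq[of d x] by simp
    then have x0: "x i = 0" if "i < d" for i using that by (subst (asm) sum_nonneg_eq_0_iff) auto
    have "(\<Sum>i<d. (unit_dir d x i)\<^sup>2) = (\<Sum>i<d. if i = 0 then 1 else 0)"
      using True by (intro sum.cong) (auto simp: unit_dir_def)
    also have "\<dots> = 1" using d by simp
    finally show ?thesis using True x0 by simp
  qed
  then show "(\<Sum>i<d. (unit_dir d x i)\<^sup>2) = 1" "(\<Sum>i<d. unit_dir d x i * x i) = nrm d x" by auto
qed

lemma unit_dir_bound:
  assumes "d > 0"
  shows "\<bar>unit_dir d x i\<bar> \<le> 1"
proof (cases "i < d")
  case True
  then have "(unit_dir d x i)\<^sup>2 \<le> (\<Sum>i<d. (unit_dir d x i)\<^sup>2)" by (intro member_le_sum) auto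
  then show ?thesis using unit_dir(1)[OF assms] by (simp add: abs_square_le_1)
qed (simp add: unit_dir_def)

lemma measurable_unit_dir: "i < d \<Longrightarrow> (\<lambda>x. unit_dir d x i) \<in> borel_measurable (gauss d)"
proof -
  assume i: "i < d"
  have [measurable]: "(\<lambda>x. x i) \<in> borel_measurable (gauss d)" by (rule measurable_gauss_component[OF i])
  have "(\<lambda>x. if nrm d x = 0 then (if i = 0 then 1 else 0) else x i / nrm d x) \<in> borel_measurable (gauss d)"
    by measurable
  then show ?thesis using i by (simp add: unit_dir_def)
qed

text \<open>Directions are rounded to a grid of mesh 1/k by a floor in every coordinate; boundedness
  leaves finitely many grid points, which are numbered. The vector of a cell is the direction of one
  of its points, hence exactly of unit length and coordinatewise within 1/k.\<close>

lemma ex_direction_cells: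
  assumes d: "d > 0" and k: "(k::nat) > 0"
  shows "\<exists>N (cell :: (nat \<Rightarrow> real) \<Rightarrow> nat) s. N > 0 \<and> (\<forall>x. cell x < N) \<and> cell \<in> gauss d \<rightarrow>\<^sub>M count_space UNIV \<and>
    (\<forall>u. (\<Sum>i<d. (s u i)\<^sup>2) = 1 \<and> (\<forall>i\<ge>d. s u i = 0)) \<and> (\<forall>x i. \<bar>s (cell x) i - unit_dir d x i\<bar> \<le> 1 / real k)"
proof -
  define q where "q x = (\<lambda>i\<in>{..<d}. \<lfloor>real k * unit_dir d x i\<rfloor>)" for x
  have qr: "q x \<in> PiE {..<d} (\<lambda>_. {- int k..int k})" for x
  proof -
    have "- int k \<le> \<lfloor>real k * unit_dir d x i\<rfloor> \<and> \<lfloor>real k * unit_dir d x i\<rfloor> \<le> int k" for i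
    proof -
      have b: "- 1 \<le> unit_dir d x i" "unit_dir d x i \<le> 1" using unit_dir_bound[OF d, of x i] by linarith+
      have "real k * (-1) \<le> real k * unit_dir d x i" "real k * unit_dir d x i \<le> real k * 1"
        using b by (intro mult_left_mono; simp)+
      then show ?thesis by (auto simp: le_floor_iff floor_le_iff)
    qed
    then show ?thesis by (auto simp: q_def)
  qed
  define Q where "Q = range q"
  have fQ: "finite Q" unfolding Q_def by (rule finite_subset[of _ "PiE {..<d} (\<lambda>_. {- int k..int k})"]) (use qr in \<open>auto intro!: finite_PiE\<close>)
  obtain e where e: "bij_betw e Q {0..<card Q}" using ex_bij_betw_finite_nat[OF fQ] by blast
  define cell where "cell x = e (q x)" for x
  define s where "s u = unit_dir d (SOME x. cell x = u)" for u
  have N: "card Q > 0" using fQ by (auto simp: card_gt_0_iff Q_def)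
  have c1: "cell x < card Q" for x
    using bij_betw_apply[OF e, of "q x"] by (simp add: cell_def Q_def)
  have inj: "q x = q x'" if "cell x = cell x'" for x x'
    using that e unfolding cell_def bij_betw_def Q_def by (auto simp: inj_on_def)
  have meas: "cell \<in> gauss d \<rightarrow>\<^sub>M count_space UNIV"
  proof (rule iffD2[OF measurable_count_space_eq2_countable])
    show "cell \<in> space (gauss d) \<rightarrow> UNIV \<and> (\<forall>a\<in>UNIV. cell -` {a} \<inter> space (gauss d) \<in> sets (gauss d))"
    proof (intro conjI ballI)
      fix u :: nat
      show "cell -` {u} \<inter> space (gauss d) \<in> sets (gauss d)"
      proof (cases "\<exists>x0. cell x0 = u")
        case False
        then have "cell -` {u} \<inter> space (gauss d) = {}" by auto
        then show ?thesis by simp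
      next
        case True
        then obtain x0 where x0: "cell x0 = u" by blast
        have "cell x = u \<longleftrightarrow> (\<forall>i\<in>{..<d}. real_of_int (q x0 i) \<le> real k * unit_dir d x i \<and> real k * unit_dir d x i < real_of_int (q x0 i) + 1)" for x
        proof -
          have "cell x = u \<longleftrightarrow> q x = q x0" using x0 inj[of x x0] by (auto simp: cell_def)
          also have "\<dots> \<longleftrightarrow> (\<forall>i\<in>{..<d}. \<lfloor>real k * unit_dir d x i\<rfloor> = q x0 i)"
            by (auto simp: q_def fun_eq_iff restrict_def)
          also have "\<dots> \<longleftrightarrow> (\<forall>i\<in>{..<d}. real_of_int (q x0 i) \<le> real k * unit_dir d x i \<and> real k * unit_dir d x i < real_of_int (q x0 i) + 1)"
            by (simp only: floor_eq_iff)
          finally show ?thesis .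
        qed
        then have "cell -` {u} \<inter> space (gauss d) = {x\<in>space (gauss d). \<forall>i\<in>{..<d}. real_of_int (q x0 i) \<le> real k * unit_dir d x i \<and> real k * unit_dir d x i < real_of_int (q x0 i) + 1}"
          by auto
        also have "\<dots> \<in> sets (gauss d)"
        proof (rule sets.sets_Collect_finite_All)
          fix i assume "i \<in> {..<d}"
          then have [measurable]: "(\<lambda>x. unit_dir d x i) \<in> borel_measurable (gauss d)" by (intro measurable_unit_dir) simp
          show "{x \<in> space (gauss d). real_of_int (q x0 i) \<le> real k * unit_dir d x i \<and> real k * unit_dir d x i < real_of_int (q x0 i) + 1} \<in> sets (gauss d)"
            by measurable
        qed simp
        finally show ?thesis .
      qed
    qed simp
  qed
  have close: "\<bar>s (cell x) i - unit_dir d x i\<bar> \<le> 1 / real k" for x i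
  proof (cases "i < d")
    case True
    define x' where "x' = (SOME x'. cell x' = cell x)"
    have "cell x' = cell x" unfolding x'_def by (rule someI[of "\<lambda>x'. cell x' = cell x" x]) simp
    then have "q x' i = q x i" using inj by metis
    then have f: "\<lfloor>real k * unit_dir d x' i\<rfloor> = \<lfloor>real k * unit_dir d x i\<rfloor>" using True by (simp add: q_def)
    have "\<bar>real k * unit_dir d x' i - real k * unit_dir d x i\<bar> \<le> 1"
      using f floor_correct[of "real k * unit_dir d x' i"] floor_correct[of "real k * unit_dir d x i"] by linarith
    then have "real k * \<bar>unit_dir d x' i - unit_dir d x i\<bar> \<le> 1"
      by (simp add: right_diff_distrib[symmetric] abs_mult)
    then show ?thesis using k unfolding s_def x'_def by (simp add: field_simps)
  next
    case False
    then show ?thesis by (simp add: s_def unit_dir_def)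
  qed
  have sn: "(\<Sum>i<d. (s u i)\<^sup>2) = 1 \<and> (\<forall>i\<ge>d. s u i = 0)" for u
    unfolding s_def using unit_dir(1)[OF d] by (simp add: unit_dir_def)
  show ?thesis
    by (intro exI[of _ "card Q"] exI[of _ cell] exI[of _ s]) (use N c1 meas sn close in blast)
qed

text \<open>The diagonal entries may be positive, which amounts to self-loops of the cell
  graph.\<close>

definition cell_weight :: "nat \<Rightarrow> real \<Rightarrow> ((nat \<Rightarrow> real) \<Rightarrow> nat) \<Rightarrow> nat \<Rightarrow> nat \<Rightarrow> real" where
  "cell_weight d \<rho> cell u v = measure (gauss d \<Otimes>\<^sub>M gauss d)
     {p\<in>space (gauss d \<Otimes>\<^sub>M gauss d). cell (fst p) = u \<and> cell (corr d \<rho> (fst p) (snd p)) = v}"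

lemma measurable_corr: "(\<lambda>p. corr d \<rho> (fst p) (snd p)) \<in> gauss d \<Otimes>\<^sub>M gauss d \<rightarrow>\<^sub>M gauss d"
  using measurable_compose[OF measurable_gauss_rot measurable_fst, of d \<rho>] by (simp add: gauss_rot_def)

text \<open>The integrand is a simple function, constant on the events whose probabilities are the
  cell weights.\<close>

lemma integral_cells:
  fixes G :: "nat \<Rightarrow> nat \<Rightarrow> real"
  assumes N: "\<And>x. cell x < N" and m: "cell \<in> gauss d \<rightarrow>\<^sub>M count_space UNIV"
  shows "(\<integral>p. G (cell (fst p)) (cell (corr d \<rho> (fst p) (snd p))) \<partial>(gauss d \<Otimes>\<^sub>M gauss d)) =
     (\<Sum>u<N. \<Sum>v<N. cell_weight d \<rho> cell u v * G u v)"
    and "integrable (gauss d \<Otimes>\<^sub>M gauss d) (\<lambda>p. G (cell (fst p)) (cell (corr d \<rho> (fst p) (snd p))))"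
proof -
  let ?M = "gauss d \<Otimes>\<^sub>M gauss d"
  interpret g: prob_space "gauss d" by (rule prob_space_gauss)
  interpret gg: pair_prob_space "gauss d" "gauss d" ..
  define A where "A u v = {p\<in>space ?M. cell (fst p) = u \<and> cell (corr d \<rho> (fst p) (snd p)) = v}" for u v
  have m1 [measurable]: "(\<lambda>p. cell (fst p)) \<in> ?M \<rightarrow>\<^sub>M count_space UNIV"
    by (rule measurable_compose[OF measurable_fst m])
  have m2 [measurable]: "(\<lambda>p. cell (corr d \<rho> (fst p) (snd p))) \<in> ?M \<rightarrow>\<^sub>M count_space UNIV"
    by (rule measurable_compose[OF measurable_corr m])
  have Am: "A u v \<in> sets ?M" for u v unfolding A_def by measurable
  have e: "G (cell (fst p)) (cell (corr d \<rho> (fst p) (snd p))) = (\<Sum>u<N. \<Sum>v<N. G u v * indicator (A u v) p)" if "p \<in> space ?M" for p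
  proof -
    have "(\<Sum>u<N. \<Sum>v<N. G u v * indicator (A u v) p) =
      (\<Sum>u<N. \<Sum>v<N. if v = cell (corr d \<rho> (fst p) (snd p)) then (if u = cell (fst p) then G u v else 0) else 0)"
      using that by (intro sum.cong refl) (auto simp: A_def indicator_def)
    also have "\<dots> = (\<Sum>u<N. if u = cell (fst p) then G u (cell (corr d \<rho> (fst p) (snd p))) else 0)"
      using N by (intro sum.cong refl) (subst sum.delta, auto)
    also have "\<dots> = G (cell (fst p)) (cell (corr d \<rho> (fst p) (snd p)))" using N by (subst sum.delta) auto
    finally show ?thesis ..
  qed
  have I: "integrable ?M (\<lambda>p. G u v * indicator (A u v) p)" for u v
    using Am by (intro integrable_mult_right integrable_real_indicator) (auto simp: gg.emeasure_finite less_top[symmetric])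
  show "integrable ?M (\<lambda>p. G (cell (fst p)) (cell (corr d \<rho> (fst p) (snd p))))"
    by (subst Bochner_Integration.integrable_cong[OF refl e]) (assumption, intro Bochner_Integration.integrable_sum I)
  have "(\<integral>p. G (cell (fst p)) (cell (corr d \<rho> (fst p) (snd p))) \<partial>?M) = (\<integral>p. (\<Sum>u<N. \<Sum>v<N. G u v * indicator (A u v) p) \<partial>?M)"
    by (rule Bochner_Integration.integral_cong[OF refl e])
  also have "\<dots> = (\<Sum>u<N. \<integral>p. (\<Sum>v<N. G u v * indicator (A u v) p) \<partial>?M)"
    by (intro Bochner_Integration.integral_sum Bochner_Integration.integrable_sum I)
  also have "\<dots> = (\<Sum>u<N. \<Sum>v<N. \<integral>p. G u v * indicator (A u v) p \<partial>?M)"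
    by (intro sum.cong refl Bochner_Integration.integral_sum I)
  also have "\<dots> = (\<Sum>u<N. \<Sum>v<N. cell_weight d \<rho> cell u v * G u v)"
    using Am by (intro sum.cong refl) (simp add: cell_weight_def A_def[symmetric] sets.Int_space_eq2 mult.commute)
  finally show "(\<integral>p. G (cell (fst p)) (cell (corr d \<rho> (fst p) (snd p))) \<partial>?M) =
     (\<Sum>u<N. \<Sum>v<N. cell_weight d \<rho> cell u v * G u v)" .
qed

text \<open>A choice of one ball vector per cell is a piecewise constant field, whose stability is
  the weighted sum over pairs of cells. The hypothesis about all measurable fields thus becomes a
  statement about a finite weighted graph.\<close>

lemma H3_cells:
  assumes H3 and d: "3 \<le> d" and \<rho>: "\<rho> \<in> {-1..0}"
    and N: "\<And>x. cell x < N" and m: "cell \<in> gauss d \<rightarrow>\<^sub>M count_space UNIV"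
    and g: "\<And>u. u < N \<Longrightarrow> (\<Sum>j<3. (g u j)\<^sup>2) \<le> 1"
  shows "gp_corr \<rho> \<le> (\<Sum>u<N. \<Sum>v<N. cell_weight d \<rho> cell u v * (\<Sum>j<(3::nat). g u j * g v j))"
proof -
  define f where "f x = (vector [g (cell x) 0, g (cell x) 1, g (cell x) 2] :: real^3)" for x
  have ip: "inner (f x) (f y) = (\<Sum>j<3. g (cell x) j * g (cell y) j)" for x y
    by (simp add: f_def inner_vec_def sum_3 sum_lessThan_3)
  have "f \<in> borel_measurable (gauss d)"
    unfolding f_def by (rule measurable_compose[OF m]) simp
  then have fm: "f \<in> borel_measurable (PiM {..<d} (\<lambda>_. borel))" by (simp add: measurable_cong_sets[OF sets_gauss refl])
  have fn: "norm (f x) \<le> 1" for x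
    using g[OF N, of x] by (simp add: norm_eq_sqrt_inner ip power2_eq_square)
  have "Stab d \<rho> f_opt3 \<le> Stab d \<rho> f"
    using \<open>H3\<close>[unfolded H3_def, rule_format, OF d \<rho>, of f] fm fn by blast
  also have "Stab d \<rho> f = (\<Sum>u<N. \<Sum>v<N. cell_weight d \<rho> cell u v * (\<Sum>j<(3::nat). g u j * g v j))"
    unfolding Stab_def ip by (rule integral_cells(1)[OF N m])
  finally show ?thesis by (simp add: Stab_f_opt3[OF d])
qed

text \<open>Replacing both directions by cell vectors costs 2\<delta> per coordinate, since all
  entries are at most 1 in modulus; the remaining integral is bounded by
  \<open>radial_stability_le\<close>.\<close>

lemma cells_inner_le:
  assumes \<rho>: "\<bar>\<rho>\<bar> \<le> 1" and d: "d > 0" and N: "\<And>x. cell x < N" and m: "cell \<in> gauss d \<rightarrow>\<^sub>M count_space UNIV"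
    and s: "\<And>u. (\<Sum>i<d. (s u i)\<^sup>2) = 1" and close: "\<And>x i. \<bar>s (cell x) i - unit_dir d x i\<bar> \<le> \<delta>"
  shows "(\<Sum>u<N. \<Sum>v<N. cell_weight d \<rho> cell u v * (\<Sum>i<d. s u i * s v i)) \<le> \<rho> + 2 * (1 - \<rho>) / (real d + 2) + 2 * real d * \<delta>"
proof -
  let ?M = "gauss d \<Otimes>\<^sub>M gauss d"
  interpret g: prob_space "gauss d" by (rule prob_space_gauss)
  interpret gg: pair_prob_space "gauss d" "gauss d" ..
  define y where "y p = corr d \<rho> (fst p) (snd p)" for p
  define D where "D p = (\<Sum>i<d. unit_dir d (fst p) i * unit_dir d (y p) i)" for p
  have sb: "\<bar>s u i\<bar> \<le> 1" if "i < d" for u i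
  proof -
    have "(s u i)\<^sup>2 \<le> (\<Sum>i<d. (s u i)\<^sup>2)" using that by (intro member_le_sum) auto
    then show ?thesis using s by (simp add: abs_square_le_1)
  qed
  have \<delta>: "\<delta> \<ge> 0" using close[of undefined undefined] by linarith
  have pt: "(\<Sum>i<d. s (cell (fst p)) i * s (cell (y p)) i) \<le> D p + 2 * real d * \<delta>" for p
  proof -
    have "(\<Sum>i<d. s (cell (fst p)) i * s (cell (y p)) i) \<le> (\<Sum>i<d. unit_dir d (fst p) i * unit_dir d (y p) i + 2 * \<delta>)"
    proof (intro sum_mono)
      fix i assume "i \<in> {..<d}"
      then have i: "i < d" by simp
      define a a' b b' where "a = s (cell (fst p)) i" and "a' = s (cell (y p)) i"
        and "b = unit_dir d (fst p) i" and "b' = unit_dir d (y p) i"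
      have "a * a' - b * b' = (a - b) * a' + b * (a' - b')" by (simp add: algebra_simps)
      also have "\<dots> \<le> \<bar>a - b\<bar> * \<bar>a'\<bar> + \<bar>b\<bar> * \<bar>a' - b'\<bar>"
        using abs_ge_self[of "(a - b) * a'"] abs_ge_self[of "b * (a' - b')"] unfolding abs_mult by (rule add_mono)
      also have "\<dots> \<le> \<delta> * 1 + 1 * \<delta>"
        unfolding a_def a'_def b_def b'_def
        by (intro add_mono mult_mono close sb[OF i] unit_dir_bound[OF d]) (auto simp: \<delta>)
      finally show "s (cell (fst p)) i * s (cell (y p)) i \<le> unit_dir d (fst p) i * unit_dir d (y p) i + 2 * \<delta>"
        unfolding a_def a'_def b_def b'_def by simp
    qed
    then show ?thesis by (simp add: D_def sum.distrib algebra_simps)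
  qed
  have um: "(\<lambda>p. unit_dir d (fst p) i) \<in> borel_measurable ?M" "(\<lambda>p. unit_dir d (y p) i) \<in> borel_measurable ?M" if "i < d" for i
    unfolding y_def
    by (rule measurable_compose[OF measurable_fst measurable_unit_dir[OF that]], rule measurable_compose[OF measurable_corr measurable_unit_dir[OF that]])
  have DI: "integrable ?M D"
    unfolding D_def[abs_def]
  proof (intro Bochner_Integration.integrable_sum)
    fix i assume "i \<in> {..<d}"
    then have i: "i < d" by simp
    show "integrable ?M (\<lambda>p. unit_dir d (fst p) i * unit_dir d (y p) i)"
    proof (rule gg.integrable_const_bound[of _ 1])
      show "AE p in ?M. norm (unit_dir d (fst p) i * unit_dir d (y p) i) \<le> 1"
        using unit_dir_bound[OF d] by (intro AE_I2) (simp add: abs_mult mult_le_one)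
      show "(\<lambda>p. unit_dir d (fst p) i * unit_dir d (y p) i) \<in> borel_measurable ?M"
        using um[OF i] by (rule borel_measurable_times)
    qed
  qed
  have "(\<Sum>u<N. \<Sum>v<N. cell_weight d \<rho> cell u v * (\<Sum>i<d. s u i * s v i)) = (\<integral>p. (\<Sum>i<d. s (cell (fst p)) i * s (cell (y p)) i) \<partial>?M)"
    unfolding y_def by (rule integral_cells(1)[OF N m, symmetric])
  also have "\<dots> \<le> (\<integral>p. D p + 2 * real d * \<delta> \<partial>?M)"
  proof (rule integral_mono)
    show "integrable ?M (\<lambda>p. \<Sum>i<d. s (cell (fst p)) i * s (cell (y p)) i)"
      unfolding y_def by (rule integral_cells(2)[OF N m])
  qed (use DI pt in auto)
  also have "\<dots> = (\<integral>p. D p \<partial>?M) + 2 * real d * \<delta>" using DI by (simp add: gg.prob_space)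
  also have "(\<integral>p. D p \<partial>?M) \<le> \<rho> + 2 * (1 - \<rho>) / (real d + 2)"
    unfolding D_def y_def
    by (rule radial_stability_le[OF \<rho> d measurable_unit_dir]) (use unit_dir[OF d] in auto)
  finally show ?thesis by simp
qed

text \<open>All copies in a cloud share the vector of their cell. The dropped diagonal pairs have
  inner product 1, so before renormalisation their removal only lowers the sum. The condition
  \<open>d \<le> N * M\<close> fits the vectors into the dimension that the SDP permits.\<close>

lemma SDP_blowup_ge:
  assumes M: "M > 1" and W: "\<And>u v. 0 \<le> W u v" "(\<Sum>u<N. \<Sum>v<N. W u v) = 1"
    and d: "d \<le> N * M" and s: "\<And>u. (\<Sum>i<d. (s u i)\<^sup>2) = 1" "\<And>u i. d \<le> i \<Longrightarrow> s u i = 0"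
    and B: "(\<Sum>u<N. \<Sum>v<N. W u v * (\<Sum>i<d. s u i * s v i)) \<le> B"
  shows "1/4 - 3/4 * (B / loop_defect N M W) \<le> SDP_QMC (N*M) (blowup N M W)"
proof -
  define n where "n = N * M"
  define f where "f p = s (p div M)" for p
  have ext: "(\<Sum>i<n. s u i * s v i) = (\<Sum>i<d. s u i * s v i)" for u v
    using d s(2) unfolding n_def by (intro sum.mono_neutral_right) auto
  have "(\<Sum>i<n. (f p i)\<^sup>2) = 1" for p
    using ext[of "p div M" "p div M"] s(1)[of "p div M"] by (simp add: f_def power2_eq_square)
  moreover have "f p i = 0" if "n \<le> i" for p i using that d s(2) by (simp add: f_def n_def)
  ultimately have f: "f \<in> sphere_maps n" by (auto simp: sphere_maps_def)
  define G where "G p q = (\<Sum>i<n. f p i * f q i)" for p q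
  have Guv: "G (u * M + a) (v * M + b) = (\<Sum>i<d. s u i * s v i)" if "a < M" "b < M" for u v a b
    using that M unfolding G_def f_def by (simp add: ext)
  have wg: "weighted_graph n (blowup N M W)" unfolding n_def by (rule weighted_graph_blowup[OF M W])
  have symG: "G p q = G q p" for p q unfolding G_def by (simp add: mult.commute)
  have M0: "real M > 0" using M by simp
  have ld: "loop_defect N M W > 0" by (rule loop_defect_pos[OF M W])
  have "(\<Sum>e\<in>edges n. blowup N M W e * G (fst e) (snd e)) =
    ((\<Sum>u<N. \<Sum>v<N. W u v * (\<Sum>i<d. s u i * s v i)) - (\<Sum>u<N. W u u * ((\<Sum>a<M. (\<Sum>i<d. s u i * s u i)) / (real M)\<^sup>2))) / loop_defect N M W"
  proof -
    have "(\<Sum>a<M. \<Sum>b<M. G (u * M + a) (v * M + b)) / (real M)\<^sup>2 = (\<Sum>i<d. s u i * s v i)" for u v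
      using M0 by (simp add: Guv power2_eq_square)
    moreover have "(\<Sum>a<M. G (u * M + a) (u * M + a)) = (\<Sum>a<M. (\<Sum>i<d. s u i * s u i))" for u
      by (intro sum.cong refl) (simp add: Guv)
    ultimately show ?thesis unfolding n_def sum_blowup[OF M W, of G, OF symG] by simp
  qed
  also have "\<dots> \<le> B / loop_defect N M W"
  proof (intro divide_right_mono)
    have ss: "(\<Sum>i<d. s u i * s u i) = 1" for u using s(1)[of u] by (simp add: power2_eq_square)
    have "0 \<le> (\<Sum>u<N. W u u * ((\<Sum>a<M. (\<Sum>i<d. s u i * s u i)) / (real M)\<^sup>2))"
      unfolding ss by (intro sum_nonneg mult_nonneg_nonneg divide_nonneg_nonneg W) auto
    then show "(\<Sum>u<N. \<Sum>v<N. W u v * (\<Sum>i<d. s u i * s v i)) - (\<Sum>u<N. W u u * ((\<Sum>a<M. (\<Sum>i<d. s u i * s u i)) / (real M)\<^sup>2)) \<le> B"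
      using B by linarith
  qed (use ld in simp)
  finally have le: "(\<Sum>e\<in>edges n. blowup N M W e * G (fst e) (snd e)) \<le> B / loop_defect N M W" .
  have "sdp_value n (blowup N M W) f = 1/4 * (\<Sum>e\<in>edges n. blowup N M W e) - 3/4 * (\<Sum>e\<in>edges n. blowup N M W e * G (fst e) (snd e))"
    unfolding sdp_value_def G_def[symmetric] sum_distrib_left sum_subtractf[symmetric]
    by (intro sum.cong refl) (simp add: right_diff_distrib)
  also have "(\<Sum>e\<in>edges n. blowup N M W e) = 1" using wg by (simp add: weighted_graph_def)
  finally have "1/4 - 3/4 * (B / loop_defect N M W) \<le> sdp_value n (blowup N M W) f" using le by simp
  also have "\<dots> \<le> SDP_QMC n (blowup N M W)" by (rule SDP_QMC_ge[OF wg f])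
  finally show ?thesis by (simp only: n_def)
qed

text \<open>\<open>I\<close> stands for any nonnegative lower bound on the ratios. It is applied to
  the blown-up cell graphs, and the number M of copies tends to infinity while d, the cells, \<eta>
  and K stay fixed; every correction carries M in its denominator and disappears.\<close>

lemma ratio_bound_step:
  assumes H3 and \<rho>: "\<rho> \<in> {-1..0}" and d: "3 \<le> d" and \<eta>: "\<eta> > 0"
    and I: "0 \<le> I" "\<And>n w. weighted_graph n w \<Longrightarrow> I * SDP_QMC n w \<le> QMaxCut n w"
  shows "I * (1/4 - 3/4 * (\<rho> + 6 / real d)) \<le> 1/4 - 1/4 * (gp_corr \<rho> - \<eta>)"
proof -
  define F where "F = gp_corr \<rho>"
  have d0: "d > 0" using d by simp
  have dd: "d * d > 0" using d0 by simp
  obtain N and cell :: "(nat \<Rightarrow> real) \<Rightarrow> nat" and s where N0: "N > 0" and N': "\<forall>x. cell x < N" and m: "cell \<in> gauss d \<rightarrow>\<^sub>M count_space UNIV"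
    and s': "\<forall>u. (\<Sum>i<d. (s u i)\<^sup>2) = 1 \<and> (\<forall>i\<ge>d. s u i = 0)"
    and close': "\<forall>x i. \<bar>s (cell x) i - unit_dir d x i\<bar> \<le> 1 / real (d * d)"
    using ex_direction_cells[OF d0 dd] by blast
  have N: "cell x < N" for x using N' by blast
  have s: "(\<Sum>i<d. (s u i)\<^sup>2) = 1" "d \<le> i \<Longrightarrow> s u i = 0" for u i using s' by blast+
  have close: "\<bar>s (cell x) i - unit_dir d x i\<bar> \<le> 1 / real (d * d)" for x i using close' by blast
  define W where "W = cell_weight d \<rho> cell"
  have W: "\<And>u v. 0 \<le> W u v" "(\<Sum>u<N. \<Sum>v<N. W u v) = 1"
  proof -
    interpret g: prob_space "gauss d" by (rule prob_space_gauss)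
    interpret gg: pair_prob_space "gauss d" "gauss d" ..
    show "0 \<le> W u v" for u v by (simp add: W_def cell_weight_def)
    show "(\<Sum>u<N. \<Sum>v<N. W u v) = 1"
      using integral_cells(1)[where G="\<lambda>_ _. 1" and d=d and \<rho>=\<rho>, OF N m] by (simp add: W_def gg.prob_space)
  qed
  have \<rho>1: "\<bar>\<rho>\<bar> \<le> 1" using \<rho> by auto
  \<comment> \<open>The radial error is at most 4/d because 1 - \<rho> \<le> 2, and mesh 1/d^2 makes
    the quantisation error 2/d.\<close>
  have B: "(\<Sum>u<N. \<Sum>v<N. W u v * (\<Sum>i<d. s u i * s v i)) \<le> \<rho> + 6 / real d"
  proof -
    have "(\<Sum>u<N. \<Sum>v<N. W u v * (\<Sum>i<d. s u i * s v i)) \<le> \<rho> + 2 * (1 - \<rho>) / (real d + 2) + 2 * real d * (1 / real (d * d))"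
      unfolding W_def by (rule cells_inner_le[OF \<rho>1 d0 N m s(1) close])
    moreover have "2 * (1 - \<rho>) / (real d + 2) \<le> 4 / real d" using \<rho> d0 by (intro frac_le) auto
    moreover have "2 * real d * (1 / real (d * d)) = 2 / real d" using d0 by simp
    moreover have "4 / real d + 2 / real d = 6 / real d" by (simp add: add_divide_distrib[symmetric])
    ultimately show ?thesis by linarith
  qed
  have FW: "F \<le> (\<Sum>u<N. \<Sum>v<N. W u v * (\<Sum>j<(3::nat). g u j * g v j))"
    if "\<And>u. u < N \<Longrightarrow> (\<Sum>j<3. (g u j)\<^sup>2) \<le> 1" for g
    unfolding F_def W_def by (rule H3_cells[OF \<open>H3\<close> d \<rho> N m that])
  obtain K :: nat where K: "81 / \<eta>\<^sup>2 < real K" using reals_Archimedean2 by blast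
  then have K': "81 < real K * \<eta>\<^sup>2" using \<eta> by (simp add: field_simps)
  define c where "c = (\<Sum>u<N. W u u)"
  \<comment> \<open>The condition \<open>M \<ge> d + 2\<close> secures both M > 1 and room for
    d-dimensional vectors.\<close>
  have main: "I * (1/4 - 3/4 * ((\<rho> + 6 / real d) / (1 - c / real M))) \<le>
     1/4 - 1/4 * (((1 + 3 * real (K * N) / real M)\<^sup>2 * F - \<eta> - 9 / real M) / (1 - c / real M))"
    if M: "M \<ge> d + 2" for M
  proof -
    have M1: "M > 1" using M by simp
    have "d \<le> 1 * M" using M by simp
    also have "1 * M \<le> N * M" using N0 by (intro mult_le_mono) auto
    finally have dM: "d \<le> N * M" .
    have ld: "loop_defect N M W = 1 - c / real M" by (simp add: loop_defect_def c_def)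
    have "I * (1/4 - 3/4 * ((\<rho> + 6 / real d) / loop_defect N M W)) \<le> I * SDP_QMC (N*M) (blowup N M W)"
      by (intro mult_left_mono SDP_blowup_ge[OF M1 W dM s B] I(1))
    also have "\<dots> \<le> QMaxCut (N*M) (blowup N M W)" by (intro I(2) weighted_graph_blowup[OF M1 W])
    also have "\<dots> \<le> 1/4 - 1/4 * (((1 + 3 * real (K * N) / real M)\<^sup>2 * F - \<eta> - 9 / real M) / loop_defect N M W)"
      by (rule QMaxCut_blowup_le[OF M1 W FW \<eta> K'])
    finally show ?thesis unfolding ld .
  qed
  have lim0: "(\<lambda>M. a / real M) \<longlonglongrightarrow> 0" for a :: real by (rule lim_const_over_n)
  have "(\<lambda>M. I * (1/4 - 3/4 * ((\<rho> + 6 / real d) / (1 - c / real M)))) \<longlonglongrightarrow> I * (1/4 - 3/4 * ((\<rho> + 6 / real d) / (1 - 0)))"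
    by (intro tendsto_intros lim0) simp
  moreover have "(\<lambda>M. 1/4 - 1/4 * (((1 + 3 * real (K * N) / real M)\<^sup>2 * F - \<eta> - 9 / real M) / (1 - c / real M)))
     \<longlonglongrightarrow> 1/4 - 1/4 * (((1 + 0)\<^sup>2 * F - \<eta> - 0) / (1 - 0))"
    by (intro tendsto_intros lim0) simp
  ultimately have "I * (1/4 - 3/4 * ((\<rho> + 6 / real d) / (1 - 0))) \<le> 1/4 - 1/4 * (((1 + 0)\<^sup>2 * F - \<eta> - 0) / (1 - 0))"
    by (rule LIMSEQ_le) (intro exI[of _ "d + 2"] allI impI main)
  then show ?thesis by (simp add: F_def)
qed

lemma le_gp_ratio_nonpos:
  assumes H3 and \<rho>: "\<rho> \<in> {-1..0}"
    and I: "0 \<le> I" "\<And>n w. weighted_graph n w \<Longrightarrow> I * SDP_QMC n w \<le> QMaxCut n w"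
  shows "I \<le> gp_ratio \<rho>"
proof -
  have 1: "I * (1/4 - 3/4 * (\<rho> + 6 / real d)) \<le> 1/4 - 1/4 * gp_corr \<rho>" if d: "3 \<le> d" for d
  \<comment> \<open>An error \<eta> in the correlation is an error \<eta>/4 in the energy, hence the
    choice \<eta> = 4e.\<close>
  proof (rule field_le_epsilon)
    fix e :: real assume "e > 0"
    then show "I * (1/4 - 3/4 * (\<rho> + 6 / real d)) \<le> 1/4 - 1/4 * gp_corr \<rho> + e"
      using ratio_bound_step[OF assms(1) \<rho> d, of "4 * e", OF _ I] by (simp add: diff_divide_distrib)
  qed
  have "(\<lambda>d. I * (1/4 - 3/4 * (\<rho> + 6 / real d))) \<longlonglongrightarrow> I * (1/4 - 3/4 * (\<rho> + 0))"
    by (intro tendsto_intros lim_const_over_n)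
  then have "I * (1/4 - 3/4 * (\<rho> + 0)) \<le> 1/4 - 1/4 * gp_corr \<rho>"
    by (rule LIMSEQ_le_const2) (intro exI[of _ 3] allI impI 1)
  then show ?thesis using \<rho> by (simp add: gp_ratio_def pos_le_divide_eq)
qed

theorem theorem2p7:
  assumes "H3"
  shows "(INF (n, w) \<in> {(n, w). weighted_graph n w}. QMaxCut n w / SDP_QMC n w) = alpha_GP"
proof -
  define S where "S = {(n, w). weighted_graph n w}"
  define R where "R = (\<lambda>(n, w). QMaxCut n w / SDP_QMC n w)"
  have S: "(n, w) \<in> S \<longleftrightarrow> weighted_graph n w" for n w by (simp add: S_def)
  have R_ge: "alpha_GP \<le> R x" if "x \<in> S" for x
    using that QMaxCut_ratio_ge by (cases x) (simp add: S R_def)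
  \<comment> \<open>A single edge: over a nonempty set that is bounded below by
    \<open>alpha_GP\<close>, the real-valued \<open>INF\<close> is a true infimum.\<close>
  have "weighted_graph 2 (\<lambda>_. 1)"
  proof -
    have "edges 2 = {(0, 1)}" by (auto simp: edges_def)
    then show ?thesis by (simp add: weighted_graph_def)
  qed
  then have ne: "S \<noteq> {}" using S by blast
  define I where "I = (INF x\<in>S. R x)"
  have aI: "alpha_GP \<le> I" unfolding I_def by (rule cINF_greatest[OF ne R_ge])
  have I0: "0 \<le> I" using aI alpha_GP_nonneg by simp
  have I_le: "I * SDP_QMC n w \<le> QMaxCut n w" if w: "weighted_graph n w" for n w
  proof -
    have "I \<le> R (n, w)" unfolding I_def
      by (rule cINF_lower) (use w R_ge in \<open>auto simp: S intro!: bdd_belowI[of _ alpha_GP]\<close>)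
    then show ?thesis using SDP_QMC_pos[OF w] by (simp add: R_def pos_le_divide_eq)
  qed
  have "I \<le> gp_ratio \<rho>" if \<rho>: "\<rho> \<in> {-1..<1/3}" for \<rho>
  proof (cases "\<rho> \<le> 0")
    case True
    then show ?thesis using \<rho> by (intro le_gp_ratio_nonpos[OF assms _ I0 I_le]) auto
  next
    \<comment> \<open>The hypothesis is silent for positive \<rho>. The instances for \<rho> = -1
      already force the infimum down to 1/2, and no positive \<rho> in the range goes below
      that.\<close>
    case False
    have "I \<le> gp_ratio (-1)" by (rule le_gp_ratio_nonpos[OF assms _ I0 I_le]) auto
    also have "\<dots> \<le> 1/2" by (rule gp_ratio_minus_one_le)
    also have "\<dots> \<le> gp_ratio \<rho>" using False \<rho> by (intro gp_ratio_ge_half) auto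
    finally show ?thesis .
  qed
  then have "I \<le> alpha_GP" unfolding alpha_GP_eq by (intro cINF_greatest) auto
  with aI have "I = alpha_GP" by simp
  then show ?thesis unfolding I_def S_def R_def by simp
qed

end
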